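(* Let $p$ be a prime and let $R$ be a ring with $\mathbb{Z}_{(p)}[X]\subseteq R\subseteq\mathbb{Q}[X]$. Then $R$ is a UFD if and only if either $R=\mathbb{Q}[X]$ or $R=W\cap\mathbb{Q}[X]$ for some DVR $W$ of $\mathbb{Q}(X)$ with $W\cap\mathbb{Q}=\mathbb{Z}_{(p)}$ which is unramified over $\mathbb{Z}_{(p)}$. Moreover, the latter case holds if and only if there is an admissible pair $(\alpha,\delta)\in\mathbb{O}_p^{\mathrm{br}}\times(\mathbb{Z}_{\ge0}\cup\{\infty\})$ with $\alpha$ unramified over $\mathbb{Q}_p$ such that $R=\mathrm{Int}_{\mathbb{Q}}(\bar B_p(\alpha,\delta),\mathbb{O}_p)$.
   Context: Fix a prime $p$. $\overline{\mathbb{Q}_p}$ is an algebraic closure of $\mathbb{Q}_p$, $v_p$ the unique extension of the $p$-adic valuation, $\mathbb{C}_p$ the completion of $\overline{\mathbb{Q}_p}$, $\mathbb{O}_p=\{x\in\mathbb{C}_p:v_p(x)\ge0\}$. $\mathbb{C}_p^{\mathrm{br}}$ is the set of $\alpha\in\mathbb{C}_p$ such that the ramification index of $\mathbb{Q}_p(\alpha)/\mathbb{Q}_p$ (index of $\mathbb{Z}$ in $v_p(\mathbb{Q}_p(\alpha)^* )$) is finite; $\alpha$ is unramified over $\mathbb{Q}_p$ if this index is $1$; $\mathbb{O}_p^{\mathrm{br}}=\mathbb{O}_p\cap\mathbb{C}_p^{\mathrm{br}}$. A pair $(\alpha,\delta)\in\mathbb{C}_p\times(\mathbb{Q}\cup\{\infty\})$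 is admissible if: when $\delta\in\mathbb{Q}$, $\alpha\in\overline{\mathbb{Q}_p}$; when $\delta=\infty$, $\alpha$ is transcendental over $\mathbb{Q}$. $\bar B_p(\alpha,\delta)=\{x\in\mathbb{C}_p:v_p(x-\alpha)\ge\delta\}$ (equal to $\{\alpha\}$ if $\delta=\infty$). For $E\subseteq\mathbb{C}_p$, $\mathrm{Int}_{\mathbb{Q}}(E,\mathbb{O}_p)=\{f\in\mathbb{Q}[X]:f(x)\in\mathbb{O}_p\ \forall x\in E\}$. A DVR $W$ over $\mathbb{Z}_{(p)}$ is unramified if the value group of $\mathbb{Z}_{(p)}$ equals that of $W$. *)

theory Defs
  imports "HOL-Computational_Algebra.Computational_Algebra"
          "HOL-Library.Extended_Real" "HOL-Library.Extended_Nat" "HOL-Library.Multiset"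
begin

definition padic_val_rat :: "nat \<Rightarrow> rat \<Rightarrow> int" where
  "padic_val_rat p q = (case quotient_of q of (a, b) \<Rightarrow>
      int (multiplicity (int p) a) - int (multiplicity (int p) b))"

definition Zloc :: "nat \<Rightarrow> rat set" where
  "Zloc p = {q. \<not> int p dvd snd (quotient_of q)}"

definition Zloc_poly :: "nat \<Rightarrow> rat poly set" where
  "Zloc_poly p = {f. \<forall>i. coeff f i \<in> Zloc p}"

definition is_subring :: "'a::comm_ring_1 set \<Rightarrow> bool" where
  "is_subring R \<longleftrightarrow> 0 \<in> R \<and> 1 \<in> R \<and> (\<forall>a\<in>R. \<forall>b\<in>R. a + b \<in> R \<and> a - b \<in> R \<and> a * b \<in> R)"

definition unit_in :: "'a::comm_ring_1 set \<Rightarrow> 'a \<Rightarrow> bool" where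
  "unit_in R u \<longleftrightarrow> u \<in> R \<and> (\<exists>w\<in>R. u * w = 1)"

definition dvd_in :: "'a::comm_ring_1 set \<Rightarrow> 'a \<Rightarrow> 'a \<Rightarrow> bool" where
  "dvd_in R a b \<longleftrightarrow> (\<exists>c\<in>R. b = a * c)"

definition assoc_in :: "'a::comm_ring_1 set \<Rightarrow> 'a \<Rightarrow> 'a \<Rightarrow> bool" where
  "assoc_in R a b \<longleftrightarrow> dvd_in R a b \<and> dvd_in R b a"

definition irred_in :: "'a::comm_ring_1 set \<Rightarrow> 'a \<Rightarrow> bool" where
  "irred_in R a \<longleftrightarrow> a \<in> R \<and> a \<noteq> 0 \<and> \<not> unit_in R a \<and>
     (\<forall>b\<in>R. \<forall>c\<in>R. a = b * c \<longrightarrow> unit_in R b \<or> unit_in R c)"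

definition is_UFD :: "'a::idom set \<Rightarrow> bool" where
  "is_UFD R \<longleftrightarrow>
     (\<forall>a\<in>R. a \<noteq> 0 \<and> \<not> unit_in R a \<longrightarrow>
        (\<exists>xs. xs \<noteq> [] \<and> (\<forall>x\<in>set xs. irred_in R x) \<and> prod_list xs = a)) \<and>
     (\<forall>xs ys. (\<forall>x\<in>set xs. irred_in R x) \<and> (\<forall>y\<in>set ys. irred_in R y) \<and>
        prod_list xs = prod_list ys \<longrightarrow>
        (\<exists>zs. mset zs = mset ys \<and> list_all2 (assoc_in R) xs zs))"

abbreviation embP :: "rat poly \<Rightarrow> rat poly fract" where
  "embP f \<equiv> Fract f 1"

abbreviation embQ :: "rat \<Rightarrow> rat poly fract" where
  "embQ q \<equiv> Fract [:q:] 1"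

definition dvr_valuation :: "'k::field set \<Rightarrow> ('k \<Rightarrow> int) \<Rightarrow> bool" where
  "dvr_valuation W w \<longleftrightarrow>
     (\<forall>x y. x \<noteq> 0 \<and> y \<noteq> 0 \<longrightarrow> w (x * y) = w x + w y) \<and>
     (\<forall>x y. x \<noteq> 0 \<and> y \<noteq> 0 \<and> x + y \<noteq> 0 \<longrightarrow> w (x + y) \<ge> min (w x) (w y)) \<and>
     (\<forall>n. \<exists>x. x \<noteq> 0 \<and> w x = n) \<and>
     W = {x. x = 0 \<or> w x \<ge> 0}"

definition is_DVR_of_QX :: "rat poly fract set \<Rightarrow> bool" where
  "is_DVR_of_QX W \<longleftrightarrow> (\<exists>w. dvr_valuation W w)"

definition DVR_contract_Q :: "rat poly fract set \<Rightarrow> rat set" where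
  "DVR_contract_Q W = {q. embQ q \<in> W}"

definition DVR_contract_QX :: "rat poly fract set \<Rightarrow> rat poly set" where
  "DVR_contract_QX W = {f. embP f \<in> W}"

definition DVR_unramified :: "rat poly fract set \<Rightarrow> bool" where
  "DVR_unramified W \<longleftrightarrow> (\<exists>w. dvr_valuation W w \<and>
     {w (embQ q) | q. q \<noteq> 0} = {w x | x. x \<noteq> 0})"

text \<open>(K, v) is (isometric to) C_p: an algebraically closed field with a
  valuation v (values in R \<union> {\<infinity>}) extending v_p on Q, complete, in which the
  algebraic closure of Q_p (Q_p = closure of Q) is dense.\<close>

definition Qp_in :: "('k::field_char_0 \<Rightarrow> ereal) \<Rightarrow> 'k set" where
  "Qp_in v = {x. \<forall>M::real. \<exists>q::rat. v (x - of_rat q) \<ge> ereal M}"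

definition Qpbar_in :: "('k::field_char_0 \<Rightarrow> ereal) \<Rightarrow> 'k set" where
  "Qpbar_in v = {x. \<exists>f::'k poly. f \<noteq> 0 \<and> (\<forall>i. coeff f i \<in> Qp_in v) \<and> poly f x = 0}"

definition is_Cp_model :: "nat \<Rightarrow> ('k::field_char_0 \<Rightarrow> ereal) \<Rightarrow> bool" where
  "is_Cp_model p v \<longleftrightarrow>
     (\<forall>x. v x = \<infinity> \<longleftrightarrow> x = 0) \<and> (\<forall>x. v x \<noteq> -\<infinity>) \<and>
     (\<forall>x y. v (x * y) = v x + v y) \<and>
     (\<forall>x y. v (x + y) \<ge> min (v x) (v y)) \<and>
     (\<forall>q::rat. q \<noteq> 0 \<longrightarrow> v (of_rat q) = ereal (of_int (padic_val_rat p q))) \<and>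
     (\<forall>f::'k poly. degree f > 0 \<longrightarrow> (\<exists>x. poly f x = 0)) \<and>
     (\<forall>s::nat \<Rightarrow> 'k. (\<forall>M::real. \<exists>N. \<forall>m\<ge>N. \<forall>n\<ge>N. v (s m - s n) \<ge> ereal M) \<longrightarrow>
        (\<exists>L. \<forall>M::real. \<exists>N. \<forall>n\<ge>N. v (s n - L) \<ge> ereal M)) \<and>
     (\<forall>x. \<forall>M::real. \<exists>y\<in>Qpbar_in v. v (x - y) \<ge> ereal M)"

definition Qp_adj :: "('k::field_char_0 \<Rightarrow> ereal) \<Rightarrow> 'k \<Rightarrow> 'k set" where
  "Qp_adj v a = {poly f a / poly g a | f g.
     (\<forall>i. coeff f i \<in> Qp_in v) \<and> (\<forall>i. coeff g i \<in> Qp_in v) \<and> poly g a \<noteq> 0}"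

definition value_group :: "('k::field_char_0 \<Rightarrow> ereal) \<Rightarrow> 'k set \<Rightarrow> real set" where
  "value_group v F = {real_of_ereal (v y) | y. y \<in> F \<and> y \<noteq> 0}"

text \<open>Ramification index: index of Z in v(Q_p(\<alpha>)^*), i.e. the number of cosets
  (card = 0 when infinite).\<close>
definition ram_cosets :: "('k::field_char_0 \<Rightarrow> ereal) \<Rightarrow> 'k \<Rightarrow> real set set" where
  "ram_cosets v a = (\<lambda>g. {g + real_of_int k | k. True}) ` value_group v (Qp_adj v a)"

definition Cp_br :: "('k::field_char_0 \<Rightarrow> ereal) \<Rightarrow> 'k set" where
  "Cp_br v = {a. finite (ram_cosets v a)}"

definition unramified_in :: "('k::field_char_0 \<Rightarrow> ereal) \<Rightarrow> 'k \<Rightarrow> bool" where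
  "unramified_in v a \<longleftrightarrow> card (ram_cosets v a) = 1"

definition Op_in :: "('k::field_char_0 \<Rightarrow> ereal) \<Rightarrow> 'k set" where
  "Op_in v = {x. v x \<ge> 0}"

definition Op_br :: "('k::field_char_0 \<Rightarrow> ereal) \<Rightarrow> 'k set" where
  "Op_br v = Op_in v \<inter> Cp_br v"

definition delta_val :: "enat \<Rightarrow> ereal" where
  "delta_val d = (case d of enat n \<Rightarrow> ereal (real n) | \<infinity> \<Rightarrow> \<infinity>)"

definition transcendental_over_Q :: "'k::field_char_0 \<Rightarrow> bool" where
  "transcendental_over_Q a \<longleftrightarrow> \<not> (\<exists>f::rat poly. f \<noteq> 0 \<and> poly (map_poly of_rat f) a = 0)"

definition admissible :: "('k::field_char_0 \<Rightarrow> ereal) \<Rightarrow> 'k \<Rightarrow> enat \<Rightarrow> bool" where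
  "admissible v a d \<longleftrightarrow> (d \<noteq> \<infinity> \<longrightarrow> a \<in> Qpbar_in v) \<and> (d = \<infinity> \<longrightarrow> transcendental_over_Q a)"

definition closed_ball_p :: "('k::field_char_0 \<Rightarrow> ereal) \<Rightarrow> 'k \<Rightarrow> enat \<Rightarrow> 'k set" where
  "closed_ball_p v a d = {x. v (x - a) \<ge> delta_val d}"

definition Int_Q :: "('k::field_char_0 \<Rightarrow> ereal) \<Rightarrow> 'k set \<Rightarrow> rat poly set" where
  "Int_Q v E = {f. \<forall>x\<in>E. poly (map_poly of_rat f) x \<in> Op_in v}"

end

(*
  All three conditions are compared with one property of R: that p is a prime element of R, with
  no nonzero polynomial divisible by all its powers.  For such R the p-adic order is a discrete
  valuation w on Q(X) with w(p) = 1, and R is its ring of integers in Q[X]; since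
  R[1/p] = Q[X] is factorial, so is R.

  To pass from w to a ball, consider the subring C = O_p[R] of C_p[X].  A flatness argument shows
  that the maximal ideal of O_p generates in C an ideal meeting R in pR, so C has a prime M with
  M inter R = pR, and the localization at M plays the role of an extension of w to C_p[X].
  Starting from the ball of radius 0 around 0 the centre is improved step by step.
  Given (X - a)/p^n integral at M, either the ball (a, n) already gives R, or the residue of
  (X - a)/p^n is algebraic over F_p, and then the next digit is found with the help of
  G_{n+1} = (G_n^q - G_n)/p in R, whose expansion around the new centre is linear with
  unit slope modulo the maximal ideal.  If this never stops, the centres converge to a transcendental
  a with v(f(a)) = w(f).  The ramification of a is controlled by the stability of a ring of integral
  elements under x -> (x^q - x)/p, which forces its nonzero elements to have integer valuations.
*)
theory Submission
  imports Defs
begin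

section \<open>The ring of p-local rational numbers\<close>

text \<open>The obstacle is that \<open>(X - a)/p^n\<close> has coefficients in C_p, while R only
  knows rational polynomials. The polynomials G of a \<open>frobenius_chain\<close> are rational
  stand-ins for this coordinate: on the current ball, G is a unit multiple of it up to smaller
  terms. A new digit has to meet two demands: the centre stays unramified, and the next stand-in
  exists. Both are met by solving G(a') = t exactly, where t is the Teichmueller representative (t^q
  = t) of the residue of G at M. Then G^q - G lies in M, hence in pR, and it vanishes at a', so its
  quotient by p is the next stand-in. The chain also certifies that a' is unramified: its values
  there are integral, are linked by x -> (x^q - x)/p and end in 0. No valuation of C_p(X) is
  constructed. The localization stays inside C_p[X] and is used only through the primality of M, the
  cancellation of factors outside M, and the known traces on the constants and on R. In the limit
  case the formula for |f(a)| gives transcendence and integer valuations at once.\<close>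

lemma Zloc_iff: "q \<in> Zloc p \<longleftrightarrow> (\<exists>a b. \<not> int p dvd b \<and> q = of_int a / of_int b)"
proof
  assume "q \<in> Zloc p"
  then show "\<exists>a b. \<not> int p dvd b \<and> q = of_int a / of_int b"
    by (metis Zloc_def mem_Collect_eq prod.collapse quotient_of_div)
next
  assume "\<exists>a b. \<not> int p dvd b \<and> q = of_int a / of_int b"
  then obtain a b where ab: "\<not> int p dvd b" "q = of_int a / of_int b" by blast
  obtain c d where cd: "quotient_of q = (c, d)" by fastforce
  have d: "d > 0" "coprime c d" "q = of_int c / of_int d"
    using cd quotient_of_denom_pos quotient_of_coprime quotient_of_div by blast+
  have b0: "b \<noteq> 0" using ab by auto
  have "(of_int a :: rat) * of_int d = of_int c * of_int b"
    using ab(2) d b0 by (simp add: field_simps)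
  then have "a * d = c * b" by (metis of_int_eq_iff of_int_mult)
  then have "d dvd c * b" by (metis dvd_triv_right)
  then have "d dvd b" using d(2) by (simp add: coprime_commute coprime_dvd_mult_right_iff)
  then show "q \<in> Zloc p" using ab(1) cd by (auto simp: Zloc_def dest: dvd_trans)
qed

lemma Zloc_mult: assumes "prime p" "x \<in> Zloc p" "y \<in> Zloc p" shows "x * y \<in> Zloc p"
proof -
  obtain a b c d where 1: "\<not> int p dvd b" "x = of_int a / of_int b" "\<not> int p dvd d" "y = of_int c / of_int d"
    using assms(2,3) by (auto simp: Zloc_iff)
  then have "x * y = of_int (a * c) / of_int (b * d)" by (simp add: field_simps)
  moreover have "\<not> int p dvd b * d" using 1 assms(1) by (simp add: prime_dvd_mult_iff)
  ultimately show ?thesis unfolding Zloc_iff by blast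
qed

lemma Zloc_of_int: assumes "prime p" shows "of_int n \<in> Zloc p"
proof -
  have "\<not> int p dvd 1" using assms by (auto dest: not_prime_unit)
  then show ?thesis unfolding Zloc_iff by (intro exI[of _ n] exI[of _ 1]) auto
qed

lemma Zloc_of_nat: "prime p \<Longrightarrow> of_nat n \<in> Zloc p"
  using Zloc_of_int[of p "int n"] by simp

lemma inverse_p_notin_Zloc: assumes "prime p" shows "inverse (of_nat p) \<notin> Zloc p"
proof
  assume "inverse (of_nat p) \<in> Zloc p"
  then obtain a b where ab: "\<not> int p dvd b" "inverse (of_nat p) = (of_int a :: rat) / of_int b"
    by (auto simp: Zloc_iff)
  have "b \<noteq> 0" "p > 0" using ab assms prime_gt_0_nat by auto
  then have "(of_int b :: rat) = of_int (int p * a)" using ab(2) by (simp add: field_simps)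
  then have "b = int p * a" by (metis of_int_eq_iff)
  with ab(1) show False by simp
qed

lemma rat_padic_decomp:
  assumes "prime p" "q \<noteq> 0"
  obtains u where "q = of_nat p powi (padic_val_rat p q) * u" "u \<in> Zloc p" "inverse u \<in> Zloc p"
proof -
  obtain a b where ab: "quotient_of q = (a, b)" by fastforce
  have q: "q = of_int a / of_int b" "b > 0" using ab quotient_of_div quotient_of_denom_pos by blast+
  have a0: "a \<noteq> 0" using q assms by auto
  have np: "\<not> is_unit (int p)" using assms by (auto dest: not_prime_unit)
  obtain a' where a': "a = int p ^ multiplicity (int p) a * a'" "\<not> int p dvd a'"
    using multiplicity_decompose'[OF a0 np] by metis
  obtain b' where b': "b = int p ^ multiplicity (int p) b * b'" "\<not> int p dvd b'"
    using multiplicity_decompose'[of b "int p"] np q(2) by (metis less_irrefl)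
  define i j where ij: "i = multiplicity (int p) a" "j = multiplicity (int p) b"
  have nz: "a' \<noteq> 0" "b' \<noteq> 0" using a' b' by auto
  have p0: "(of_nat p :: rat) \<noteq> 0" using assms(1) prime_gt_0_nat by auto
  have v: "padic_val_rat p q = int i - int j" by (simp add: padic_val_rat_def ab ij)
  have "q = of_nat p ^ i * of_int a' / (of_nat p ^ j * of_int b')"
    using q(1) a'(1) b'(1) ij by (metis of_int_mult of_int_of_nat_eq of_int_power)
  also have "\<dots> = of_nat p powi (padic_val_rat p q) * (of_int a' / of_int b')"
    unfolding v using p0 by (simp add: power_int_diff)
  finally have "q = of_nat p powi (padic_val_rat p q) * (of_int a' / of_int b')" .
  moreover have "of_int a' / of_int b' \<in> Zloc p" "inverse (of_int a' / of_int b') \<in> Zloc p"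
    using a' b' unfolding Zloc_iff inverse_divide by blast+
  ultimately show ?thesis using that by blast
qed

lemma p_power_Zloc_nonneg: assumes "prime p" "k \<ge> 0" shows "of_nat p powi k \<in> Zloc p"
proof -
  have "of_nat p powi k = (of_nat (p ^ nat k) :: rat)" using assms(2) by (simp add: power_int_def)
  then show ?thesis using Zloc_of_nat[OF assms(1)] by metis
qed

lemma padic_nonneg_iff:
  assumes "prime p" "q \<noteq> 0"
  shows "padic_val_rat p q \<ge> 0 \<longleftrightarrow> q \<in> Zloc p"
proof -
  obtain u where u: "q = of_nat p powi (padic_val_rat p q) * u" "u \<in> Zloc p" "inverse u \<in> Zloc p"
    using rat_padic_decomp assms by blast
  have p0: "(of_nat p :: rat) \<noteq> 0" using assms(1) prime_gt_0_nat by auto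
  have u0: "u \<noteq> 0" using u(1) assms(2) by auto
  define k where "k = padic_val_rat p q"
  show ?thesis
  proof
    assume "padic_val_rat p q \<ge> 0"
    then show "q \<in> Zloc p" using u Zloc_mult p_power_Zloc_nonneg assms(1) by metis
  next
    assume q: "q \<in> Zloc p"
    show "padic_val_rat p q \<ge> 0"
    proof (rule ccontr)
      assume "\<not> ?thesis"
      then have k: "-1 - k \<ge> 0" by (simp add: k_def)
      \<comment> \<open>If q had order k < 0, multiplying it by p^(-1-k) and by the inverse unit
        would put 1/p into \<open>Zloc p\<close>.\<close>
      have "inverse (of_nat p) = (of_nat p powi (-1 - k) * q) * inverse u"
        using u(1) u0 p0 unfolding k_def[symmetric] by (simp add: power_int_diff field_simps power_int_minus)
      also have "\<dots> \<in> Zloc p" using k q u(3) assms(1) by (intro Zloc_mult p_power_Zloc_nonneg)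
      finally show False using inverse_p_notin_Zloc assms(1) by blast
    qed
  qed
qed

lemma Zloc_integer_multiple:
  assumes "prime p" shows "\<exists>n. of_nat p ^ n * q \<in> Zloc p"
proof (cases "q = 0")
  case True then show ?thesis using Zloc_of_nat[OF assms, of 0] by auto
next
  case False
  then obtain u where u: "q = of_nat p powi (padic_val_rat p q) * u" "u \<in> Zloc p"
    using rat_padic_decomp assms by blast
  define k where "k = padic_val_rat p q"
  have p0: "(of_nat p :: rat) \<noteq> 0" using assms(1) prime_gt_0_nat by auto
  have "of_nat p ^ nat \<bar>k\<bar> * q = of_nat p powi (\<bar>k\<bar> + k) * u"
    using u(1) p0 unfolding k_def[symmetric] by (simp add: power_int_add power_int_def[of _ "\<bar>k\<bar>"])
  also have "\<dots> \<in> Zloc p" using u(2) assms by (intro Zloc_mult p_power_Zloc_nonneg) auto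
  finally show ?thesis by blast
qed

lemma Zloc_poly_integer_multiple:
  assumes "prime p" shows "\<exists>n. smult (of_nat p ^ n) f \<in> Zloc_poly p"
proof -
  have "\<forall>i. \<exists>n. of_nat p ^ n * coeff f i \<in> Zloc p" using Zloc_integer_multiple[OF assms] by blast
  then obtain N where N: "\<And>i. of_nat p ^ N i * coeff f i \<in> Zloc p" by metis
  define n where "n = (\<Sum>i\<le>degree f. N i)"
  have "of_nat p ^ n * coeff f i \<in> Zloc p" for i
  proof (cases "i \<le> degree f")
    case True
    then have "N i \<le> n" unfolding n_def by (intro member_le_sum) auto
    then have "of_nat p ^ n * coeff f i = of_nat (p ^ (n - N i)) * (of_nat p ^ N i * coeff f i)"
      by (simp add: power_add[symmetric] mult.assoc[symmetric])
    also have "\<dots> \<in> Zloc p" using Zloc_mult[OF assms Zloc_of_nat[OF assms] N] .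
    finally show ?thesis .
  next
    case False
    then show ?thesis using Zloc_of_nat[OF assms, of 0] by (simp add: coeff_eq_0)
  qed
  then show ?thesis unfolding Zloc_poly_def by auto
qed

section \<open>Unique factorization in subrings\<close>

locale subring_of =
  fixes R :: "'a::idom set"
  assumes subring: "is_subring R"
begin

lemma zero_in: "0 \<in> R" and one_in: "1 \<in> R"
  and add_in: "a \<in> R \<Longrightarrow> b \<in> R \<Longrightarrow> a + b \<in> R"
  and diff_in: "a \<in> R \<Longrightarrow> b \<in> R \<Longrightarrow> a - b \<in> R"
  and mult_in: "a \<in> R \<Longrightarrow> b \<in> R \<Longrightarrow> a * b \<in> R"
  using subring by (auto simp: is_subring_def)

lemma uminus_in: "a \<in> R \<Longrightarrow> - a \<in> R"
  using diff_in[OF zero_in, of a] by simp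

lemma power_in: "a \<in> R \<Longrightarrow> a ^ n \<in> R"
  by (induction n) (auto simp: one_in mult_in)

lemma sum_in: "(\<And>i. i \<in> I \<Longrightarrow> f i \<in> R) \<Longrightarrow> sum f I \<in> R"
  by (induction I rule: infinite_finite_induct) (auto simp: zero_in add_in)

lemma prod_list_in: "set xs \<subseteq> R \<Longrightarrow> prod_list xs \<in> R"
  by (induction xs) (auto simp: one_in mult_in)

lemma of_nat_in: "of_nat n \<in> R"
  by (induction n) (auto simp: zero_in one_in add_in)

lemma unit_mult_left: "unit_in R (a * b) \<Longrightarrow> a \<in> R \<Longrightarrow> b \<in> R \<Longrightarrow> unit_in R a"
  unfolding unit_in_def by (metis mult.assoc mult_in)

lemma unit_mult: "unit_in R a \<Longrightarrow> unit_in R b \<Longrightarrow> unit_in R (a * b)"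
proof -
  assume "unit_in R a" "unit_in R b"
  then obtain x y where xy: "a \<in> R" "b \<in> R" "x \<in> R" "y \<in> R" "a * x = 1" "b * y = 1" by (auto simp: unit_in_def)
  have "(a * b) * (x * y) = (a * x) * (b * y)" by (simp add: mult_ac)
  then show ?thesis using xy unfolding unit_in_def by (auto intro!: mult_in bexI[of _ "x * y"])
qed

lemma unit_prod_list_irred:
  assumes "\<forall>x\<in>set xs. irred_in R x" "unit_in R (prod_list xs)" shows "xs = []"
proof (cases xs)
  case (Cons y ys)
  have "y \<in> R" "prod_list ys \<in> R" using assms Cons by (auto intro!: prod_list_in simp: irred_in_def)
  then have "unit_in R y" using assms(2) Cons unit_mult_left by auto
  then show ?thesis using assms(1) Cons by (auto simp: irred_in_def)
qed auto

lemma prime_dvd_prod_list: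
  assumes "\<forall>f\<in>R. \<forall>g\<in>R. dvd_in R x (f * g) \<longrightarrow> dvd_in R x f \<or> dvd_in R x g"
    and "\<not> unit_in R x" "x \<in> R" "dvd_in R x (prod_list ys)" "set ys \<subseteq> R"
  shows "\<exists>y\<in>set ys. dvd_in R x y"
  using assms(4,5)
proof (induction ys)
  case Nil
  then show ?case using assms(2,3) by (auto simp: dvd_in_def unit_in_def)
next
  case (Cons y ys)
  then have "dvd_in R x y \<or> dvd_in R x (prod_list ys)" using assms(1) prod_list_in by auto
  then show ?case using Cons by auto
qed

lemma irred_dvd_irred:
  assumes "irred_in R x" "irred_in R y" "dvd_in R x y"
  obtains c where "y = x * c" "unit_in R c"
proof -
  obtain c where "c \<in> R" "y = x * c" using assms(3) by (auto simp: dvd_in_def)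
  moreover have "unit_in R c" using calculation assms(1,2) by (auto simp: irred_in_def)
  ultimately show ?thesis using that by blast
qed

lemma assoc_in_unit_mult: "x \<in> R \<Longrightarrow> unit_in R c \<Longrightarrow> assoc_in R x (x * c)"
  unfolding assoc_in_def dvd_in_def unit_in_def by (metis mult.assoc mult.right_neutral)

text \<open>The unit u makes the induction go through: cancelling x against its associate y = x * c
  leaves the unit c behind, which is absorbed into u.\<close>

lemma unique_factorization_up_to_unit:
  assumes pr: "\<And>x f g. irred_in R x \<Longrightarrow> f \<in> R \<Longrightarrow> g \<in> R \<Longrightarrow> dvd_in R x (f * g) \<Longrightarrow> dvd_in R x f \<or> dvd_in R x g"
    and "\<forall>x\<in>set xs. irred_in R x" "\<forall>y\<in>set ys. irred_in R y" "unit_in R u"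
    and "prod_list xs * u = prod_list ys"
  shows "\<exists>zs. mset zs = mset ys \<and> list_all2 (assoc_in R) xs zs"
  using assms(2-)
proof (induction xs arbitrary: ys u)
  case Nil
  then have "ys = []" using unit_prod_list_irred by auto
  then show ?case by auto
next
  case (Cons x xs)
  have xi: "irred_in R x" and xR: "x \<in> R" "x \<noteq> 0" "\<not> unit_in R x"
    using Cons.prems(1) by (auto simp: irred_in_def)
  have ysR: "set ys \<subseteq> R" and xsR: "set xs \<subseteq> R" using Cons.prems by (auto simp: irred_in_def)
  have uR: "u \<in> R" using Cons.prems by (auto simp: unit_in_def)
  have "prod_list ys = x * (prod_list xs * u)" using Cons.prems(4) by (simp add: mult.assoc)
  then have "dvd_in R x (prod_list ys)" using xsR uR unfolding dvd_in_def by (metis mult_in prod_list_in)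
  then obtain y where y: "y \<in> set ys" "dvd_in R x y"
    using prime_dvd_prod_list[of x ys] pr[OF xi] xR ysR by metis
  obtain c where c: "y = x * c" "unit_in R c" using irred_dvd_irred[OF xi _ y(2)] y(1) Cons.prems(2) by metis
  obtain w where w: "w \<in> R" "c * w = 1" "c \<in> R" using c(2) by (auto simp: unit_in_def)
  have wc: "w * c = 1" using w by (simp add: mult.commute)
  obtain ys1 ys2 where ys: "ys = ys1 @ y # ys2" using y(1) by (meson split_list)
  have "prod_list ys = x * (c * prod_list (ys1 @ ys2))" unfolding ys c(1) by (simp add: mult_ac)
  then have "x * (prod_list xs * u) = x * (c * prod_list (ys1 @ ys2))"
    using Cons.prems(4) by (simp add: mult.assoc)
  then have e: "prod_list xs * u = c * prod_list (ys1 @ ys2)" using xR(2) by simp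
  have e2: "prod_list xs * (u * w) = prod_list (ys1 @ ys2)"
  proof -
    have "prod_list xs * (u * w) = w * (prod_list xs * u)" by (simp add: mult_ac)
    also have "\<dots> = (w * c) * prod_list (ys1 @ ys2)" unfolding e by (simp add: mult.assoc)
    finally show ?thesis using wc by simp
  qed
  have "unit_in R (u * w)" using Cons.prems(3) w by (intro unit_mult) (auto simp: unit_in_def mult.commute)
  then obtain zs where zs: "mset zs = mset (ys1 @ ys2)" "list_all2 (assoc_in R) xs zs"
    using Cons.IH[of "ys1 @ ys2" "u * w"] Cons.prems ys e2 by auto
  have "mset (y # zs) = mset ys" using zs ys by simp
  moreover have "list_all2 (assoc_in R) (x # xs) (y # zs)" using zs c xR assoc_in_unit_mult by auto
  ultimately show ?case by blast
qed

text \<open>A proper factorization strictly lowers an additive size that is positive on nonunits, so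
  factorizations into irreducibles exist; primality of the irreducibles gives uniqueness.\<close>

lemma UFD_criterion:
  fixes \<mu> :: "'a \<Rightarrow> nat"
  assumes pr: "\<And>x f g. irred_in R x \<Longrightarrow> f \<in> R \<Longrightarrow> g \<in> R \<Longrightarrow> dvd_in R x (f * g) \<Longrightarrow> dvd_in R x f \<or> dvd_in R x g"
    and mu: "\<And>a b. a \<in> R \<Longrightarrow> b \<in> R \<Longrightarrow> a \<noteq> 0 \<Longrightarrow> b \<noteq> 0 \<Longrightarrow> \<mu> (a * b) = \<mu> a + \<mu> b"
    and mu0: "\<And>a. a \<in> R \<Longrightarrow> a \<noteq> 0 \<Longrightarrow> \<not> unit_in R a \<Longrightarrow> \<mu> a > 0"
  shows "is_UFD R"
proof -
  have ex: "\<exists>xs. xs \<noteq> [] \<and> (\<forall>x\<in>set xs. irred_in R x) \<and> prod_list xs = a"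
    if "a \<in> R" "a \<noteq> 0" "\<not> unit_in R a" for a
    using that
  proof (induction "\<mu> a" arbitrary: a rule: less_induct)
    case less
    show ?case
    proof (cases "irred_in R a")
      case True
      then show ?thesis by (intro exI[of _ "[a]"]) auto
    next
      case False
      then obtain b c where bc: "b \<in> R" "c \<in> R" "a = b * c" "\<not> unit_in R b" "\<not> unit_in R c"
        using less.prems by (auto simp: irred_in_def)
      have nz: "b \<noteq> 0" "c \<noteq> 0" using bc less.prems by auto
      have m: "\<mu> a = \<mu> b + \<mu> c" "\<mu> b > 0" "\<mu> c > 0" using mu mu0 bc nz by auto
      obtain xs where xs: "xs \<noteq> []" "\<forall>x\<in>set xs. irred_in R x" "prod_list xs = b"
        using less.hyps[of b] m bc nz by auto
      obtain ys where ys: "ys \<noteq> []" "\<forall>x\<in>set ys. irred_in R x" "prod_list ys = c"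
        using less.hyps[of c] m bc nz by auto
      show ?thesis using xs ys bc by (intro exI[of _ "xs @ ys"]) auto
    qed
  qed
  have "unit_in R 1" by (auto simp: unit_in_def one_in)
  then have "\<exists>zs. mset zs = mset ys \<and> list_all2 (assoc_in R) xs zs"
    if "\<forall>x\<in>set xs. irred_in R x" "\<forall>y\<in>set ys. irred_in R y" "prod_list xs = prod_list ys" for xs ys
    using unique_factorization_up_to_unit[OF pr that(1,2), of 1] that(3) by simp
  with ex show ?thesis unfolding is_UFD_def by blast
qed

lemma UFD_factor:
  assumes "is_UFD R" "a \<in> R" "a \<noteq> 0"
  obtains u xs where "unit_in R u" "\<forall>x\<in>set xs. irred_in R x" "a = u * prod_list xs"
proof (cases "unit_in R a")
  case True then show ?thesis using that[of a "[]"] by auto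
next
  case False
  then obtain xs where "\<forall>x\<in>set xs. irred_in R x" "prod_list xs = a"
    using assms by (auto simp: is_UFD_def)
  then show ?thesis using that[of 1 xs] by (auto simp: unit_in_def one_in)
qed

lemma irred_in_unit_mult:
  assumes "irred_in R x" "unit_in R u" shows "irred_in R (u * x)"
proof -
  obtain w where w: "w \<in> R" "u * w = 1" "u \<in> R" using assms(2) by (auto simp: unit_in_def)
  have "unit_in R b \<or> unit_in R c" if "b \<in> R" "c \<in> R" "u * x = b * c" for b c
  proof -
    have "x = (u * w) * x" using w by simp
    also have "\<dots> = w * (u * x)" by (simp add: mult_ac)
    finally have "x = (w * b) * c" using that(3) by (simp add: mult.assoc)
    then have "unit_in R (w * b) \<or> unit_in R c" using that w assms(1) unfolding irred_in_def by (metis mult_in)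
    then show ?thesis using unit_mult_left[of b w] that w by (auto simp: mult.commute)
  qed
  moreover have "\<not> unit_in R (u * x)"
    using assms unit_mult_left[of x u] w by (auto simp: irred_in_def mult.commute)
  moreover have "u * x \<in> R" "u * x \<noteq> 0" using assms w mult_in by (auto simp: irred_in_def)
  ultimately show ?thesis unfolding irred_in_def by blast
qed

text \<open>Uniqueness in \<open>is_UFD\<close> is phrased for equal products. Here the products
  agree only up to units, so the unit t is moved into the first factor of ys; an empty ys has no
  such factor and is treated separately.\<close>

lemma UFD_unique_length_and_assoc:
  assumes "is_UFD R" "\<forall>x\<in>set xs. irred_in R x" "\<forall>y\<in>set ys. irred_in R y"
    and "unit_in R u" "unit_in R w" "u * prod_list xs = w * prod_list ys"
  shows "length xs = length ys" and "\<forall>x\<in>set xs. \<exists>y\<in>set ys. dvd_in R x y"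
proof -
  obtain u' where u': "u' \<in> R" "u * u' = 1" "u \<in> R" using assms(4) by (auto simp: unit_in_def)
  define t where "t = u' * w"
  have t: "unit_in R t" using u' assms(5) unfolding t_def by (intro unit_mult) (auto simp: unit_in_def mult.commute)
  have e: "prod_list xs = t * prod_list ys"
  proof -
    have "prod_list xs = (u * u') * prod_list xs" using u' by simp
    also have "\<dots> = u' * (u * prod_list xs)" by (simp add: mult_ac)
    finally show ?thesis using assms(6) unfolding t_def by (simp add: mult.assoc)
  qed
  have "length xs = length ys \<and> (\<forall>x\<in>set xs. \<exists>y\<in>set ys. dvd_in R x y)"
  proof (cases ys)
    case Nil
    then have "xs = []" using e t assms(2) unit_prod_list_irred by auto
    then show ?thesis using Nil by auto
  next
    case (Cons y ys')
    have ty: "irred_in R (t * y)" using irred_in_unit_mult t assms(3) Cons by auto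
    have "prod_list xs = prod_list ((t * y) # ys')" using e Cons by (simp add: mult_ac)
    moreover have "\<forall>z\<in>set ((t * y) # ys'). irred_in R z" using ty assms(3) Cons by auto
    ultimately obtain zs where zs: "mset zs = mset ((t * y) # ys')" "list_all2 (assoc_in R) xs zs"
      using assms(1,2) unfolding is_UFD_def by metis
    have l: "length xs = length ys"
      using zs Cons by (metis length_Cons list_all2_lengthD size_mset)
    obtain t' where t': "t' \<in> R" "t * t' = 1" using t by (auto simp: unit_in_def)
    have "\<exists>y\<in>set ys. dvd_in R x y" if "x \<in> set xs" for x
    proof -
      obtain z where z: "z \<in> set zs" "assoc_in R x z"
        using zs(2) \<open>x \<in> set xs\<close> by (fastforce simp: in_set_conv_nth list_all2_conv_all_nth)
      then have "z \<in> set ((t * y) # ys')" using zs(1) by (metis mset_eq_setD)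
      then consider "z = t * y" | "z \<in> set ys'" by auto
      then show ?thesis
      proof cases
        case 1
        obtain c where c: "c \<in> R" "t * y = x * c" using z(2) 1 by (auto simp: assoc_in_def dvd_in_def)
        have "y = (t * t') * y" using t' by simp
        also have "\<dots> = (t * y) * t'" by (simp add: mult_ac)
        finally have "y = x * (c * t')" using c by (simp add: mult.assoc)
        moreover have "c * t' \<in> R" using c t' by (simp add: mult_in)
        ultimately show ?thesis using Cons unfolding dvd_in_def by (metis list.set_intros(1))
      next
        case 2
        then show ?thesis using z(2) Cons by (auto simp: assoc_in_def)
      qed
    qed
    then show ?thesis using l by blast
  qed
  then show "length xs = length ys" "\<forall>x\<in>set xs. \<exists>y\<in>set ys. dvd_in R x y" by auto
qed

lemma UFD_irred_imp_prime:
  assumes ufd: "is_UFD R" and x: "irred_in R x" and fg: "f \<in> R" "g \<in> R" "dvd_in R x (f * g)"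
  shows "dvd_in R x f \<or> dvd_in R x g"
proof (cases "f = 0 \<or> g = 0")
  case True
  then show ?thesis by (auto simp: dvd_in_def intro!: bexI[of _ 0] zero_in)
next
  case False
  obtain h where h: "h \<in> R" "f * g = x * h" using fg(3) by (auto simp: dvd_in_def)
  have h0: "h \<noteq> 0" using h False by auto
  obtain u xs where f: "unit_in R u" "\<forall>x\<in>set xs. irred_in R x" "f = u * prod_list xs"
    using UFD_factor[OF ufd fg(1)] False by metis
  obtain w ys where g: "unit_in R w" "\<forall>x\<in>set ys. irred_in R x" "g = w * prod_list ys"
    using UFD_factor[OF ufd fg(2)] False by metis
  obtain t zs where h': "unit_in R t" "\<forall>x\<in>set zs. irred_in R x" "h = t * prod_list zs"
    using UFD_factor[OF ufd h(1) h0] by metis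
  have "t * prod_list (x # zs) = (u * w) * prod_list (xs @ ys)" using h(2) f g h' by (simp add: mult_ac)
  moreover have "unit_in R (u * w)" using f g unit_mult by blast
  ultimately have "\<forall>y\<in>set (x # zs). \<exists>z\<in>set (xs @ ys). dvd_in R y z"
    using UFD_unique_length_and_assoc(2)[OF ufd, of "x # zs" "xs @ ys" t "u * w"] x f g h' by auto
  then obtain z where z: "z \<in> set xs \<or> z \<in> set ys" "dvd_in R x z" by auto
  have step: "dvd_in R x (s * prod_list l)" if "z \<in> set l" "s \<in> R" "\<forall>x\<in>set l. irred_in R x" for s l
  proof -
    obtain l1 l2 where l: "l = l1 @ z # l2" using split_list[OF \<open>z \<in> set l\<close>] by metis
    obtain c where c: "c \<in> R" "z = x * c" using z(2) by (auto simp: dvd_in_def)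
    have "prod_list l1 \<in> R" "prod_list l2 \<in> R" using that(3) l by (auto intro!: prod_list_in simp: irred_in_def)
    then have "s * prod_list l1 * prod_list l2 * c \<in> R" using that c by (auto intro!: mult_in)
    moreover have "s * prod_list l = x * (s * prod_list l1 * prod_list l2 * c)" using l c by (simp add: mult_ac)
    ultimately show ?thesis unfolding dvd_in_def by blast
  qed
  show ?thesis using z(1) step[of xs u] step[of ys w] f g by (auto simp: unit_in_def)
qed

text \<open>The number of irreducible factors is an invariant, and a multiple of x^(n+1) has at
  least n + 1 of them.\<close>

lemma UFD_power_not_dvd:
  assumes ufd: "is_UFD R" and x: "irred_in R x" and f: "f \<in> R" "f \<noteq> 0"
  shows "\<exists>n. \<not> dvd_in R (x ^ n) f"
proof -
  obtain u xs where f': "unit_in R u" "\<forall>x\<in>set xs. irred_in R x" "f = u * prod_list xs"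
    using UFD_factor[OF ufd f] by metis
  have "\<not> dvd_in R (x ^ Suc (length xs)) f"
  proof
    assume "dvd_in R (x ^ Suc (length xs)) f"
    then obtain h where h: "h \<in> R" "f = x ^ Suc (length xs) * h" by (auto simp: dvd_in_def)
    have "h \<noteq> 0" using h f by auto
    then obtain w ys where h': "unit_in R w" "\<forall>x\<in>set ys. irred_in R x" "h = w * prod_list ys"
      using UFD_factor[OF ufd h(1)] by metis
    have "u * prod_list xs = w * prod_list (replicate (Suc (length xs)) x @ ys)"
      using f' h h' by (simp add: mult_ac)
    then have "length xs = length (replicate (Suc (length xs)) x @ ys)"
      using f' h' x by (intro UFD_unique_length_and_assoc(1)[OF ufd]) auto
    then show False by simp
  qed
  then show ?thesis by blast
qed

end

lemma is_UFD_rat_poly: "is_UFD (UNIV :: rat poly set)"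
proof -
  interpret subring_of "UNIV :: rat poly set" by unfold_locales (auto simp: is_subring_def)
  have u: "unit_in UNIV x \<longleftrightarrow> is_unit x" for x :: "rat poly" by (auto simp: unit_in_def dvd_def)
  have d: "dvd_in UNIV x y \<longleftrightarrow> x dvd y" for x y :: "rat poly" by (auto simp: dvd_in_def dvd_def)
  have i: "irred_in UNIV x \<Longrightarrow> prime_elem x" for x :: "rat poly"
    by (intro field_poly_irreducible_imp_prime) (auto simp: irred_in_def u irreducible_def)
  show ?thesis
  proof (rule UFD_criterion[where \<mu> = degree])
    fix x f g :: "rat poly" assume "irred_in UNIV x" "dvd_in UNIV x (f * g)"
    then show "dvd_in UNIV x f \<or> dvd_in UNIV x g" using i d prime_elem_dvd_multD by metis
  next
    fix a :: "rat poly" assume "a \<noteq> 0" "\<not> unit_in UNIV a"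
    then show "degree a > 0" unfolding u by (metis is_unit_iff_degree gr0I)
  qed (auto simp: degree_mult_eq)
qed

section \<open>Discrete valuations with uniformizer p\<close>

definition pdiv :: "nat \<Rightarrow> rat poly set \<Rightarrow> rat poly set" where
  "pdiv p R = smult (of_nat p) ` R"

text \<open>The hub to which all conditions of the theorem are compared. The first clause excludes R
  = Q[X]. In the last clause an f outside R is served by n = 0, so the content concerns f in
  R.\<close>

definition p_prime_separated :: "nat \<Rightarrow> rat poly set \<Rightarrow> bool" where
  "p_prime_separated p R \<longleftrightarrow> 1 \<notin> pdiv p R \<and>
     (\<forall>f\<in>R. \<forall>g\<in>R. f * g \<in> pdiv p R \<longrightarrow> f \<in> pdiv p R \<or> g \<in> pdiv p R) \<and>
     (\<forall>f. f \<noteq> 0 \<longrightarrow> (\<exists>n. smult (inverse (of_nat p) ^ n) f \<notin> R))"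

locale p_overring = subring_of R for R :: "rat poly set" +
  fixes p :: nat
  assumes p_prime: "prime p" and Zloc_poly_sub: "Zloc_poly p \<subseteq> R"
begin

definition P :: rat where "P = of_nat p"

lemma P0: "P \<noteq> 0" using p_prime prime_gt_0_nat by (auto simp: P_def)

lemma const_in: "c \<in> Zloc p \<Longrightarrow> [:c:] \<in> R"
proof -
  assume "c \<in> Zloc p"
  then have "[:c:] \<in> Zloc_poly p" using Zloc_of_nat[OF p_prime, of 0] by (auto simp: Zloc_poly_def coeff_pCons split: nat.split)
  then show ?thesis using Zloc_poly_sub by auto
qed

lemma smult_in: "c \<in> Zloc p \<Longrightarrow> f \<in> R \<Longrightarrow> smult c f \<in> R"
  using mult_in[OF const_in, of c f] by simp

lemma P_power_Zloc: "n \<ge> 0 \<Longrightarrow> P powi n \<in> Zloc p"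
  using p_power_Zloc_nonneg[OF p_prime] by (auto simp: P_def)

lemma X_in: "[:0, 1:] \<in> R"
proof -
  have "[:0, 1:] \<in> Zloc_poly p" using Zloc_of_nat[OF p_prime, of 0] Zloc_of_nat[OF p_prime, of 1]
    by (auto simp: Zloc_poly_def coeff_pCons split: nat.split)
  then show ?thesis using Zloc_poly_sub by auto
qed

lemma pdiv_iff: "f \<in> pdiv p R \<longleftrightarrow> smult (inverse P) f \<in> R"
proof
  assume "f \<in> pdiv p R"
  then show "smult (inverse P) f \<in> R" using P0 by (auto simp: pdiv_def P_def)
next
  assume "smult (inverse P) f \<in> R"
  then have "smult P (smult (inverse P) f) \<in> pdiv p R" unfolding pdiv_def P_def by blast
  then show "f \<in> pdiv p R" using P0 by simp
qed

text \<open>The p-adic order of f relative to R, negative when f is outside R. That the greatest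
  exponent exists for nonzero f is part of the proof of \<open>w0_iff\<close>.\<close>

definition w0 :: "rat poly \<Rightarrow> int" where
  "w0 f = (GREATEST n. smult (P powi (- n)) f \<in> R)"

end

locale p_valued_ring = p_overring +
  assumes sep: "p_prime_separated p R"
begin

lemma one_nin: "1 \<notin> pdiv p R"
  and pdiv_prime: "f \<in> R \<Longrightarrow> g \<in> R \<Longrightarrow> f * g \<in> pdiv p R \<Longrightarrow> f \<in> pdiv p R \<or> g \<in> pdiv p R"
  and separated: "f \<noteq> 0 \<Longrightarrow> \<exists>n. smult (inverse P ^ n) f \<notin> R"
  using sep by (auto simp: p_prime_separated_def P_def)

lemma down_closed: "smult (P powi (- n)) f \<in> R \<Longrightarrow> m \<le> n \<Longrightarrow> smult (P powi (- m)) f \<in> R"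
proof -
  assume a: "smult (P powi (- n)) f \<in> R" "m \<le> n"
  have "P powi (- m) = P powi (n - m) * P powi (- n)" using P0 by (simp add: power_int_add[symmetric])
  then have "smult (P powi (- m)) f = smult (P powi (n - m)) (smult (P powi (- n)) f)" by simp
  then show ?thesis using smult_in[OF P_power_Zloc[of "n - m"] a(1)] a(2) by simp
qed

text \<open>The exponents that keep f inside R form a downward closed set of integers. Clearing
  denominators into \<open>Zloc_poly p\<close> shows that it is nonempty, and separatedness bounds
  it above.\<close>

lemma w0_iff:
  assumes "f \<noteq> 0" shows "smult (P powi (- n)) f \<in> R \<longleftrightarrow> n \<le> w0 f"
proof -
  obtain k where k: "smult (of_nat p ^ k) f \<in> Zloc_poly p" using Zloc_poly_integer_multiple[OF p_prime] by blast
  then have k: "smult (P powi (- (- int k))) f \<in> R" using Zloc_poly_sub by (auto simp: P_def power_int_def)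
  obtain m where m: "smult (inverse P ^ m) f \<notin> R" using separated assms by blast
  then have m: "smult (P powi (- int m)) f \<notin> R" by (simp add: power_int_minus power_inverse)
  define Q where "Q n \<longleftrightarrow> smult (P powi (- n)) f \<in> R" for n
  have bd: "n < int m" if "Q n" for n using that m down_closed[of n f "int m"] unfolding Q_def by linarith
  have fin: "finite {n. Q n \<and> - int k \<le> n}"
    by (rule finite_subset[of _ "{- int k..int m}"]) (use bd in force)+
  have ne: "- int k \<in> {n. Q n \<and> - int k \<le> n}" using k by (auto simp: Q_def)
  define M where "M = Max {n. Q n \<and> - int k \<le> n}"
  have M: "Q M" "- int k \<le> M" using Max_in[OF fin] ne unfolding M_def by blast+
  have M2: "n \<le> M" if "Q n" for n
  proof (cases "- int k \<le> n")
    case True then show ?thesis using that fin unfolding M_def by (intro Max_ge) auto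
  qed (use M in auto)
  have "w0 f = M" unfolding w0_def using M M2 by (intro Greatest_equality) (auto simp: Q_def)
  then show ?thesis using M M2 down_closed[of M f n] by (auto simp: Q_def)
qed

lemma w0_nonneg_iff: "f \<noteq> 0 \<Longrightarrow> f \<in> R \<longleftrightarrow> 0 \<le> w0 f"
  using w0_iff[of f 0] by simp

lemma pdiv_w0_iff: "f \<noteq> 0 \<Longrightarrow> f \<in> pdiv p R \<longleftrightarrow> 1 \<le> w0 f"
  using w0_iff[of f 1] by (simp add: pdiv_iff power_int_minus)

lemma w0_eqI: "f \<noteq> 0 \<Longrightarrow> smult (P powi (- n)) f \<in> R \<Longrightarrow> smult (P powi (- n)) f \<notin> pdiv p R \<Longrightarrow> w0 f = n"
proof -
  assume a: "f \<noteq> 0" "smult (P powi (- n)) f \<in> R" "smult (P powi (- n)) f \<notin> pdiv p R"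
  have "smult (inverse P) (smult (P powi (- n)) f) = smult (P powi (- (n + 1))) f"
    using P0 by (simp add: power_int_diff power_int_minus divide_simps mult.commute)
  then have "\<not> n + 1 \<le> w0 f" using a w0_iff[of f "n + 1"] by (simp add: pdiv_iff)
  moreover have "n \<le> w0 f" using a w0_iff by blast
  ultimately show ?thesis by linarith
qed

lemma w0_normalized:
  assumes "f \<noteq> 0"
  shows "smult (P powi (- w0 f)) f \<in> R" "smult (P powi (- w0 f)) f \<notin> pdiv p R"
proof -
  show "smult (P powi (- w0 f)) f \<in> R" using w0_iff assms by blast
  have "smult (inverse P) (smult (P powi (- w0 f)) f) = smult (P powi (- (w0 f + 1))) f"
    using P0 by (simp add: power_int_diff power_int_minus divide_simps mult.commute)
  then show "smult (P powi (- w0 f)) f \<notin> pdiv p R" using w0_iff[OF assms, of "w0 f + 1"] by (simp add: pdiv_iff)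
qed

text \<open>An analogue of Gauss's lemma: after normalization both factors lie in R but outside pR,
  and primality of pR keeps their product outside.\<close>

lemma w0_mult:
  assumes "f \<noteq> 0" "g \<noteq> 0" shows "w0 (f * g) = w0 f + w0 g"
proof (rule w0_eqI)
  have e: "smult (P powi (- (w0 f + w0 g))) (f * g) = smult (P powi (- w0 f)) f * smult (P powi (- w0 g)) g"
    using P0 by (simp add: power_int_diff power_int_minus divide_simps mult.commute)
  show "smult (P powi (- (w0 f + w0 g))) (f * g) \<in> R" unfolding e using w0_normalized assms by (intro mult_in)
  show "smult (P powi (- (w0 f + w0 g))) (f * g) \<notin> pdiv p R" unfolding e using w0_normalized assms pdiv_prime by blast
qed (use assms in auto)

lemma w0_add:
  assumes "f \<noteq> 0" "g \<noteq> 0" "f + g \<noteq> 0" shows "w0 (f + g) \<ge> min (w0 f) (w0 g)"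
proof -
  let ?m = "min (w0 f) (w0 g)"
  have "smult (P powi (- ?m)) f \<in> R" "smult (P powi (- ?m)) g \<in> R" using w0_iff assms by auto
  then have "smult (P powi (- ?m)) (f + g) \<in> R" by (simp add: smult_add_right add_in)
  then show ?thesis using w0_iff assms by blast
qed

lemma w0_smult_P: assumes "f \<noteq> 0" shows "w0 (smult (P powi n) f) = n + w0 f"
proof (rule w0_eqI)
  have "smult (P powi (- (n + w0 f))) (smult (P powi n) f) = smult (P powi (- w0 f)) f"
    using P0 by (simp add: power_int_add[symmetric])
  then show "smult (P powi (- (n + w0 f))) (smult (P powi n) f) \<in> R"
     "smult (P powi (- (n + w0 f))) (smult (P powi n) f) \<notin> pdiv p R" using w0_normalized assms by auto
qed (use assms P0 in auto)

lemma w0_1: "w0 1 = 0"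
  using one_nin one_in by (intro w0_eqI) (auto simp: one_pCons)

lemma w0_const_P: "w0 [:P powi n:] = n"
  using w0_smult_P[of 1 n] w0_1 by (simp add: smult_pCons one_pCons)

text \<open>A unit u of \<open>Zloc p\<close> and its inverse both lie in R, so their orders are
  nonnegative with sum 0. Hence \<open>w0\<close> restricts to the p-adic valuation on constants,
  which later gives the trace of the DVR on Q.\<close>

lemma const_in_iff: "[:q:] \<in> R \<longleftrightarrow> q \<in> Zloc p"
proof (cases "q = 0")
  case False
  then obtain u where u: "q = P powi (padic_val_rat p q) * u" "u \<in> Zloc p" "inverse u \<in> Zloc p"
    using rat_padic_decomp p_prime unfolding P_def by blast
  have u0: "u \<noteq> 0" using u(1) False by auto
  have "w0 [:u:] \<ge> 0" using const_in[OF u(2)] u0 w0_nonneg_iff[of "[:u:]"] by simp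
  moreover have "w0 [:inverse u:] \<ge> 0" using const_in[OF u(3)] u0 w0_nonneg_iff[of "[:inverse u:]"] by simp
  moreover have "w0 [:u:] + w0 [:inverse u:] = 0" using w0_mult[of "[:u:]" "[:inverse u:]"] u0 w0_1 by (simp add: one_pCons)
  ultimately have "w0 [:u:] = 0" by linarith
  then have "w0 [:q:] = padic_val_rat p q" using u(1) u0 w0_smult_P[of "[:u:]" "padic_val_rat p q"] by simp
  then show ?thesis using w0_nonneg_iff[of "[:q:]"] False padic_nonneg_iff[OF p_prime False] by simp
qed (use Zloc_of_nat[OF p_prime, of 0] zero_in in auto)

subsection \<open>The associated discrete valuation ring\<close>

text \<open>The extension of \<open>w0\<close> to Q(X) as a difference of orders; independence of
  the chosen fraction is multiplicativity of \<open>w0\<close>.\<close>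

definition fract_val :: "rat poly fract \<Rightarrow> int" where
  "fract_val x = (THE n. \<exists>a b. a \<noteq> 0 \<and> b \<noteq> 0 \<and> x = Fract a b \<and> n = w0 a - w0 b)"

lemma fract_val_Fract:
  assumes "a \<noteq> 0" "b \<noteq> 0" shows "fract_val (Fract a b) = w0 a - w0 b"
  unfolding fract_val_def
proof (rule the_equality)
  show "\<exists>a' b'. a' \<noteq> 0 \<and> b' \<noteq> 0 \<and> Fract a b = Fract a' b' \<and> w0 a - w0 b = w0 a' - w0 b'" using assms by blast
next
  fix n assume "\<exists>a' b'. a' \<noteq> 0 \<and> b' \<noteq> 0 \<and> Fract a b = Fract a' b' \<and> n = w0 a' - w0 b'"
  then obtain c d where cd: "c \<noteq> 0" "d \<noteq> 0" "Fract a b = Fract c d" "n = w0 c - w0 d" by blast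
  then have "a * d = c * b" using assms by (simp add: eq_fract)
  then have "w0 a + w0 d = w0 c + w0 b" using w0_mult assms cd by metis
  then show "n = w0 a - w0 b" using cd by linarith
qed

definition DVR :: "rat poly fract set" where "DVR = {x. x = 0 \<or> fract_val x \<ge> 0}"

lemma nonzero_Fract_cases:
  assumes "(x :: rat poly fract) \<noteq> 0" obtains a b where "a \<noteq> 0" "b \<noteq> 0" "x = Fract a b"
  using assms by (cases x rule: Fract_cases_nonzero) auto

lemma fract_val_embP: "f \<noteq> 0 \<Longrightarrow> fract_val (embP f) = w0 f"
  using fract_val_Fract[of f 1] w0_1 by simp

lemma embP_0_iff: "embP f = 0 \<longleftrightarrow> f = 0"
  by (simp add: Zero_fract_def eq_fract)

lemma dvr_valuation_DVR: "dvr_valuation DVR fract_val"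
  unfolding dvr_valuation_def
proof (intro conjI allI impI)
  fix x y :: "rat poly fract" assume "x \<noteq> 0 \<and> y \<noteq> 0"
  then obtain a b c d where "a \<noteq> 0" "b \<noteq> 0" "x = Fract a b" "c \<noteq> 0" "d \<noteq> 0" "y = Fract c d"
    by (metis nonzero_Fract_cases)
  then show "fract_val (x * y) = fract_val x + fract_val y" by (simp add: fract_val_Fract w0_mult)
next
  fix x y :: "rat poly fract" assume xy: "x \<noteq> 0 \<and> y \<noteq> 0 \<and> x + y \<noteq> 0"
  then obtain a b c d where n: "a \<noteq> 0" "b \<noteq> 0" "x = Fract a b" "c \<noteq> 0" "d \<noteq> 0" "y = Fract c d"
    by (metis nonzero_Fract_cases)
  have s: "x + y = Fract (a * d + c * b) (b * d)" using n by simp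
  then have nz: "a * d + c * b \<noteq> 0" using xy n by (auto simp: fract_collapse)
  have "w0 (a * d + c * b) \<ge> min (w0 (a * d)) (w0 (c * b))" using w0_add nz n by auto
  moreover have "fract_val (x + y) = w0 (a * d + c * b) - w0 b - w0 d"
    unfolding s using nz n by (simp add: fract_val_Fract w0_mult)
  ultimately show "fract_val (x + y) \<ge> min (fract_val x) (fract_val y)" using n by (simp add: fract_val_Fract w0_mult)
next
  fix n show "\<exists>x. x \<noteq> 0 \<and> fract_val x = n"
    using w0_const_P[of n] P0 fract_val_embP[of "[:P powi n:]"] embP_0_iff[of "[:P powi n:]"]
    by (intro exI[of _ "embP [:P powi n:]"]) auto
qed (simp add: DVR_def)

lemma embP_in_DVR: "embP f \<in> DVR \<longleftrightarrow> f \<in> R"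
proof (cases "f = 0")
  case False
  then show ?thesis using fract_val_embP w0_nonneg_iff embP_0_iff by (auto simp: DVR_def)
qed (use zero_in in \<open>auto simp: DVR_def Zero_fract_def\<close>)

lemma DVR_exists:
  "\<exists>W. is_DVR_of_QX W \<and> DVR_contract_Q W = Zloc p \<and> DVR_unramified W \<and> R = DVR_contract_QX W"
proof (intro exI[of _ DVR] conjI)
  show "is_DVR_of_QX DVR" using dvr_valuation_DVR by (auto simp: is_DVR_of_QX_def)
  show "DVR_contract_Q DVR = Zloc p" using embP_in_DVR const_in_iff by (auto simp: DVR_contract_Q_def)
  show "R = DVR_contract_QX DVR" using embP_in_DVR by (auto simp: DVR_contract_QX_def)
  \<comment> \<open>The constants p^n already realize every value, because p has order 1.\<close>
  have "\<exists>q. fract_val x = fract_val (embQ q) \<and> q \<noteq> 0" for x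
    using fract_val_embP[of "[:P powi fract_val x:]"] w0_const_P[of "fract_val x"] P0
    by (intro exI[of _ "P powi fract_val x"]) auto
  moreover have "\<exists>x. fract_val (embQ q) = fract_val x \<and> x \<noteq> 0" if "q \<noteq> 0" for q
    using that embP_0_iff[of "[:q:]"] by (intro exI[of _ "embQ q"]) auto
  ultimately show "DVR_unramified DVR" unfolding DVR_unramified_def
    using dvr_valuation_DVR by (intro exI[of _ fract_val]) auto
qed

subsection \<open>Unique factorization\<close>

lemma in_R_degree0: "f \<in> R \<Longrightarrow> degree f = 0 \<Longrightarrow> f \<noteq> 0 \<Longrightarrow> w0 f = 0 \<Longrightarrow> unit_in R f"
proof -
  assume f: "f \<in> R" "degree f = 0" "f \<noteq> 0" "w0 f = 0"
  obtain c where c: "f = [:c:]" using f(2) by (metis degree_eq_zeroE)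
  have c0: "c \<noteq> 0" using c f by auto
  have "w0 f + w0 [:inverse c:] = 0" using w0_mult[of f "[:inverse c:]"] c c0 w0_1 by (simp add: one_pCons)
  then have "[:inverse c:] \<in> R" using w0_nonneg_iff[of "[:inverse c:]"] c0 f by simp
  moreover have "f * [:inverse c:] = 1" using c c0 by (simp add: one_pCons)
  ultimately show ?thesis using f(1) unfolding unit_in_def by blast
qed

lemma unit_degree: "unit_in R f \<Longrightarrow> degree f = 0 \<and> f \<noteq> 0 \<and> w0 f = 0"
proof -
  assume "unit_in R f"
  then obtain g where g: "f \<in> R" "g \<in> R" "f * g = 1" by (auto simp: unit_in_def)
  then have nz: "f \<noteq> 0" "g \<noteq> 0" by auto
  have "degree f + degree g = 0" using degree_mult_eq[OF nz] g(3) by simp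
  moreover have "w0 f + w0 g = 0" using w0_mult[OF nz] g(3) w0_1 by simp
  moreover have "w0 f \<ge> 0" "w0 g \<ge> 0" using g nz w0_nonneg_iff by auto
  ultimately show ?thesis using nz by linarith
qed

text \<open>There are two kinds of irreducibles. Those in pR are associates of p, and pR is prime.
  The others have order 0 and stay irreducible in Q[X], since the factors of a factorization there
  can be rescaled into R by opposite powers of p; they are prime in Q[X], and order 0 forces the
  cofactor back into R.\<close>

lemma irred_imp_prime:
  assumes x: "irred_in R x" and fg: "f \<in> R" "g \<in> R" "dvd_in R x (f * g)"
  shows "dvd_in R x f \<or> dvd_in R x g"
proof (cases "f = 0 \<or> g = 0")
  case True
  then show ?thesis by (auto simp: dvd_in_def intro!: bexI[of _ 0] zero_in)
next
  case nz: False
  have xR: "x \<in> R" "x \<noteq> 0" "\<not> unit_in R x" using x by (auto simp: irred_in_def)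
  obtain h where h: "h \<in> R" "f * g = x * h" using fg(3) by (auto simp: dvd_in_def)
  show ?thesis
  proof (cases "x \<in> pdiv p R")
    case True
    then obtain y where y: "y \<in> R" "x = smult P y" by (auto simp: pdiv_def P_def)
    have Px: "x = [:P:] * y" using y by simp
    have "[:P:] \<in> R" using const_in Zloc_of_nat p_prime by (simp add: P_def)
    moreover have "\<not> unit_in R [:P:]" using unit_degree[of "[:P:]"] w0_const_P[of 1] by auto
    ultimately have "unit_in R y" using x y Px unfolding irred_in_def by blast
    then obtain z where z: "z \<in> R" "y * z = 1" by (auto simp: unit_in_def)
    have zy: "z * y = 1" using z by (simp add: mult.commute)
    have key: "dvd_in R x f" if "f \<in> pdiv p R" for f
    proof -
      obtain f' where f': "f' \<in> R" "f = smult P f'" using \<open>f \<in> pdiv p R\<close> by (auto simp: pdiv_def P_def)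
      have "f = smult P (y * z * f')" using f' z by simp
      then have "f = x * (z * f')" unfolding Px by (simp add: mult.assoc)
      then show ?thesis using f' z mult_in unfolding dvd_in_def by blast
    qed
    have "f * g = smult P (y * h)" using h Px by simp
    then have "f * g \<in> pdiv p R" using mult_in y h unfolding pdiv_def P_def by blast
    then show ?thesis using pdiv_prime fg key by blast
  next
    case False
    then have w: "w0 x = 0" using xR w0_nonneg_iff pdiv_w0_iff by (smt (verit))
    have "irreducible x"
    proof (rule irreducibleI)
      show "x \<noteq> 0" by fact
      show "\<not> is_unit x" using xR w in_R_degree0 by (auto simp: is_unit_iff_degree)
    next
      fix a b assume ab: "x = a * b"
      then have nz: "a \<noteq> 0" "b \<noteq> 0" using xR by auto
      define a' b' where "a' = smult (P powi (- w0 a)) a" and "b' = smult (P powi (- w0 b)) b"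
      have s: "w0 a + w0 b = 0" using w ab w0_mult nz by simp
      have "P powi (- w0 a) * P powi (- w0 b) = 1"
      proof -
        have "w0 b = - w0 a" using s by linarith
        then show ?thesis using P0 by (simp add: power_int_minus)
      qed
      then have "P powi (- w0 b) * P powi (- w0 a) = 1" by (simp add: mult.commute)
      then have "x = a' * b'" using ab unfolding a'_def b'_def by simp
      moreover have "a' \<in> R" "b' \<in> R" using w0_normalized nz unfolding a'_def b'_def by auto
      ultimately have "unit_in R a' \<or> unit_in R b'" using x by (auto simp: irred_in_def)
      then have "degree a' = 0 \<or> degree b' = 0" using unit_degree[of a'] unit_degree[of b'] by auto
      then show "is_unit a \<or> is_unit b" using nz P0 unfolding a'_def b'_def by (simp add: is_unit_iff_degree)
    qed
    then have "prime_elem x" by (rule field_poly_irreducible_imp_prime)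
    moreover have "x dvd f * g" using h by simp
    ultimately have d: "x dvd f \<or> x dvd g" using prime_elem_dvd_multD by blast
    have key: "dvd_in R x f" if "x dvd f" "f \<in> R" "f \<noteq> 0" for f
    proof -
      obtain d where d: "f = x * d" using \<open>x dvd f\<close> by (auto simp: dvd_def)
      then have "d \<noteq> 0" using that by auto
      then have "w0 f = w0 d" using d w0_mult xR w by simp
      then have "d \<in> R" using that \<open>d \<noteq> 0\<close> w0_nonneg_iff by auto
      then show ?thesis using d by (auto simp: dvd_in_def)
    qed
    show ?thesis using d key fg nz by blast
  qed
qed

text \<open>Order plus degree serves as size: an element of R where both vanish is a unit.\<close>

lemma is_UFD: "is_UFD R"
proof (rule UFD_criterion[where \<mu> = "\<lambda>f. nat (w0 f) + degree f"])
  fix a b assume "a \<in> R" "b \<in> R" "a \<noteq> 0" "b \<noteq> 0"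
  then show "nat (w0 (a * b)) + degree (a * b) = nat (w0 a) + degree a + (nat (w0 b) + degree b)"
    using w0_nonneg_iff[of a] w0_nonneg_iff[of b] by (simp add: w0_mult degree_mult_eq nat_add_distrib)
next
  fix a assume "a \<in> R" "a \<noteq> 0" "\<not> unit_in R a"
  then show "nat (w0 a) + degree a > 0" using in_R_degree0[of a] w0_nonneg_iff[of a] by (smt (verit) add_gr_0 gr0I zero_less_nat_eq)
qed (rule irred_imp_prime)

end

section \<open>Separatedness from unique factorization and from a discrete valuation ring\<close>

context p_overring begin

text \<open>Every rational polynomial lands in R after multiplication by a power of p; with 1/p in R
  that power could be undone.\<close>

lemma inverse_P_notin: assumes "R \<noteq> UNIV" shows "[:inverse P:] \<notin> R"
proof
  assume i: "[:inverse P:] \<in> R"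
  have "f \<in> R" for f
  proof -
    obtain n where "smult (of_nat p ^ n) f \<in> Zloc_poly p" using Zloc_poly_integer_multiple[OF p_prime] by blast
    then have n: "smult (P ^ n) f \<in> R" using Zloc_poly_sub by (auto simp: P_def)
    have "[:inverse P:] ^ n * smult (P ^ n) f \<in> R" using n i by (intro mult_in power_in)
    moreover have "[:inverse P:] ^ n * smult (P ^ n) f = f" using P0
      by (simp add: poly_const_pow power_mult_distrib[symmetric])
    ultimately show ?thesis by simp
  qed
  then show False using assms by auto
qed

lemma const_in_imp_Zloc:
  assumes "R \<noteq> UNIV" "[:q:] \<in> R" shows "q \<in> Zloc p"
proof (cases "q = 0")
  case False
  then obtain u where u: "q = P powi (padic_val_rat p q) * u" "u \<in> Zloc p" "inverse u \<in> Zloc p"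
    using rat_padic_decomp p_prime unfolding P_def by blast
  define k where "k = padic_val_rat p q"
  have u0: "u \<noteq> 0" using u(1) False by auto
  show ?thesis
  proof (rule ccontr)
    assume "q \<notin> Zloc p"
    then have k: "-1 - k \<ge> 0" using padic_nonneg_iff[OF p_prime False] by (simp add: k_def)
    have "inverse P = (P powi (-1 - k) * inverse u) * q"
      using u(1) u0 P0 unfolding k_def[symmetric] by (simp add: power_int_diff field_simps power_int_minus)
    then have "[:inverse P:] = smult (P powi (-1 - k) * inverse u) [:q:]" by simp
    also have "\<dots> \<in> R" using k u assms p_prime by (intro smult_in Zloc_mult P_power_Zloc)
    finally show False using inverse_P_notin assms by blast
  qed
qed (use Zloc_of_nat[OF p_prime, of 0] in auto)

lemma UFD_imp_separated:
  assumes ufd: "is_UFD R" and ne: "R \<noteq> UNIV" shows "p_prime_separated p R"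
proof -
  have dvd: "dvd_in R ([:P:] ^ n) f \<longleftrightarrow> smult (inverse P ^ n) f \<in> R" for f n
  proof
    assume "dvd_in R ([:P:] ^ n) f"
    then show "smult (inverse P ^ n) f \<in> R" using P0 by (auto simp: dvd_in_def poly_const_pow power_mult_distrib[symmetric])
  next
    assume a: "smult (inverse P ^ n) f \<in> R"
    have "f = [:P:] ^ n * smult (inverse P ^ n) f" using P0 by (simp add: poly_const_pow power_mult_distrib[symmetric])
    then show "dvd_in R ([:P:] ^ n) f" using a unfolding dvd_in_def by blast
  qed
  have dvd1: "dvd_in R [:P:] f \<longleftrightarrow> f \<in> pdiv p R" for f using dvd[of 1 f] by (simp add: pdiv_iff)
  have PR: "[:P:] \<in> R" using const_in Zloc_of_nat p_prime by (simp add: P_def)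
  have nu: "\<not> unit_in R [:P:]"
  proof
    assume "unit_in R [:P:]"
    then obtain g where g: "g \<in> R" "smult P g = 1" by (auto simp: unit_in_def)
    then have "smult (inverse P) (smult P g) = smult (inverse P) 1" by simp
    then have "g = [:inverse P:]" using P0 by (simp add: one_pCons)
    then show False using g inverse_P_notin ne by auto
  qed
  \<comment> \<open>Factors of a constant are constants, and the constants of R are p-local, so the
    claim reduces to irreducibility of p in \<open>Zloc p\<close>.\<close>
  have irr: "irred_in R [:P:]"
    unfolding irred_in_def
  proof (intro conjI ballI impI PR nu)
    fix b c assume bc: "b \<in> R" "c \<in> R" "[:P:] = b * c"
    then have nz: "b \<noteq> 0" "c \<noteq> 0" using P0 by auto
    have "degree b + degree c = 0" using bc(3) degree_mult_eq[OF nz] by (metis degree_pCons_0)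
    then obtain x y where xy: "b = [:x:]" "c = [:y:]" by (metis degree_eq_zeroE add_is_0)
    have nz: "x \<noteq> 0" "y \<noteq> 0" using nz xy by auto
    have z: "x \<in> Zloc p" "y \<in> Zloc p" using xy bc const_in_imp_Zloc ne by auto
    obtain u where u: "x = P powi (padic_val_rat p x) * u" "u \<in> Zloc p" "inverse u \<in> Zloc p"
      using rat_padic_decomp p_prime nz unfolding P_def by metis
    define k where "k = padic_val_rat p x"
    have u0: "u \<noteq> 0" using u nz by auto
    have k0: "k \<ge> 0" using padic_nonneg_iff[OF p_prime nz(1)] z by (simp add: k_def)
    have Pxy: "P = x * y" using bc xy by simp
    show "unit_in R b \<or> unit_in R c"
    proof (cases "k = 0")
      case True
      then have "inverse x \<in> Zloc p" using u by (simp add: k_def)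
      then have "unit_in R b" unfolding unit_in_def using bc xy nz const_in by (auto intro!: bexI[of _ "[:inverse x:]"] simp: one_pCons)
      then show ?thesis ..
    next
      case False
      \<comment> \<open>From p = p^k * u * y with k at least 1, cancelling one p exhibits an inverse
        of y.\<close>
      then have "P powi (k - 1) * u * y = 1" using u(1) P0 Pxy k0 unfolding k_def[symmetric]
        by (simp add: power_int_diff field_simps)
      moreover have "P powi (k - 1) * u \<in> Zloc p" using False k0 u p_prime by (intro Zloc_mult P_power_Zloc) auto
      ultimately have "unit_in R c" unfolding unit_in_def using bc xy const_in
        by (intro conjI bexI[of _ "[:P powi (k - 1) * u:]"]) (auto simp: one_pCons mult_ac)
      then show ?thesis ..
    qed
  qed (use P0 in auto)
  show ?thesis unfolding p_prime_separated_def
  proof (intro conjI ballI impI allI)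
    show "1 \<notin> pdiv p R" using inverse_P_notin[OF ne] by (simp add: pdiv_iff)
    fix f g assume "f \<in> R" "g \<in> R" "f * g \<in> pdiv p R"
    then show "f \<in> pdiv p R \<or> g \<in> pdiv p R" using UFD_irred_imp_prime[OF ufd irr] dvd1 by blast
  next
    fix f :: "rat poly" assume f: "f \<noteq> 0"
    \<comment> \<open>The clause ranges over all of Q[X], so f is first moved into R, where the
      bound on the number of factors applies.\<close>
    obtain k where "smult (of_nat p ^ k) f \<in> Zloc_poly p" using Zloc_poly_integer_multiple[OF p_prime] by blast
    then have k: "smult (P ^ k) f \<in> R" using Zloc_poly_sub by (auto simp: P_def)
    obtain n where n: "smult (inverse P ^ n) (smult (P ^ k) f) \<notin> R"
      using UFD_power_not_dvd[OF ufd irr k] f P0 dvd by auto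
    have "smult (inverse P ^ n) f \<notin> R"
    proof
      assume "smult (inverse P ^ n) f \<in> R"
      then have "smult (P ^ k) (smult (inverse P ^ n) f) \<in> R"
        using smult_in[OF P_power_Zloc[of "int k"], of "smult (inverse P ^ n) f"] by simp
      then show False using n by (simp add: mult.commute)
    qed
    then show "\<exists>n. smult (inverse (of_nat p) ^ n) f \<notin> R" by (auto simp: P_def)
  qed
qed

text \<open>Unramifiedness yields w(p) = 1: some rational q = p^k * u has value 1 and the unit u has
  value 0, so k times w(p) is 1. Then pR is the part of R with w at least 1, and the three clauses
  are properties of w.\<close>

lemma DVR_imp_separated:
  assumes W: "is_DVR_of_QX W" "DVR_contract_Q W = Zloc p" "DVR_unramified W" "R = DVR_contract_QX W"
  shows "p_prime_separated p R"
proof -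
  obtain w where w: "dvr_valuation W w" "{w (embQ q) | q. q \<noteq> 0} = {w x | x. x \<noteq> 0}"
    using W(3) by (auto simp: DVR_unramified_def)
  have wm: "w (x * y) = w x + w y" if "x \<noteq> 0" "y \<noteq> 0" for x y using w(1) that by (auto simp: dvr_valuation_def)
  have ws: "\<exists>x. x \<noteq> 0 \<and> w x = n" for n using w(1) by (auto simp: dvr_valuation_def)
  have Wdef: "W = {x. x = 0 \<or> w x \<ge> 0}" using w(1) by (auto simp: dvr_valuation_def)
  have e0: "embP f = 0 \<longleftrightarrow> f = 0" for f :: "rat poly" by (simp add: Zero_fract_def eq_fract)
  have fm: "w (embP (f * g)) = w (embP f) + w (embP g)" if "f \<noteq> 0" "g \<noteq> 0" for f g
    using wm[of "embP f" "embP g"] that e0 by simp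
  have RW: "f \<in> R \<longleftrightarrow> f = 0 \<or> w (embP f) \<ge> 0" for f
    using W(4) Wdef e0 by (auto simp: DVR_contract_QX_def)
  have ZW: "q \<in> Zloc p \<longleftrightarrow> q = 0 \<or> w (embQ q) \<ge> 0" for q
  proof -
    have "q \<in> Zloc p \<longleftrightarrow> embQ q \<in> W" using W(2) by (auto simp: DVR_contract_Q_def)
    then show ?thesis using Wdef e0[of "[:q:]"] by auto
  qed
  have w1: "w (embP 1) = 0" using fm[of 1 1] by simp
  have wq: "w (embQ (x * y)) = w (embQ x) + w (embQ y)" if "x \<noteq> 0" "y \<noteq> 0" for x y
    using fm[of "[:x:]" "[:y:]"] that by (simp add: mult.commute)
  have wP: "w (embQ P) \<ge> 0" using ZW[of P] P0 Zloc_of_nat[OF p_prime, of p] by (auto simp: P_def)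
  have wPn: "w (embQ (P ^ n)) = int n * w (embQ P)" for n
  proof (induction n)
    case (Suc n) then show ?case using wq[of P "P ^ n"] P0 by (simp add: algebra_simps)
  qed (use w1 in \<open>simp add: one_pCons\<close>)
  have "1 \<in> {w x | x. x \<noteq> 0}" using ws[of 1] by auto
  then have "1 \<in> {w (embQ q) | q. q \<noteq> 0}" using w(2) by simp
  then obtain q where q: "q \<noteq> 0" "w (embQ q) = 1" by auto
  have "q \<in> Zloc p" using ZW q by auto
  then have kp: "padic_val_rat p q \<ge> 0" using padic_nonneg_iff p_prime q by blast
  obtain u where u: "q = P powi (padic_val_rat p q) * u" "u \<in> Zloc p" "inverse u \<in> Zloc p"
    using rat_padic_decomp p_prime q(1) unfolding P_def by metis
  define k where "k = nat (padic_val_rat p q)"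
  have u0: "u \<noteq> 0" using u q by auto
  have qk: "q = P ^ k * u" using u(1) kp by (simp add: k_def power_int_def)
  have "w (embQ u) + w (embQ (inverse u)) = 0" using wq[of u "inverse u"] u0 w1 by (simp add: one_pCons)
  moreover have "w (embQ u) \<ge> 0" "w (embQ (inverse u)) \<ge> 0" using ZW u u0 by auto
  ultimately have "w (embQ u) = 0" by linarith
  then have "1 = int k * w (embQ P)" using q(2) qk wq[of "P ^ k" u] u0 P0 wPn by simp
  then have wP1: "w (embQ P) = 1" using wP zmult_eq_1_iff[of "int k" "w (embQ P)"] by auto
  have wsm: "w (embP (smult (inverse P ^ n) f)) = w (embP f) - int n" if "f \<noteq> 0" for f n
  proof -
    have "f = [:P ^ n:] * smult (inverse P ^ n) f" using P0 by (simp add: power_mult_distrib[symmetric])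
    then have "w (embP f) = w (embP ([:P ^ n:] * smult (inverse P ^ n) f))" by simp
    also have "\<dots> = int n + w (embP (smult (inverse P ^ n) f))"
      using fm[of "[:P ^ n:]" "smult (inverse P ^ n) f"] that P0 wPn wP1 by simp
    finally show ?thesis by simp
  qed
  have pd: "f \<in> pdiv p R \<longleftrightarrow> f = 0 \<or> w (embP f) \<ge> 1" for f
    using wsm[of f 1] P0 by (cases "f = 0") (auto simp: pdiv_iff RW)
  show ?thesis unfolding p_prime_separated_def
  proof (intro conjI ballI impI allI)
    show "1 \<notin> pdiv p R" using pd w1 by auto
    fix f g assume fg: "f \<in> R" "g \<in> R" "f * g \<in> pdiv p R"
    then show "f \<in> pdiv p R \<or> g \<in> pdiv p R"
      using RW[of f] RW[of g] pd[of f] pd[of g] pd[of "f * g"] fm[of f g] by (cases "f = 0 \<or> g = 0") auto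
  next
    fix f :: "rat poly" assume f: "f \<noteq> 0"
    have "smult (inverse P ^ nat (w (embP f) + 1)) f \<notin> R" using f P0 wsm[OF f] by (auto simp: RW)
    then show "\<exists>n. smult (inverse (of_nat p) ^ n) f \<notin> R" by (auto simp: P_def)
  qed
qed

end

section \<open>The absolute value and the Gauss norm\<close>

locale cp_model =
  fixes p :: nat and v :: "'k::field_char_0 \<Rightarrow> ereal"
  assumes p_prime: "prime p" and model: "is_Cp_model p v"
begin

text \<open>The multiplicative form of v, with |p| = exp(-1). Working in the reals lets norms be
  multiplied and compared without infinite values.\<close>

definition av :: "'k \<Rightarrow> real" where
  "av x = (if x = 0 then 0 else exp (- real_of_ereal (v x)))"

lemma v_mult: "v (x * y) = v x + v y" and v_add: "min (v x) (v y) \<le> v (x + y)"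
  and v_inf: "v x = \<infinity> \<longleftrightarrow> x = 0" and v_minf: "v x \<noteq> -\<infinity>"
  and v_rat: "q \<noteq> 0 \<Longrightarrow> v (of_rat q) = ereal (of_int (padic_val_rat p q))"
  and alg_closed: "degree f > 0 \<Longrightarrow> \<exists>x::'k. poly f x = 0"
  and dense: "\<exists>y\<in>Qpbar_in v. v (x - y) \<ge> ereal M"
  using model unfolding is_Cp_model_def by auto

lemma complete:
  fixes s :: "nat \<Rightarrow> 'k"
  assumes "\<forall>M::real. \<exists>N. \<forall>m\<ge>N. \<forall>n\<ge>N. v (s m - s n) \<ge> ereal M"
  shows "\<exists>L. \<forall>M::real. \<exists>N. \<forall>n\<ge>N. v (s n - L) \<ge> ereal M"
proof -
  have "\<forall>s::nat \<Rightarrow> 'k. (\<forall>M::real. \<exists>N. \<forall>m\<ge>N. \<forall>n\<ge>N. v (s m - s n) \<ge> ereal M) \<longrightarrow>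
        (\<exists>L. \<forall>M::real. \<exists>N. \<forall>n\<ge>N. v (s n - L) \<ge> ereal M)"
    using model unfolding is_Cp_model_def by (elim conjE) assumption
  from this[THEN spec, of s] assms show ?thesis by (rule mp)
qed

lemma v_real: "x \<noteq> 0 \<Longrightarrow> v x = ereal (real_of_ereal (v x))"
  using v_inf[of x] v_minf[of x] by (cases "v x") auto

lemma v_ge_iff: "v x \<ge> ereal M \<longleftrightarrow> av x \<le> exp (- M)"
proof (cases "x = 0")
  case True
  then have "v x = \<infinity>" using v_inf by blast
  then show ?thesis using True by (simp add: av_def)
next
  case False
  then obtain r where "v x = ereal r" using v_real by blast
  then show ?thesis using False by (simp add: av_def)
qed

lemma v_nonneg_iff: "v x \<ge> 0 \<longleftrightarrow> av x \<le> 1"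
  using v_ge_iff[of 0 x] by (simp add: zero_ereal_def)

lemma av_0 [simp]: "av 0 = 0" by (simp add: av_def)

lemma av_pos: "x \<noteq> 0 \<Longrightarrow> av x > 0" by (simp add: av_def)

lemma av_nonneg [simp]: "av x \<ge> 0" by (simp add: av_def)

lemma av_eq_0_iff [simp]: "av x = 0 \<longleftrightarrow> x = 0" by (simp add: av_def)

lemma av_mult: "av (x * y) = av x * av y"
proof (cases "x = 0 \<or> y = 0")
  case False
  then obtain r s where "v x = ereal r" "v y = ereal s" using v_real by metis
  then show ?thesis using False v_mult[of x y] by (auto simp: av_def exp_add[symmetric])
qed auto

lemma av_add: "av (x + y) \<le> max (av x) (av y)"
proof (cases "x = 0 \<or> y = 0 \<or> x + y = 0")
  case True
  then show ?thesis by (auto simp: le_max_iff_disj)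
next
  case False
  then obtain r s t where "v x = ereal r" "v y = ereal s" "v (x + y) = ereal t" using v_real by metis
  moreover have "min r s \<le> t" using v_add[of x y] calculation by (auto simp: min_def split: if_splits)
  ultimately show ?thesis using False by (auto simp: av_def min_def max_def split: if_splits)
qed

lemma av_1 [simp]: "av 1 = 1"
proof -
  have "av 1 * av 1 = av 1" using av_mult[of 1 1] by simp
  then show ?thesis by (metis av_eq_0_iff mult_cancel_right2 zero_neq_one)
qed

lemma av_minus [simp]: "av (- x) = av x"
proof -
  have "av (-1) * av (-1) = 1" using av_mult[of "-1" "-1"] by simp
  then have "av (-1) = 1" using av_nonneg[of "-1"] by (simp add: square_eq_1_iff)
  then show ?thesis using av_mult[of "-1" x] by simp
qed

lemma av_diff: "av (x - y) \<le> max (av x) (av y)"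
  using av_add[of x "- y"] by simp

lemma av_diff_commute: "av (x - y) = av (y - x)"
  using av_minus[of "x - y"] by simp

lemma av_power: "av (x ^ n) = av x ^ n"
  by (induction n) (auto simp: av_mult)

lemma av_inverse: "av (inverse x) = inverse (av x)"
proof (cases "x = 0")
  case False
  then have "av x * av (inverse x) = 1" using av_mult[of x "inverse x"] by simp
  then show ?thesis by (metis inverse_unique)
qed simp

lemma av_divide: "av (x / y) = av x / av y"
  by (simp add: divide_inverse av_mult av_inverse)

lemma av_add_less: "av x < c \<Longrightarrow> av y < c \<Longrightarrow> av (x + y) < c" using av_add[of x y] by auto
lemma av_add_le: "av x \<le> c \<Longrightarrow> av y \<le> c \<Longrightarrow> av (x + y) \<le> c" using av_add[of x y] by auto
lemma av_diff_less: "av x < c \<Longrightarrow> av y < c \<Longrightarrow> av (x - y) < c" using av_diff[of x y] by auto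
lemma av_diff_le: "av x \<le> c \<Longrightarrow> av y \<le> c \<Longrightarrow> av (x - y) \<le> c" using av_diff[of x y] by auto

text \<open>The isosceles triangle principle of ultrametric spaces.\<close>

lemma av_eqI: "av (x - y) < av y \<Longrightarrow> av x = av y"
proof -
  assume a: "av (x - y) < av y"
  have "av x \<le> av y" using av_add[of "x - y" y] a by auto
  moreover have "av y \<le> max (av x) (av (x - y))" using av_diff[of x "x - y"] by simp
  ultimately show ?thesis using a by auto
qed

lemma av_trans_less: "av (x - y) < c \<Longrightarrow> av (y - z) < c \<Longrightarrow> av (x - z) < c"
  using av_add_less[of "x - y" c "y - z"] by simp

lemma av_sum_less: "finite I \<Longrightarrow> c > 0 \<Longrightarrow> (\<And>i. i \<in> I \<Longrightarrow> av (f i) < c) \<Longrightarrow> av (sum f I) < c"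
  by (induction I rule: finite_induct) (auto intro!: av_add_less)

lemma av_sum_le: "c \<ge> 0 \<Longrightarrow> (\<And>i. i \<in> I \<Longrightarrow> av (f i) \<le> c) \<Longrightarrow> av (sum f I) \<le> c"
  by (induction I rule: infinite_finite_induct) (auto intro!: av_add_le)

lemma av_mult_le_1: "av x \<le> 1 \<Longrightarrow> av y \<le> 1 \<Longrightarrow> av (x * y) \<le> 1"
  by (simp add: av_mult mult_le_one)

lemma av_mult_less_1: "av x < 1 \<Longrightarrow> av y \<le> 1 \<Longrightarrow> av (x * y) < 1"
  by (metis av_mult av_nonneg dual_order.strict_trans2 mult.commute mult_left_le_one_le)

lemma av_power_le_1: "av x \<le> 1 \<Longrightarrow> av (x ^ n) \<le> 1"
  by (simp add: av_power power_le_one)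

lemma av_prod: "av (prod f I) = (\<Prod>i\<in>I. av (f i))"
  by (induction I rule: infinite_finite_induct) (auto simp: av_mult)

lemma av_rat_le_1_iff: "av (of_rat q) \<le> 1 \<longleftrightarrow> q \<in> Zloc p"
proof (cases "q = 0")
  case True then show ?thesis using Zloc_of_nat[OF p_prime, of 0] by simp
next
  case False
  then show ?thesis using v_nonneg_iff[of "of_rat q"] v_rat padic_nonneg_iff[OF p_prime False] by simp
qed

lemma av_of_nat_le_1: "av (of_nat n) \<le> 1"
  using av_rat_le_1_iff[of "of_nat n"] Zloc_of_nat[OF p_prime] by simp

lemma av_p: "av (of_nat p) = exp (-1)"
proof -
  have "quotient_of (of_nat p) = (int p, 1)" using quotient_of_int[of "int p"] by simp
  moreover have "\<not> is_unit (int p)" "int p \<noteq> 0" using p_prime by (auto dest: not_prime_unit)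
  ultimately have "padic_val_rat p (of_nat p) = 1"
    unfolding padic_val_rat_def using multiplicity_self[of "int p"] by simp
  then have "v (of_rat (of_nat p)) = ereal 1" using v_rat[of "of_nat p"] p_prime by (auto simp: one_ereal_def)
  then show ?thesis using p_prime by (auto simp: av_def)
qed

lemma av_p_power: "av (of_nat p ^ n) = exp (- real n)"
  by (simp add: av_power av_p exp_of_nat_mult[symmetric])

lemma av_p_less_1: "av (of_nat p) < 1" by (simp add: av_p)

lemma p_nz: "(of_nat p :: 'k) \<noteq> 0" using p_prime by auto

text \<open>The valuation is discrete on Q. This gap is what turns a small rational coefficient into
  one divisible by p.\<close>

lemma av_rat_less_1: "av (of_rat q) < 1 \<Longrightarrow> av (of_rat q) \<le> exp (-1)"
proof (cases "q = 0")
  case False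
  assume "av (of_rat q) < 1"
  then have "padic_val_rat p q \<ge> 1" using False v_rat[OF False] by (auto simp: av_def)
  then show ?thesis using False v_rat[OF False] by (auto simp: av_def)
qed simp

subsection \<open>Embedding of rational polynomials\<close>

definition emb :: "rat poly \<Rightarrow> 'k poly" where "emb f = map_poly of_rat f"

lemma coeff_emb [simp]: "coeff (emb f) i = of_rat (coeff f i)"
  by (simp add: emb_def coeff_map_poly)

lemma emb_0 [simp]: "emb 0 = 0" and emb_1 [simp]: "emb 1 = 1"
  by (auto simp: poly_eq_iff coeff_pCons one_pCons split: nat.split)

lemma emb_add: "emb (f + g) = emb f + emb g" and emb_diff: "emb (f - g) = emb f - emb g"
  and emb_smult: "emb (smult c f) = smult (of_rat c) (emb f)"
  and emb_pCons: "emb (pCons c f) = pCons (of_rat c) (emb f)"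
  by (auto simp: poly_eq_iff of_rat_add of_rat_diff of_rat_mult coeff_pCons split: nat.split)

lemma emb_mult: "emb (f * g) = emb f * emb g"
  by (auto simp: poly_eq_iff coeff_mult of_rat_sum of_rat_mult)

lemma emb_power: "emb (f ^ n) = emb f ^ n"
  by (induction n) (auto simp: emb_mult)

lemma emb_eq_0_iff [simp]: "emb f = 0 \<longleftrightarrow> f = 0"
  by (simp add: poly_eq_iff)

lemma emb_X [simp]: "emb [:0, 1:] = [:0, 1:]"
  by (simp add: emb_pCons)

subsection \<open>The Gauss norm\<close>

definition gn :: "'k poly \<Rightarrow> real" where
  "gn P = Max ((\<lambda>i. av (coeff P i)) ` {..degree P})"

lemma gn_attained: "\<exists>i. gn P = av (coeff P i)"
proof -
  have "gn P \<in> (\<lambda>i. av (coeff P i)) ` {..degree P}" unfolding gn_def by (intro Max_in) auto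
  then show ?thesis by blast
qed

lemma gn_nonneg [simp]: "gn P \<ge> 0" using gn_attained[of P] by auto

lemma coeff_le_gn: "av (coeff P i) \<le> gn P"
proof (cases "i \<le> degree P")
  case True then show ?thesis unfolding gn_def by (intro Max_ge) auto
qed (simp add: coeff_eq_0)

lemma gn_le_iff: "gn P \<le> c \<longleftrightarrow> (\<forall>i. av (coeff P i) \<le> c)"
  using gn_attained[of P] coeff_le_gn[of P] by (metis order_trans)

lemma gn_less_iff: "gn P < c \<longleftrightarrow> (\<forall>i. av (coeff P i) < c)"
  using gn_attained[of P] coeff_le_gn[of P] by (metis order_le_less_trans)

lemma gn_0 [simp]: "gn 0 = 0" using gn_attained[of 0] by simp

lemma gn_eq_0_iff [simp]: "gn P = 0 \<longleftrightarrow> P = 0"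
proof
  assume "gn P = 0"
  then have "av (coeff P i) = 0" for i using coeff_le_gn[of P i] av_nonneg[of "coeff P i"] by linarith
  then show "P = 0" by (simp add: poly_eq_iff)
qed simp

lemma gn_pCons: "gn (pCons a P) = max (av a) (gn P)"
proof (rule antisym)
  show "gn (pCons a P) \<le> max (av a) (gn P)"
    unfolding gn_le_iff
  proof
    fix i show "av (coeff (pCons a P) i) \<le> max (av a) (gn P)"
      by (cases i) (auto intro: max.coboundedI2 coeff_le_gn)
  qed
  show "max (av a) (gn P) \<le> gn (pCons a P)"
    using coeff_le_gn[of "pCons a P" 0] coeff_le_gn[of "pCons a P" "Suc i" for i] by (auto simp: gn_le_iff)
qed

lemma gn_1 [simp]: "gn 1 = 1" by (simp add: one_pCons gn_pCons)

lemma gn_smult: "gn (smult c P) = av c * gn P"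
proof (rule antisym)
  show "gn (smult c P) \<le> av c * gn P" by (auto simp: gn_le_iff av_mult coeff_le_gn mult_left_mono)
  obtain i where "gn P = av (coeff P i)" using gn_attained by blast
  then show "av c * gn P \<le> gn (smult c P)" using coeff_le_gn[of "smult c P" i] by (simp add: av_mult)
qed

lemma gn_minus [simp]: "gn (- P) = gn P" using gn_smult[of "-1" P] by simp

lemma gn_add: "gn (P + Q) \<le> max (gn P) (gn Q)"
  unfolding gn_le_iff
proof
  fix i
  show "av (coeff (P + Q) i) \<le> max (gn P) (gn Q)"
    using av_add[of "coeff P i" "coeff Q i"] coeff_le_gn[of P i] coeff_le_gn[of Q i] by auto
qed

lemma gn_add_less: "gn P < c \<Longrightarrow> gn Q < c \<Longrightarrow> gn (P + Q) < c" using gn_add[of P Q] by auto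
lemma gn_add_le: "gn P \<le> c \<Longrightarrow> gn Q \<le> c \<Longrightarrow> gn (P + Q) \<le> c" using gn_add[of P Q] by auto
lemma gn_diff_less: "gn P < c \<Longrightarrow> gn Q < c \<Longrightarrow> gn (P - Q) < c" using gn_add[of P "- Q"] by auto
lemma gn_diff_le: "gn P \<le> c \<Longrightarrow> gn Q \<le> c \<Longrightarrow> gn (P - Q) \<le> c" using gn_add[of P "- Q"] by auto

text \<open>Gauss's lemma for the absolute value \<open>av\<close>.\<close>

lemma gn_mult: "gn (P * Q) = gn P * gn Q"
proof (cases "P = 0 \<or> Q = 0")
  case False
  show ?thesis
  proof (rule antisym)
    have "av (coeff P k * coeff Q (n - k)) \<le> gn P * gn Q" for k n
      unfolding av_mult by (intro mult_mono coeff_le_gn) auto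
    then show "gn (P * Q) \<le> gn P * gn Q" unfolding gn_le_iff coeff_mult by (auto intro!: av_sum_le)
  next
    \<comment> \<open>With the first indices where the norms are attained, the term i, j strictly
      dominates in coefficient i + j of the product: any other k has either k < i or i + j - k <
      j.\<close>
    define i j where "i = (LEAST i. av (coeff P i) = gn P)" and "j = (LEAST i. av (coeff Q i) = gn Q)"
    have "\<exists>i. av (coeff P i) = gn P" using gn_attained[of P] by metis
    then have i: "av (coeff P i) = gn P" unfolding i_def by (rule LeastI_ex)
    have "\<exists>i. av (coeff Q i) = gn Q" using gn_attained[of Q] by metis
    then have j: "av (coeff Q j) = gn Q" unfolding j_def by (rule LeastI_ex)
    have il: "av (coeff P k) < gn P" if "k < i" for k
      using not_less_Least[of k "\<lambda>i. av (coeff P i) = gn P"] that coeff_le_gn[of P k] unfolding i_def by linarith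
    have jl: "av (coeff Q k) < gn Q" if "k < j" for k
      using not_less_Least[of k "\<lambda>i. av (coeff Q i) = gn Q"] that coeff_le_gn[of Q k] unfolding j_def by linarith
    have pos: "gn P > 0" "gn Q > 0" using False gn_nonneg gn_eq_0_iff by (metis order_le_less)+
    have "av (coeff P k * coeff Q (i + j - k)) < gn P * gn Q" if "k \<in> {..i + j} - {i}" for k
    proof (cases "k < i")
      case True
      then show ?thesis unfolding av_mult using il coeff_le_gn[of Q] pos
        by (cases "coeff Q (i + j - k) = 0") (auto intro!: mult_less_le_imp_less av_pos)
    next
      case ge: False
      then have "i + j - k < j" using that by auto
      then show ?thesis unfolding av_mult using jl coeff_le_gn[of P] pos ge
        by (cases "coeff P k = 0") (auto intro!: mult_le_less_imp_less av_pos)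
    qed
    then have s: "av (\<Sum>k\<in>{..i + j} - {i}. coeff P k * coeff Q (i + j - k)) < gn P * gn Q"
      using pos by (intro av_sum_less) auto
    have "coeff (P * Q) (i + j) - coeff P i * coeff Q j = (\<Sum>k\<in>{..i + j} - {i}. coeff P k * coeff Q (i + j - k))"
      unfolding coeff_mult using sum.remove[of "{..i + j}" i "\<lambda>k. coeff P k * coeff Q (i + j - k)"] by simp
    then have "av (coeff (P * Q) (i + j)) = av (coeff P i * coeff Q j)"
      using s i j by (intro av_eqI) (simp add: av_mult)
    then show "gn P * gn Q \<le> gn (P * Q)" using i j coeff_le_gn[of "P * Q" "i + j"] by (simp add: av_mult)
  qed
qed auto

lemma gn_pcompose_le:
  assumes "gn L \<le> 1" shows "gn (pcompose P L) \<le> gn P"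
proof (induction P)
  case (pCons a P)
  have "gn (L * pcompose P L) \<le> gn P" using pCons assms mult_mono[of "gn L" 1 "gn (pcompose P L)" "gn P"] by (simp add: gn_mult)
  then have "gn ([:a:] + L * pcompose P L) \<le> max (av a) (gn P)"
    using gn_add[of "[:a:]" "L * pcompose P L"] by (auto simp: gn_pCons)
  then show ?case by (simp add: pcompose_pCons gn_pCons)
qed simp

lemma poly_le_gn: assumes "av y \<le> 1" shows "av (poly P y) \<le> gn P"
proof -
  have "gn (pcompose P [:y:]) \<le> gn P" using assms by (intro gn_pcompose_le) (simp add: gn_pCons)
  then show ?thesis by (simp add: pcompose_pCons_0 gn_pCons)
qed

section \<open>Maximum principle and location of roots\<close>

lemma split_root: "P = [:poly P y:] + [:- y, 1:] * synthetic_div P y" for P :: "'k poly"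
  using synthetic_div_correct'[of y P] by (simp add: add.commute)

text \<open>Witness: a root of the product of X - z over all z in F, minus 1.\<close>
lemma residue_field_infinite:
  assumes "finite F" "\<forall>z\<in>F. av z \<le> 1"
  shows "\<exists>y. av y \<le> 1 \<and> (\<forall>z\<in>F. av (y - z) = 1)"
proof (cases "F = {}")
  case True
  then show ?thesis by (intro exI[of _ 0]) auto
next
  case False
  define Q where "Q = (\<Prod>z\<in>F. [:- z, 1:])"
  have dQ: "degree Q = card F" unfolding Q_def by (subst degree_prod_eq_sum_degree) auto
  have "card F > 0" using False assms by (simp add: card_gt_0_iff)
  then have "degree (Q + (- 1)) = degree Q" by (intro degree_add_eq_left) (simp add: dQ)
  then have "degree (Q - 1) > 0" using dQ \<open>card F > 0\<close> by simp
  then obtain y where "poly (Q - 1) y = 0" using alg_closed by blast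
  then have pr: "(\<Prod>z\<in>F. av (y - z)) = 1"
    unfolding Q_def by (simp add: poly_prod av_prod[symmetric])
  have y: "av y \<le> 1"
  proof (rule ccontr)
    assume "\<not> ?thesis"
    then have "av (y - z) > 1" if "z \<in> F" for z using that assms av_add[of "y - z" z] by fastforce
    then have "(\<Prod>z\<in>F. av (y - z)) > 1" using assms False by (intro less_1_prod) auto
    then show False using pr by simp
  qed
  have le: "av (y - z) \<le> 1" if "z \<in> F" for z using that assms y by (intro av_diff_le) auto
  have "av (y - z) = 1" if z: "z \<in> F" for z
  proof (rule ccontr)
    assume "av (y - z) \<noteq> 1"
    then have "av (y - z) < 1" using le z by force
    moreover have "(\<Prod>z\<in>F - {z}. av (y - z)) \<le> 1" using le by (intro prod_le_1) auto
    ultimately have "av (y - z) * (\<Prod>z\<in>F - {z}. av (y - z)) < 1"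
      by (metis av_nonneg dual_order.strict_trans2 mult_left_le)
    then show False using pr z assms by (simp add: prod.remove)
  qed
  then show ?thesis using y by blast
qed

text \<open>The maximum principle, by division by X - y0 at a sample point y0. The quotient is
  controlled only where |y - y0| = 1, so the residue class of y0 must be excluded from then on; the
  finite set F of excluded classes makes the induction possible.\<close>

lemma gn_le_of_values:
  assumes "c \<ge> 0" "finite F" "\<forall>z\<in>F. av z \<le> 1"
    and "\<And>y. av y \<le> 1 \<Longrightarrow> \<forall>z\<in>F. av (y - z) = 1 \<Longrightarrow> av (poly P y) \<le> c"
  shows "gn P \<le> c"
  using assms
proof (induction "degree P" arbitrary: P F rule: less_induct)
  case less
  obtain y0 where y0: "av y0 \<le> 1" "\<forall>z\<in>F. av (y0 - z) = 1" using residue_field_infinite less.prems by metis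
  define Q where "Q = synthetic_div P y0"
  have P: "P = [:poly P y0:] + [:- y0, 1:] * Q" unfolding Q_def by (rule split_root)
  have p0: "av (poly P y0) \<le> c" using less.prems(4) y0 by blast
  show ?case
  proof (cases "degree P = 0")
    case True
    then obtain a where "P = [:a:]" by (metis degree_eq_zeroE)
    then show ?thesis using p0 less.prems by (simp add: gn_pCons)
  next
    case False
    have "gn Q \<le> c"
    proof (rule less.hyps[of Q "insert y0 F"])
      show "degree Q < degree P" using False unfolding Q_def by (simp add: degree_synthetic_div)
      fix y assume y: "av y \<le> 1" "\<forall>z\<in>insert y0 F. av (y - z) = 1"
      have "poly P y - poly P y0 = (y - y0) * poly Q y" using arg_cong[OF P, of "\<lambda>P. poly P y"] by (simp add: algebra_simps)
      then have "av (poly Q y) = av (poly P y - poly P y0)" using y by (simp add: av_mult)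
      also have "\<dots> \<le> c" using p0 less.prems(4) y by (intro av_diff_le) auto
      finally show "av (poly Q y) \<le> c" .
    qed (use less.prems y0 in auto)
    moreover have "gn [:- y0, 1:] = 1" using y0 by (simp add: gn_pCons)
    ultimately have "gn ([:poly P y0:] + [:- y0, 1:] * Q) \<le> c" using p0 less.prems(1)
      by (intro gn_add_le) (simp_all add: gn_mult gn_pCons del: mult_pCons_left)
    then show ?thesis using P by simp
  qed
qed

lemma gn_le_1_iff: "gn P \<le> 1 \<longleftrightarrow> (\<forall>y. av y \<le> 1 \<longrightarrow> av (poly P y) \<le> 1)"
  using gn_le_of_values[of 1 "{}" P] poly_le_gn[of _ P] by force

text \<open>A factor X - r with |r| at least 1 has its Gauss norm at the constant coefficient, and
  both the norm and the constant coefficient are multiplicative.\<close>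

lemma large_roots_imp_gn_le:
  assumes "Q \<noteq> 0" "\<And>r. poly Q r = 0 \<Longrightarrow> av r \<ge> 1" shows "gn Q \<le> av (coeff Q 0)"
  using assms
proof (induction "degree Q" arbitrary: Q rule: less_induct)
  case less
  show ?case
  proof (cases "degree Q = 0")
    case True
    then obtain a where "Q = [:a:]" by (metis degree_eq_zeroE)
    then show ?thesis by (simp add: gn_pCons)
  next
    case False
    then obtain r where r: "poly Q r = 0" using alg_closed by blast
    define Q' where "Q' = synthetic_div Q r"
    have Q: "Q = [:- r, 1:] * Q'" using split_root[of Q r] r unfolding Q'_def by simp
    have "gn Q' \<le> av (coeff Q' 0)"
    proof (rule less.hyps)
      show "degree Q' < degree Q" using False unfolding Q'_def by (simp add: degree_synthetic_div)
      show "Q' \<noteq> 0" using Q less.prems by auto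
      fix s assume "poly Q' s = 0" then show "av s \<ge> 1" using less.prems Q by simp
    qed
    then have "av r * gn Q' \<le> av r * av (coeff Q' 0)" by (intro mult_left_mono) auto
    moreover have "gn Q = av r * gn Q'" using Q less.prems(2)[OF r] by (simp add: gn_mult gn_pCons del: mult_pCons_left)
    moreover have "coeff Q 0 = - r * coeff Q' 0" unfolding Q by (simp add: coeff_mult)
    ultimately show ?thesis by (simp add: av_mult)
  qed
qed

text \<open>A substitute for Hensel's lemma over an algebraically closed field. After moving c to 0,
  if no root were smaller than 1, the constant coefficient P(c) would attain the Gauss norm.\<close>

lemma approximate_root:
  assumes "av c \<le> 1" "av (poly P c) < gn P"
  shows "\<exists>r. poly P r = 0 \<and> av (c - r) < 1"
proof -
  define Q where "Q = pcompose P [:c, 1:]"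
  \<comment> \<open>Translating back by the integral c shows that the shift does not lower the Gauss
    norm.\<close>
  have "P = pcompose Q [:- c, 1:]" unfolding Q_def by (simp add: pcompose_assoc[symmetric] pcompose_pCons)
  then have "gn P \<le> gn Q" using assms gn_pcompose_le[of "[:- c, 1:]" Q] by (simp add: gn_pCons)
  moreover have "coeff Q 0 = poly P c" unfolding Q_def by (simp add: pcompose_coeff_0)
  ultimately have "\<not> gn Q \<le> av (coeff Q 0)" "Q \<noteq> 0" using assms by auto
  then obtain r where "poly Q r = 0" "av r < 1" using large_roots_imp_gn_le by force
  then show ?thesis unfolding Q_def by (intro exI[of _ "c + r"]) (simp add: poly_pcompose)
qed

subsection \<open>Rational approximation of polynomials over Q_p\<close>

lemma Qp_poly_approx:
  assumes "\<forall>i. coeff f i \<in> Qp_in v" "e > 0"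
  shows "\<exists>g. gn (f - emb g) < e"
proof -
  have "\<exists>q. av (coeff f i - of_rat q) < e" for i
  proof -
    have "\<forall>M::real. \<exists>q::rat. v (coeff f i - of_rat q) \<ge> ereal M" using assms(1) by (simp add: Qp_in_def)
    then obtain q :: rat where "v (coeff f i - of_rat q) \<ge> ereal (- ln (e / 2))" by blast
    then have "av (coeff f i - of_rat q) \<le> e / 2" using assms(2) unfolding v_ge_iff by simp
    then show ?thesis using assms(2) by (intro exI[of _ q]) auto
  qed
  then obtain q where q: "\<And>i. av (coeff f i - of_rat (q i)) < e" by metis
  define g where "g = Poly (map q [0..<Suc (degree f)])"
  have "coeff g i = (if i \<le> degree f then q i else 0)" for i
    unfolding g_def by (auto simp: nth_default_def nth_append simp del: upt_Suc)
  then have "av (coeff (f - emb g) i) < e" for i using q assms(2) by (auto simp: coeff_eq_0)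
  then show ?thesis by (auto simp: gn_less_iff)
qed

lemma of_rat_in_Qp: "of_rat q \<in> Qp_in v"
proof -
  have "v (of_rat q - of_rat q) = \<infinity>" using v_inf by simp
  then show ?thesis unfolding Qp_in_def by (auto intro!: exI[of _ q])
qed

section \<open>Integer valuations and unramified elements\<close>

definition intval :: "'k \<Rightarrow> bool" where
  "intval x \<longleftrightarrow> x = 0 \<or> (\<exists>k::int. av x = exp (of_int k))"

lemma intval_iff: "x \<noteq> 0 \<Longrightarrow> intval x \<longleftrightarrow> real_of_ereal (v x) \<in> \<int>"
proof -
  assume x: "x \<noteq> 0"
  have "(\<exists>k::int. - real_of_ereal (v x) = of_int k) \<longleftrightarrow> - real_of_ereal (v x) \<in> \<int>" by (auto simp: Ints_def)
  then show ?thesis using x by (simp add: intval_def av_def)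
qed

lemma coset_eq_Ints_iff: "{g + real_of_int k | k. True} = \<int> \<longleftrightarrow> g \<in> \<int>"
proof
  assume "{g + real_of_int k | k. True} = \<int>"
  moreover have "g + real_of_int 0 \<in> {g + real_of_int k | k. True}" by blast
  ultimately show "g \<in> \<int>" by simp
next
  assume g: "g \<in> \<int>"
  then obtain n where n: "g = of_int n" by (auto simp: Ints_def)
  have "x \<in> {g + real_of_int k | k. True}" if "x \<in> \<int>" for x
  proof -
    obtain m where "x = of_int m" using \<open>x \<in> \<int>\<close> by (auto simp: Ints_def)
    then have "x = g + real_of_int (m - n)" using n by simp
    then show ?thesis by blast
  qed
  then show "{g + real_of_int k | k. True} = \<int>" using g by auto
qed

text \<open>The coset of the value 0 is Z itself and is always present, so having a single coset
  means that every coset is Z.\<close>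

lemma unramified_iff:
  "unramified_in v a \<longleftrightarrow> (\<forall>y\<in>Qp_adj v a. intval y)"
proof -
  have "(1::'k) \<in> Qp_adj v a"
    unfolding Qp_adj_def using of_rat_in_Qp[of 0] of_rat_in_Qp[of 1]
    by (auto intro!: exI[of _ 1] simp: one_pCons coeff_pCons split: nat.split)
  moreover have "real_of_ereal (v 1) = 0" using v_rat[of 1] by (simp add: padic_val_rat_def)
  ultimately have "0 \<in> value_group v (Qp_adj v a)" unfolding value_group_def by force
  then have "\<int> \<in> ram_cosets v a" unfolding ram_cosets_def using coset_eq_Ints_iff[of 0] by (intro image_eqI[of _ _ 0]) auto
  then have "unramified_in v a \<longleftrightarrow> ram_cosets v a = {\<int>}"
    unfolding unramified_in_def by (auto simp: card_1_singleton_iff)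
  also have "\<dots> \<longleftrightarrow> (\<forall>g\<in>value_group v (Qp_adj v a). {g + real_of_int k | k. True} = \<int>)"
  proof -
    have "ram_cosets v a = {\<int>} \<longleftrightarrow> (\<forall>c\<in>ram_cosets v a. c = \<int>)"
      using \<open>\<int> \<in> ram_cosets v a\<close> by blast
    then show ?thesis unfolding ram_cosets_def by simp
  qed
  also have "\<dots> \<longleftrightarrow> (\<forall>g\<in>value_group v (Qp_adj v a). g \<in> \<int>)" by (simp only: coset_eq_Ints_iff)
  also have "\<dots> \<longleftrightarrow> (\<forall>y\<in>Qp_adj v a. intval y)"
  proof -
    have "intval y \<longleftrightarrow> (y \<noteq> 0 \<longrightarrow> real_of_ereal (v y) \<in> \<int>)" for y
      using intval_iff by (cases "y = 0") (auto simp: intval_def[of 0])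
    then show ?thesis unfolding value_group_def by auto
  qed
  finally show ?thesis .
qed

lemma unramified_imp_Cp_br: "unramified_in v a \<Longrightarrow> a \<in> Cp_br v"
  unfolding unramified_in_def Cp_br_def by (metis card.infinite mem_Collect_eq zero_neq_one)

lemma intval_divide: "intval x \<Longrightarrow> intval y \<Longrightarrow> intval (x / y)"
  unfolding intval_def av_divide by (auto simp: exp_diff[symmetric] simp flip: of_int_diff)

text \<open>Elements of Q_p(a) are quotients of values f(a) with f over Q_p. A rational g close
  enough to f has |g(a)| = |f(a)|; integrality of a turns closeness of coefficients into closeness
  of values.\<close>

lemma unramifiedI:
  assumes "av a \<le> 1" "\<And>f. intval (poly (emb f) a)"
  shows "unramified_in v a"
proof -
  have "intval (poly f a)" if f: "\<forall>i. coeff f i \<in> Qp_in v" for f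
  proof (cases "poly f a = 0")
    case False
    then obtain g where g: "gn (f - emb g) < av (poly f a)" using Qp_poly_approx[OF f] av_pos by blast
    have "av (poly (emb g) a - poly f a) = av (poly (f - emb g) a)" using av_diff_commute by simp
    also have "\<dots> < av (poly f a)" using g poly_le_gn[OF assms(1)] by (meson order_le_less_trans)
    finally have e: "av (poly (emb g) a) = av (poly f a)" by (rule av_eqI)
    then have "poly (emb g) a \<noteq> 0" using False by (metis av_eq_0_iff)
    then show ?thesis using assms(2)[of g] e unfolding intval_def by auto
  qed (simp add: intval_def)
  then show ?thesis unfolding unramified_iff Qp_adj_def by (auto intro!: intval_divide)
qed

lemma unramifiedD: assumes "unramified_in v a" shows "intval (poly (emb f) a)"
proof -
  have "poly (emb f) a \<in> Qp_adj v a" unfolding Qp_adj_def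
    using of_rat_in_Qp of_rat_in_Qp[of 0] of_rat_in_Qp[of 1]
    by (intro CollectI exI[of _ "emb f"] exI[of _ 1]) (auto simp: one_pCons coeff_pCons split: nat.split)
  then show ?thesis using assms unramified_iff by blast
qed

end

section \<open>Frobenius congruences\<close>

definition pcong :: "nat \<Rightarrow> 'a::idom set \<Rightarrow> 'a \<Rightarrow> 'a \<Rightarrow> bool" where
  "pcong p A x y \<longleftrightarrow> (\<exists>z\<in>A. x - y = of_nat p * z)"

context subring_of begin

lemma pcong_refl: "pcong p R x x"
  unfolding pcong_def by (intro bexI[of _ 0]) (auto simp: zero_in)

lemma pcong_trans: "pcong p R x y \<Longrightarrow> pcong p R y z \<Longrightarrow> pcong p R x z"
proof -
  assume "pcong p R x y" "pcong p R y z"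
  then obtain a b where ab: "a \<in> R" "b \<in> R" "x - y = of_nat p * a" "y - z = of_nat p * b" by (auto simp: pcong_def)
  have "x - z = (x - y) + (y - z)" by simp
  also have "\<dots> = of_nat p * (a + b)" using ab by (simp add: algebra_simps)
  finally show ?thesis using ab add_in unfolding pcong_def by blast
qed

lemma pcong_add: "pcong p R x y \<Longrightarrow> pcong p R x' y' \<Longrightarrow> pcong p R (x + x') (y + y')"
proof -
  assume "pcong p R x y" "pcong p R x' y'"
  then obtain a b where ab: "a \<in> R" "b \<in> R" "x - y = of_nat p * a" "x' - y' = of_nat p * b" by (auto simp: pcong_def)
  have "(x + x') - (y + y') = (x - y) + (x' - y')" by simp
  also have "\<dots> = of_nat p * (a + b)" using ab by (simp add: algebra_simps)
  finally show ?thesis using ab add_in unfolding pcong_def by blast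
qed

lemma pcong_mult:
  "pcong p R x y \<Longrightarrow> pcong p R x' y' \<Longrightarrow> x' \<in> R \<Longrightarrow> y \<in> R \<Longrightarrow> pcong p R (x * x') (y * y')"
proof -
  assume R: "x' \<in> R" "y \<in> R"
  assume "pcong p R x y" "pcong p R x' y'"
  then obtain a b where ab: "a \<in> R" "b \<in> R" "x - y = of_nat p * a" "x' - y' = of_nat p * b" by (auto simp: pcong_def)
  have "x * x' - y * y' = (x - y) * x' + y * (x' - y')" by (simp add: algebra_simps)
  also have "\<dots> = of_nat p * (a * x' + y * b)" unfolding ab by (simp add: algebra_simps)
  finally show ?thesis using ab R add_in mult_in unfolding pcong_def by blast
qed

lemma pcong_power: "pcong p R x y \<Longrightarrow> x \<in> R \<Longrightarrow> y \<in> R \<Longrightarrow> pcong p R (x ^ n) (y ^ n)"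
  by (induction n) (auto intro!: pcong_mult power_in simp: pcong_refl)

lemma pcong_frobenius:
  assumes "prime p" "x \<in> R" "y \<in> R" shows "pcong p R ((x + y) ^ p) (x ^ p + y ^ p)"
proof -
  have p0: "p > 0" using assms prime_gt_0_nat by blast
  define c where "c k = (p choose k) div p" for k
  have c: "p choose k = p * c k" if "k \<in> {1..<p}" for k
    using dvd_choose_prime[of k p] that assms unfolding c_def by auto
  have set: "{..p} = insert 0 (insert p {1..<p})" using p0 by auto
  have "(x + y) ^ p = (\<Sum>k\<le>p. of_nat (p choose k) * x ^ k * y ^ (p - k))" by (rule binomial_ring)
  also have "\<dots> = x ^ p + y ^ p + (\<Sum>k\<in>{1..<p}. of_nat (p choose k) * x ^ k * y ^ (p - k))"
    unfolding set using p0 by simp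
  also have "(\<Sum>k\<in>{1..<p}. of_nat (p choose k) * x ^ k * y ^ (p - k)) = (\<Sum>k\<in>{1..<p}. of_nat p * (of_nat (c k) * x ^ k * y ^ (p - k)))"
    by (intro sum.cong) (auto simp: c mult.assoc)
  finally have "(x + y) ^ p - (x ^ p + y ^ p) = of_nat p * (\<Sum>k\<in>{1..<p}. of_nat (c k) * x ^ k * y ^ (p - k))"
    by (simp add: sum_distrib_left)
  moreover have "(\<Sum>k\<in>{1..<p}. of_nat (c k) * x ^ k * y ^ (p - k)) \<in> R"
    using assms by (intro sum_in mult_in power_in of_nat_in)
  ultimately show ?thesis unfolding pcong_def by blast
qed

lemma pcong_frobenius_power:
  assumes "prime p" "x \<in> R" "y \<in> R" shows "pcong p R ((x + y) ^ (p ^ m)) (x ^ (p ^ m) + y ^ (p ^ m))"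
proof (induction m)
  case (Suc m)
  have "pcong p R (((x + y) ^ (p ^ m)) ^ p) ((x ^ (p ^ m) + y ^ (p ^ m)) ^ p)"
    using Suc assms by (intro pcong_power add_in power_in)
  moreover have "pcong p R ((x ^ (p ^ m) + y ^ (p ^ m)) ^ p) ((x ^ (p ^ m)) ^ p + (y ^ (p ^ m)) ^ p)"
    using assms by (intro pcong_frobenius power_in)
  ultimately have "pcong p R (((x + y) ^ (p ^ m)) ^ p) ((x ^ (p ^ m)) ^ p + (y ^ (p ^ m)) ^ p)" by (rule pcong_trans)
  then show ?case by (simp add: power_mult[symmetric] mult.commute)
qed (auto simp: pcong_refl)

text \<open>Allows two elements fixed by different powers of Frobenius to be brought to a common
  exponent.\<close>

lemma pcong_frobenius_fixed_iterate:
  assumes "x \<in> R" "pcong p R (x ^ (p ^ m)) x" shows "pcong p R (x ^ (p ^ (m * k))) x"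
proof (induction k)
  case (Suc k)
  have "pcong p R ((x ^ (p ^ (m * k))) ^ (p ^ m)) (x ^ (p ^ m))"
    using Suc assms by (intro pcong_power power_in)
  moreover have "(x ^ (p ^ (m * k))) ^ (p ^ m) = x ^ (p ^ (m * Suc k))"
    by (simp add: power_mult[symmetric] power_add mult.commute)
  ultimately show ?case using assms pcong_trans by metis
qed (auto simp: pcong_refl)

end

section \<open>Rings stable under x -> (x^q - x)/p\<close>

inductive_set ring_closure :: "'a::idom set \<Rightarrow> 'a set" for S where
  base: "x \<in> S \<Longrightarrow> x \<in> ring_closure S"
| zero: "0 \<in> ring_closure S"
| one: "1 \<in> ring_closure S"
| minus_one: "-1 \<in> ring_closure S"
| add: "x \<in> ring_closure S \<Longrightarrow> y \<in> ring_closure S \<Longrightarrow> x + y \<in> ring_closure S"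
| mult: "x \<in> ring_closure S \<Longrightarrow> y \<in> ring_closure S \<Longrightarrow> x * y \<in> ring_closure S"

lemma is_subring_ring_closure: "is_subring (ring_closure S)"
proof -
  have "x - y \<in> ring_closure S" if "x \<in> ring_closure S" "y \<in> ring_closure S" for x y
    using ring_closure.add[OF that(1) ring_closure.mult[OF ring_closure.minus_one that(2)]] by simp
  then show ?thesis unfolding is_subring_def by (auto intro: ring_closure.intros)
qed

text \<open>For a ring S this says that each element of S/pS is fixed by some power of Frobenius.
  Such a quotient has no nilpotents, which is how ramification is excluded. The exponent m may
  depend on x.\<close>

definition frobenius_stable :: "nat \<Rightarrow> 'a::idom set \<Rightarrow> bool" where
  "frobenius_stable p S \<longleftrightarrow> (\<forall>x\<in>S. \<exists>m\<ge>1. \<exists>y\<in>S. x ^ (p ^ m) - x = of_nat p * y)"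

text \<open>If x and y are fixed modulo p by the exponents m and n, both are fixed by m * n, and
  that power of Frobenius is additive and multiplicative modulo p.\<close>

lemma frobenius_stable_ring_closure:
  assumes "prime p" "frobenius_stable p S" shows "frobenius_stable p (ring_closure S)"
proof -
  interpret subring_of "ring_closure S" by unfold_locales (rule is_subring_ring_closure)
  have "\<exists>m\<ge>1. pcong p (ring_closure S) (x ^ (p ^ m)) x" if "x \<in> ring_closure S" for x
    using that
  proof (induction x rule: ring_closure.induct)
    case (base x)
    then show ?case using assms(2) ring_closure.base unfolding frobenius_stable_def pcong_def by metis
  next
    case zero
    have "0 ^ (p ^ 1) = (0::'a)" using assms(1) prime_gt_0_nat by auto
    then have "pcong p (ring_closure S) (0 ^ (p ^ 1)) 0" using pcong_refl by metis
    then show ?case by blast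
  next
    case one
    show ?case by (intro exI[of _ 1]) (auto simp: pcong_refl)
  next
    case minus_one
    show ?case
    \<comment> \<open>An odd power fixes -1; for p = 2 the difference 1 - (-1) is 2 times 1.\<close>
    proof (cases "p = 2")
      case True
      then have "((-1) ^ (p ^ 1) - (-1) :: 'a) = of_nat p * 1" by simp
      then show ?thesis unfolding pcong_def using one_in by (intro exI[of _ 1]) blast
    next
      case False
      then have "odd p" using assms(1) primes_dvd_imp_eq two_is_prime_nat by blast
      then have "(-1) ^ (p ^ 1) = (-1 :: 'a)" by simp
      then show ?thesis by (intro exI[of _ 1]) (auto simp: pcong_refl)
    qed
  next
    case (add x y)
    then obtain m n where mn: "m \<ge> 1" "n \<ge> 1" "pcong p (ring_closure S) (x ^ (p ^ m)) x"
      "pcong p (ring_closure S) (y ^ (p ^ n)) y" by blast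
    have "pcong p (ring_closure S) (x ^ (p ^ (m * n))) x" "pcong p (ring_closure S) (y ^ (p ^ (n * m))) y"
      using mn add pcong_frobenius_fixed_iterate by blast+
    then have "pcong p (ring_closure S) (x ^ (p ^ (m * n)) + y ^ (p ^ (m * n))) (x + y)"
      by (intro pcong_add) (simp_all add: mult.commute)
    then have "pcong p (ring_closure S) ((x + y) ^ (p ^ (m * n))) (x + y)"
      using pcong_frobenius_power[OF assms(1)] add pcong_trans by blast
    moreover have "m * n \<ge> 1" using mn by simp
    ultimately show ?case by blast
  next
    case (mult x y)
    then obtain m n where mn: "m \<ge> 1" "n \<ge> 1" "pcong p (ring_closure S) (x ^ (p ^ m)) x"
      "pcong p (ring_closure S) (y ^ (p ^ n)) y" by blast
    have "pcong p (ring_closure S) (x ^ (p ^ (m * n))) x" "pcong p (ring_closure S) (y ^ (p ^ (n * m))) y"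
      using mn mult pcong_frobenius_fixed_iterate by blast+
    then have "pcong p (ring_closure S) (x ^ (p ^ (m * n)) * y ^ (p ^ (m * n))) (x * y)"
      using mult by (intro pcong_mult power_in) (simp_all add: mult.commute)
    then have "pcong p (ring_closure S) ((x * y) ^ (p ^ (m * n))) (x * y)"
      by (simp add: power_mult_distrib)
    moreover have "m * n \<ge> 1" using mn by simp
    ultimately show ?case by blast
  qed
  then show ?thesis unfolding frobenius_stable_def pcong_def by blast
qed

context cp_model begin

lemma is_subring_O: "is_subring {x. av x \<le> 1}"
  unfolding is_subring_def by (auto intro: av_add_le av_diff_le av_mult_le_1)

lemma ring_closure_O: assumes "S \<subseteq> {x. av x \<le> 1}" shows "ring_closure S \<subseteq> {x. av x \<le> 1}"
proof
  fix x assume "x \<in> ring_closure S"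
  then show "x \<in> {x. av x \<le> 1}"
    by (induction rule: ring_closure.induct) (use assms in \<open>auto intro: av_add_le av_mult_le_1\<close>)
qed

text \<open>If |x| < 1, then x^q is smaller than x, so |x| = |x^q - x| = |p| |y| with y again in A.
  Each such step multiplies the absolute value by e, so after finitely many steps it reaches
  1.\<close>

lemma frobenius_stable_values:
  assumes A: "A \<subseteq> {x. av x \<le> 1}" "frobenius_stable p A" and "x \<in> A" "x \<noteq> 0"
  shows "\<exists>n::nat. av x = exp (- real n)"
proof -
  have "\<exists>n::nat. av x = exp (- real n)" if "x \<in> A" "x \<noteq> 0" "av x > exp (- real k)" for x k
    using that
  proof (induction k arbitrary: x)
    case 0
    then show ?case using A(1) by force
  next
    case (Suc k)
    show ?case
    proof (cases "av x = 1")
      case True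
      then show ?thesis by (intro exI[of _ 0]) simp
    next
      case False
      then have x1: "av x < 1" using A(1) Suc.prems by force
      obtain m y where m: "m \<ge> 1" "y \<in> A" "x ^ (p ^ m) - x = of_nat p * y"
        using A(2) Suc.prems unfolding frobenius_stable_def by metis
      have "p ^ m > 1" using m(1) p_prime prime_gt_1_nat by (intro one_less_power) auto
      then have "av x ^ (p ^ m) < av x ^ 1" using x1 Suc.prems av_pos by (intro power_strict_decreasing) auto
      then have "av ((x - x ^ (p ^ m)) - x) < av x" by (simp add: av_power)
      then have "av x = av (x - x ^ (p ^ m))" using av_eqI by metis
      also have "\<dots> = exp (-1) * av y" using m(3) av_diff_commute by (metis av_mult av_p)
      finally have e: "av x = exp (-1) * av y" .
      have y0: "y \<noteq> 0" using e Suc.prems by auto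
      have "av y = exp 1 * av x" using e by (simp add: exp_minus)
      also have "\<dots> > exp 1 * exp (- real (Suc k))" using Suc.prems by simp
      also have "exp 1 * exp (- real (Suc k)) = exp (- real k)" by (simp add: exp_add[symmetric])
      finally obtain n :: nat where "av y = exp (- real n)" using Suc.IH m y0 by blast
      then have "av x = exp (- real (Suc n))" using e by (simp add: exp_add[symmetric])
      then show ?thesis by blast
    qed
  qed
  moreover obtain k where "av x > exp (- real k)"
  proof -
    obtain k :: nat where "real k > - ln (av x)" using reals_Archimedean2 by blast
    then have "exp (- real k) < exp (ln (av x))" by simp
    then show ?thesis using that[of k] av_pos assms by simp
  qed
  ultimately show ?thesis using assms by blast
qed

text \<open>\<open>ring_closure {a}\<close> is Z[a]. Clearing denominators is harmless for
  integrality of valuations, since N itself has an integer valuation.\<close>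

lemma poly_emb_integer_multiple:
  "\<exists>N>0. of_nat N * poly (emb f) a \<in> ring_closure {a}"
proof (induction f)
  case 0
  then show ?case by (intro exI[of _ 1]) (auto intro: ring_closure.intros)
next
  case (pCons c f)
  interpret subring_of "ring_closure {a}" by unfold_locales (rule is_subring_ring_closure)
  obtain N where N: "N > 0" "of_nat N * poly (emb f) a \<in> ring_closure {a}" using pCons by blast
  obtain x y where xy: "c = of_int x / of_int y" "y > 0"
    by (metis quotient_of_denom_pos quotient_of_div surj_pair)
  have int: "of_int z \<in> ring_closure {a}" for z
    by (cases z) (auto intro: of_nat_in uminus_in simp del: of_nat_Suc)
  have y: "of_nat (nat y) * of_rat c = (of_int x :: 'k)"
    using xy by (simp add: of_rat_divide)
  have "of_nat (N * nat y) * poly (emb (pCons c f)) a =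
      of_nat N * (of_nat (nat y) * of_rat c) + of_nat (nat y) * a * (of_nat N * poly (emb f) a)"
    by (simp add: emb_pCons algebra_simps)
  also have "\<dots> \<in> ring_closure {a}"
    unfolding y using add_in[OF mult_in[OF of_nat_in int] mult_in[OF mult_in[OF of_nat_in ring_closure.base] N(2)]] by blast
  finally show ?case using N(1) xy(2) by (intro exI[of _ "N * nat y"]) auto
qed

lemma intval_rat: "intval (of_rat q)"
proof (cases "q = 0")
  case False
  then have "av (of_rat q) = exp (of_int (- padic_val_rat p q))" using v_rat by (simp add: av_def)
  then show ?thesis unfolding intval_def by blast
qed (simp add: intval_def)

lemma frobenius_stable_imp_unramified:
  assumes S: "S \<subseteq> {x. av x \<le> 1}" "frobenius_stable p S" "a \<in> S"
  shows "unramified_in v a"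
proof (rule unramifiedI)
  show "av a \<le> 1" using S by auto
  fix f
  obtain N where N: "N > 0" "of_nat N * poly (emb f) a \<in> ring_closure {a}" using poly_emb_integer_multiple by blast
  have mono: "x \<in> ring_closure S" if "x \<in> ring_closure {a}" for x
    using that by (induction rule: ring_closure.induct) (use S in \<open>auto intro: ring_closure.intros\<close>)
  have "intval x" if "x \<in> ring_closure S" for x
  proof (cases "x = 0")
    case False
    then obtain n :: nat where "av x = exp (- real n)"
      using frobenius_stable_values[OF ring_closure_O[OF S(1)] frobenius_stable_ring_closure[OF p_prime S(2)]
          \<open>x \<in> ring_closure S\<close>] by auto
    then have "av x = exp (of_int (- int n))" by simp
    then show ?thesis unfolding intval_def by blast
  qed (simp add: intval_def)
  then have "intval (of_nat N * poly (emb f) a)" using N mono by blast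
  then have "intval ((of_nat N * poly (emb f) a) / of_rat (of_nat N))" by (intro intval_divide intval_rat)
  then show "intval (poly (emb f) a)" using N(1) by simp
qed

section \<open>The residue field is algebraic over the prime field\<close>

lemma Zloc_residue:
  assumes "av (of_rat q) \<le> 1" shows "\<exists>n<p. av (of_rat q - of_nat n) < 1"
proof -
  obtain a b where ab: "\<not> int p dvd b" "q = of_int a / of_int b"
    using assms av_rat_le_1_iff by (auto simp: Zloc_iff)
  have b0: "b \<noteq> 0" using ab by auto
  have "prime (int p)" using p_prime by simp
  then have "coprime (int p) b" using ab(1) by (rule prime_imp_coprime)
  then have "gcd b (int p) = 1" by (simp add: coprime_commute)
  \<comment> \<open>s inverts b modulo p, so the remainder of a * s represents the residue of
    a/b.\<close>
  then obtain s t where st: "s * b + t * int p = 1" using bezout_int[of b "int p"] by auto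
  define n where "n = nat ((a * s) mod int p)"
  have pp: "int p > 0" using p_prime prime_gt_0_nat by auto
  have n: "int n = (a * s) mod int p" "n < p" unfolding n_def using pp by (auto simp: nat_less_iff)
  obtain m where m: "a * s = int n + int p * m" using n(1) by (metis mod_mult_div_eq add.commute mult.commute)
  have "a = a * (s * b + t * int p)" using st by simp
  also have "\<dots> = (a * s) * b + a * t * int p" by (simp add: algebra_simps)
  finally have "a = (int n + int p * m) * b + a * t * int p" unfolding m .
  then have e: "a - int n * b = int p * (m * b + a * t)" by algebra
  have "q - of_nat n = of_int (a - int n * b) / of_int b" using ab b0 by (simp add: field_simps)
  also have "\<dots> = of_nat p * (of_int (m * b + a * t) / of_int b)" unfolding e by simp
  finally have q: "q - of_nat n = of_nat p * (of_int (m * b + a * t) / of_int b)" .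
  have "of_int (m * b + a * t) / of_int b \<in> Zloc p" using ab unfolding Zloc_iff by blast
  then have "av (of_rat (of_int (m * b + a * t) / of_int b)) \<le> 1" using av_rat_le_1_iff by blast
  then have "av (of_rat (q - of_nat n)) < 1"
    unfolding q of_rat_mult using av_mult_less_1[OF av_p_less_1] by simp
  then show ?thesis using n(2) by (auto simp: of_rat_diff)
qed

text \<open>An equation of y over Q_p is approximated by a rational one to within its Gauss norm,
  scaled, and reduced: the residue of y satisfies a monic equation over the prime field, written
  with natural coefficients.\<close>

lemma residue_algebraic_relation:
  assumes "av y \<le> 1" "y \<in> Qpbar_in v"
  shows "\<exists>D c. av (y ^ D - (\<Sum>i<D. of_nat (c i) * y ^ i)) < 1"
proof -
  obtain f where f: "f \<noteq> 0" "\<forall>i. coeff f i \<in> Qp_in v" "poly f y = 0" using assms(2) by (auto simp: Qpbar_in_def)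
  have gf: "gn f > 0" using f gn_nonneg[of f] gn_eq_0_iff[of f] by linarith
  obtain g where g: "gn (f - emb g) < gn f" using Qp_poly_approx[OF f(2) gf] by blast
  have gg: "gn (emb g) = gn f"
  proof (rule antisym)
    show "gn (emb g) \<le> gn f" using gn_diff_le[of f "gn f" "f - emb g"] g by simp
    show "gn f \<le> gn (emb g)" using gn_add[of "f - emb g" "emb g"] g by auto
  qed
  have "poly (emb g) y = - poly (f - emb g) y" using f by simp
  then have yg: "av (poly (emb g) y) < gn f" using poly_le_gn[OF assms(1), of "f - emb g"] g by (simp only: av_minus)
  define S where "S = {i. av (coeff (emb g) i) = gn f}"
  have "coeff (emb g) i \<noteq> 0" if "i \<in> S" for i
  proof
    assume "coeff (emb g) i = 0"
    then have "av (coeff (emb g) i) = 0" by simp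
    then show False using that gf unfolding S_def by simp
  qed
  then have "S \<subseteq> {..degree (emb g)}" using le_degree by blast
  then have fin: "finite S" using finite_subset by blast
  have "S \<noteq> {}" unfolding S_def using gn_attained[of "emb g"] gg by auto
  \<comment> \<open>The last coefficient of maximal size survives reduction as the leading one;
    everything above it becomes small.\<close>
  define D where "D = Max S"
  have D: "av (coeff (emb g) D) = gn f" using Max_in[OF fin \<open>S \<noteq> {}\<close>] unfolding D_def S_def by auto
  have gtD: "av (coeff (emb g) i) < gn f" if "i > D" for i
  proof -
    have "i \<notin> S" using that fin unfolding D_def by (metis Max_ge leD)
    then show ?thesis using coeff_le_gn[of "emb g" i] gg unfolding S_def by auto
  qed
  define h where "h = smult (inverse (coeff g D)) g"
  have gD: "coeff g D \<noteq> 0" using D gf by auto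
  have avh: "av (coeff (emb h) i) = av (coeff (emb g) i) / gn f" for i
    unfolding h_def using D by (simp add: of_rat_mult of_rat_inverse av_mult av_inverse divide_inverse mult.commute)
  have hD: "coeff (emb h) D = 1" unfolding h_def using gD by simp
  have hle: "av (coeff (emb h) i) \<le> 1" for i using avh[of i] coeff_le_gn[of "emb g" i] gg gf by (simp add: field_simps)
  have hlt: "av (coeff (emb h) i) < 1" if "i > D" for i using avh[of i] gtD[OF that] gf by (simp add: field_simps)
  have hy: "av (poly (emb h) y) < 1"
  proof -
    have "av (poly (emb h) y) = inverse (gn f) * av (poly (emb g) y)"
      using D unfolding h_def by (simp add: emb_smult of_rat_inverse av_mult av_inverse)
    also have "\<dots> < inverse (gn f) * gn f" using yg gf by (intro mult_strict_left_mono) auto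
    also have "inverse (gn f) * gn f = 1" using f by simp
    finally show ?thesis .
  qed
  \<comment> \<open>The negated coefficient is approximated, so that y^D is expressed by the lower
    powers with a plus sign.\<close>
  have "\<exists>n. av (- coeff (emb h) i - of_nat n) < 1" for i
  proof -
    have "av (of_rat (- coeff h i)) \<le> 1" using hle[of i] by (simp add: of_rat_minus)
    then obtain n where "av (of_rat (- coeff h i) - of_nat n) < 1" using Zloc_residue by blast
    then have "av (- coeff (emb h) i - of_nat n) < 1" by (simp add: of_rat_minus)
    then show ?thesis ..
  qed
  then obtain c where c: "\<And>i. av (- coeff (emb h) i - of_nat (c i)) < 1" by metis
  define N where "N = max D (degree (emb h))"
  have yi: "av (y ^ i) \<le> 1" for i using assms(1) by (rule av_power_le_1)
  have "poly (emb h) y = (\<Sum>i\<le>degree (emb h). coeff (emb h) i * y ^ i)" by (rule poly_altdef)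
  also have "\<dots> = (\<Sum>i\<le>N. coeff (emb h) i * y ^ i)"
    by (rule sum.mono_neutral_left) (auto simp: N_def coeff_eq_0 simp del: coeff_emb)
  also have "{..N} = insert D ({..<D} \<union> {D<..N})" by (auto simp: N_def)
  also have "(\<Sum>i\<in>insert D ({..<D} \<union> {D<..N}). coeff (emb h) i * y ^ i) =
      y ^ D + ((\<Sum>i<D. coeff (emb h) i * y ^ i) + (\<Sum>i\<in>{D<..N}. coeff (emb h) i * y ^ i))"
    using hD sum.union_disjoint[OF _ _ Int_emptyI, of "{..<D}" "{D<..N}" "\<lambda>i. coeff (emb h) i * y ^ i"]
    by (subst sum.insert) (auto simp del: coeff_emb)
  finally have eq: "y ^ D - (\<Sum>i<D. of_nat (c i) * y ^ i) =
      poly (emb h) y - (\<Sum>i\<in>{D<..N}. coeff (emb h) i * y ^ i) + (\<Sum>i<D. (- coeff (emb h) i - of_nat (c i)) * y ^ i)"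
    by (simp add: algebra_simps sum.distrib sum_subtractf sum_negf)
  have "av (\<Sum>i\<in>{D<..N}. coeff (emb h) i * y ^ i) < 1"
    using hlt yi by (intro av_sum_less av_mult_less_1) auto
  moreover have "av (\<Sum>i<D. (- coeff (emb h) i - of_nat (c i)) * y ^ i) < 1"
    using c yi by (intro av_sum_less av_mult_less_1) auto
  ultimately have "av (y ^ D - (\<Sum>i<D. of_nat (c i) * y ^ i)) < 1"
    unfolding eq by (intro av_add_less av_diff_less hy)
  then show ?thesis by blast
qed

lemma of_nat_mod_p: "av (of_nat n - of_nat (n mod p)) < 1"
proof -
  have "(of_nat n :: 'k) = of_nat (p * (n div p) + n mod p)" by simp
  then have "(of_nat n :: 'k) - of_nat (n mod p) = of_nat p * of_nat (n div p)" by (simp only: of_nat_add of_nat_mult) simp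
  then show ?thesis using av_mult_less_1[OF av_p_less_1 av_of_nat_le_1] by metis
qed

text \<open>By density c may be replaced by an algebraic y with the same residue. Powers of y reduce
  to combinations of 1, ..., y^(D-1) with coefficients below p; there are finitely many, so two
  Frobenius iterates of y coincide in the residue field.\<close>

lemma residue_frobenius_fixed:
  assumes "av c \<le> 1" shows "\<exists>m\<ge>1. av (c ^ (p ^ m) - c) < 1"
proof -
  obtain y where y: "y \<in> Qpbar_in v" "v (c - y) \<ge> ereal 1" using dense by blast
  have cy: "av (c - y) < 1" using y(2) unfolding v_ge_iff by (meson exp_less_one_iff neg_less_0_iff_less order_le_less_trans zero_less_one)
  have y1: "av y \<le> 1" using av_diff_le[of c 1 "c - y"] cy assms by simp
  obtain D b where Db: "av (y ^ D - (\<Sum>i<D. of_nat (b i) * y ^ i)) < 1" using residue_algebraic_relation y y1 by metis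
  have yi: "av (y ^ i) \<le> 1" for i using y1 by (rule av_power_le_1)
  have D0: "D \<noteq> 0" using Db by (intro notI) simp
  have rep: "\<exists>e. av (y ^ j - (\<Sum>i<D. of_nat (e i) * y ^ i)) < 1" for j
  proof (induction j)
    case 0
    have "(\<Sum>i<D. of_nat ((if i = 0 then 1 else 0)) * y ^ i) = (\<Sum>i<D. if i = 0 then 1 else 0)"
      by (rule sum.cong) auto
    also have "\<dots> = 1" using D0 by (simp add: sum.delta)
    finally show ?case by (intro exI[of _ "\<lambda>i. if i = 0 then 1 else 0"]) simp
  next
    case (Suc j)
    then obtain e where e: "av (y ^ j - (\<Sum>i<D. of_nat (e i) * y ^ i)) < 1" by blast
    obtain D' where D': "D = Suc D'" using D0 by (cases D) auto
    \<comment> \<open>Multiplication by y shifts coefficients up by one; the overflow at y^D is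
      rewritten with the relation for y^D.\<close>
    define e' where "e' i = (if i = 0 then 0 else e (i - 1)) + e D' * b i" for i
    have "y * (\<Sum>i<D. of_nat (e i) * y ^ i) = (\<Sum>i<D'. of_nat (e i) * y ^ Suc i) + of_nat (e D') * y ^ D"
      unfolding D' by (simp add: distrib_left sum_distrib_left mult_ac)
    also have "(\<Sum>i<D'. of_nat (e i) * y ^ Suc i) = (\<Sum>i<D. of_nat (if i = 0 then 0 else e (i - 1)) * y ^ i)"
      unfolding D' by (subst sum.lessThan_Suc_shift) auto
    finally have s: "y * (\<Sum>i<D. of_nat (e i) * y ^ i) = (\<Sum>i<D. of_nat (if i = 0 then 0 else e (i - 1)) * y ^ i) + of_nat (e D') * y ^ D" .
    have "(\<Sum>i<D. of_nat (e' i) * y ^ i) = (\<Sum>i<D. of_nat (if i = 0 then 0 else e (i - 1)) * y ^ i) + of_nat (e D') * (\<Sum>i<D. of_nat (b i) * y ^ i)"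
      unfolding e'_def by (simp add: sum.distrib[symmetric] sum_distrib_left algebra_simps)
    then have eq: "y ^ Suc j - (\<Sum>i<D. of_nat (e' i) * y ^ i) =
       y * (y ^ j - (\<Sum>i<D. of_nat (e i) * y ^ i)) + of_nat (e D') * (y ^ D - (\<Sum>i<D. of_nat (b i) * y ^ i))"
      using s by (simp add: algebra_simps)
    have "av (y * (y ^ j - (\<Sum>i<D. of_nat (e i) * y ^ i))) < 1"
      using av_mult_less_1[OF e y1] by (simp add: mult.commute)
    moreover have "av (of_nat (e D') * (y ^ D - (\<Sum>i<D. of_nat (b i) * y ^ i))) < 1"
      using av_mult_less_1[OF Db av_of_nat_le_1] by (simp add: mult.commute)
    ultimately have "av (y ^ Suc j - (\<Sum>i<D. of_nat (e' i) * y ^ i)) < 1" unfolding eq by (rule av_add_less)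
    then show ?case by blast
  qed
  have rep': "\<exists>e\<in>{..<D} \<rightarrow>\<^sub>E {..<p}. av (y ^ j - (\<Sum>i<D. of_nat (e i) * y ^ i)) < 1" for j
  proof -
    obtain e where e: "av (y ^ j - (\<Sum>i<D. of_nat (e i) * y ^ i)) < 1" using rep by blast
    define e' where "e' = restrict (\<lambda>i. e i mod p) {..<D}"
    have eq: "y ^ j - (\<Sum>i<D. of_nat (e' i) * y ^ i) = (y ^ j - (\<Sum>i<D. of_nat (e i) * y ^ i)) + (\<Sum>i<D. (of_nat (e i) - of_nat (e i mod p)) * y ^ i)"
      by (simp add: e'_def algebra_simps sum_subtractf)
    have "av (\<Sum>i<D. (of_nat (e i) - of_nat (e i mod p)) * y ^ i) < 1"
      using yi of_nat_mod_p by (intro av_sum_less av_mult_less_1) auto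
    with e have "av (y ^ j - (\<Sum>i<D. of_nat (e' i) * y ^ i)) < 1" unfolding eq by (rule av_add_less)
    moreover have "e' \<in> {..<D} \<rightarrow>\<^sub>E {..<p}" using p_prime prime_gt_0_nat unfolding e'_def by auto
    ultimately show ?thesis by blast
  qed
  obtain E where E: "\<And>j. E j \<in> {..<D} \<rightarrow>\<^sub>E {..<p}" "\<And>j. av (y ^ (p ^ j) - (\<Sum>i<D. of_nat (E j i) * y ^ i)) < 1"
    using rep'[of "p ^ j" for j] by metis
  have "finite ({..<D} \<rightarrow>\<^sub>E {..<p})" by (intro finite_PiE) auto
  moreover have "range E \<subseteq> {..<D} \<rightarrow>\<^sub>E {..<p}" using E by blast
  ultimately have "finite (range E)" using finite_subset by blast
  then have "\<not> inj E" using finite_imageD infinite_UNIV_nat by blast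
  then obtain i j where ij: "i < j" "E i = E j" by (metis injI linorder_neqE_nat)
  have "av (y ^ (p ^ i) - y ^ (p ^ j)) < 1"
    using av_trans_less[OF E(2)[of i], of "y ^ (p ^ j)"] E(2)[of j] unfolding ij(2) by (simp add: av_diff_commute)
  then have d: "av (y ^ (p ^ j) - y ^ (p ^ i)) < 1" by (simp add: av_diff_commute)
  define m where "m = j - i"
  have m1: "m \<ge> 1" using ij by (simp add: m_def)
  interpret O: subring_of "{x. av x \<le> 1}" by unfold_locales (rule is_subring_O)
  have pc: "av (a - b) < 1" if "pcong p {x. av x \<le> 1} a b" for a b
    using that av_mult_less_1[OF av_p_less_1] by (auto simp: pcong_def)
  \<comment> \<open>Frobenius is injective on the residue field: with q = p^m, the p^i-th power of
    y^q - y is congruent to y^(p^j) - y^(p^i), which is small.\<close>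
  have "pcong p {x. av x \<le> 1} (((y ^ (p ^ m) - y) + y) ^ (p ^ i)) ((y ^ (p ^ m) - y) ^ (p ^ i) + y ^ (p ^ i))"
    using y1 by (intro O.pcong_frobenius_power p_prime) (auto intro: av_diff_le av_power_le_1)
  then have "av ((y ^ (p ^ m)) ^ (p ^ i) - ((y ^ (p ^ m) - y) ^ (p ^ i) + y ^ (p ^ i))) < 1" using pc by simp
  moreover have "(y ^ (p ^ m)) ^ (p ^ i) = y ^ (p ^ j)" using ij by (simp add: m_def power_mult[symmetric] power_add[symmetric])
  ultimately have "av ((y ^ (p ^ j) - y ^ (p ^ i)) - (y ^ (p ^ m) - y) ^ (p ^ i)) < 1" by (simp add: algebra_simps)
  then have "av ((y ^ (p ^ m) - y) ^ (p ^ i)) < 1" using d av_diff_less[OF d] by fastforce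
  then have ym: "av (y ^ (p ^ m) - y) < 1" unfolding av_power
    by (metis av_nonneg linorder_not_less one_le_power)
  have "c ^ (p ^ m) - y ^ (p ^ m) = (c - y) * (\<Sum>i<p ^ m. y ^ (p ^ m - Suc i) * c ^ i)" by (rule power_diff_sumr2)
  moreover have "av (\<Sum>i<p ^ m. y ^ (p ^ m - Suc i) * c ^ i) \<le> 1"
    using assms y1 by (intro av_sum_le av_mult_le_1 av_power_le_1) auto
  ultimately have "av (c ^ (p ^ m) - y ^ (p ^ m)) < 1" using av_mult_less_1[OF cy] by metis
  then have "av (c ^ (p ^ m) - c) < 1" using ym cy av_trans_less av_diff_commute by metis
  then show ?thesis using m1 by blast
qed

text \<open>The residue of c is a root of X^q - X, a polynomial with Gauss norm at least 1, so an
  exact root lies nearby.\<close>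

lemma teichmueller:
  assumes "av c \<le> 1" shows "\<exists>m t. m \<ge> 1 \<and> t ^ (p ^ m) = t \<and> av (c - t) < 1"
proof -
  obtain m where m: "m \<ge> 1" "av (c ^ (p ^ m) - c) < 1" using residue_frobenius_fixed assms by blast
  define Q :: "'k poly" where "Q = monom 1 (p ^ m) - [:0, 1:]"
  have "p ^ m > 1" using m(1) p_prime prime_gt_1_nat by (intro one_less_power) auto
  then have "coeff Q (p ^ m) = 1" unfolding Q_def using m(1) by (auto simp: coeff_pCons split: nat.split)
  then have "gn Q \<ge> 1" using coeff_le_gn[of Q "p ^ m"] by simp
  moreover have "poly Q c = c ^ (p ^ m) - c" unfolding Q_def by (simp add: poly_monom)
  ultimately obtain r where "poly Q r = 0" "av (c - r) < 1" using approximate_root[OF assms, of Q] m by auto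
  then show ?thesis using m(1) unfolding Q_def by (intro exI[of _ m] exI[of _ r]) (simp add: poly_monom)
qed

section \<open>Integer-valued polynomials on balls\<close>

text \<open>The coefficients are Taylor coefficients of f at a, scaled by powers of c. Hence the
  Gauss norm of f on a ball around an unramified a is an integer power of e.\<close>

lemma poly_pcompose_emb_coeff: "\<exists>h. coeff (pcompose (emb f) [:a, of_rat c:]) i = poly (emb h) a"
proof (induction f arbitrary: i)
  case (pCons b f)
  show ?case
  proof (cases i)
    case 0
    obtain h where h: "coeff (pcompose (emb f) [:a, of_rat c:]) 0 = poly (emb h) a" using pCons by blast
    then show ?thesis using 0 by (intro exI[of _ "pCons b h"]) (simp add: emb_pCons pcompose_pCons mult.commute)
  next
    case (Suc j)
    obtain h where h: "coeff (pcompose (emb f) [:a, of_rat c:]) (Suc j) = poly (emb h) a" using pCons by blast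
    obtain g where g: "coeff (pcompose (emb f) [:a, of_rat c:]) j = poly (emb g) a" using pCons by blast
    show ?thesis using h g Suc
      by (intro exI[of _ "pCons 0 h + smult c g"]) (simp add: emb_pCons emb_add emb_smult pcompose_pCons coeff_pCons mult.commute)
  qed
qed (auto intro: exI[of _ 0])

lemma Int_Q_point: "Int_Q v (closed_ball_p v a \<infinity>) = {f. av (poly (emb f) a) \<le> 1}"
proof -
  have "closed_ball_p v a \<infinity> = {a}" using v_inf by (auto simp: closed_ball_p_def delta_val_def)
  then show ?thesis by (simp add: Int_Q_def Op_in_def v_nonneg_iff emb_def)
qed

definition ballmap :: "'k \<Rightarrow> nat \<Rightarrow> 'k poly" where "ballmap a n = [:a, of_nat p ^ n:]"

text \<open>\<open>ballmap\<close> parametrizes the ball by the unit ball, where integrality of all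
  values is the bound on the Gauss norm by the maximum principle.\<close>

lemma Int_Q_ball: "Int_Q v (closed_ball_p v a (enat n)) = {f. gn (pcompose (emb f) (ballmap a n)) \<le> 1}"
proof -
  have p0: "of_nat p ^ n \<noteq> (0::'k)" using p_nz by simp
  have "x \<in> closed_ball_p v a (enat n) \<longleftrightarrow> (\<exists>y. av y \<le> 1 \<and> x = a + of_nat p ^ n * y)" for x
  proof
    assume "x \<in> closed_ball_p v a (enat n)"
    then have "av (x - a) \<le> exp (- real n)" by (simp add: closed_ball_p_def delta_val_def v_ge_iff)
    then have "av ((x - a) / of_nat p ^ n) \<le> 1" by (simp add: av_divide av_p_power)
    moreover have "x = a + of_nat p ^ n * ((x - a) / of_nat p ^ n)" using p0 by simp
    ultimately show "\<exists>y. av y \<le> 1 \<and> x = a + of_nat p ^ n * y" by blast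
  next
    assume "\<exists>y. av y \<le> 1 \<and> x = a + of_nat p ^ n * y"
    then obtain y where "av y \<le> 1" "x - a = of_nat p ^ n * y" by auto
    then have "av (x - a) \<le> exp (- real n)" by (simp add: av_mult av_p_power)
    then show "x \<in> closed_ball_p v a (enat n)" by (simp add: closed_ball_p_def delta_val_def v_ge_iff)
  qed
  then have b: "closed_ball_p v a (enat n) = {a + of_nat p ^ n * y | y. av y \<le> 1}" by blast
  show ?thesis unfolding gn_le_1_iff b
    by (auto simp: Int_Q_def Op_in_def v_nonneg_iff emb_def[symmetric] poly_pcompose ballmap_def mult.commute)
qed

text \<open>Treats balls of finite radius and points together. As N takes integer powers of e as
  values and N(p) = exp(-1), N f < 1 already means that p divides f; so pR is the set N < 1, which
  is prime by multiplicativity.\<close>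

lemma integral_norm_imp_separated:
  assumes "p_overring R p"
    and R: "R = {f. N f \<le> 1}" and mult: "\<And>f g. N (f * g) = N f * N g"
    and pos: "\<And>f. N f \<ge> (0::real)" "\<And>f. f \<noteq> 0 \<Longrightarrow> N f \<noteq> 0" and Np: "N [:of_nat p:] = exp (-1)"
    and int: "\<And>f. f \<noteq> 0 \<Longrightarrow> \<exists>k::int. N f = exp (of_int k)"
  shows "p_prime_separated p R"
proof -
  interpret p_overring R p by fact
  have N1: "N 1 = 1" using mult[of 1 1] pos(2)[of 1] by simp
  have "N [:P:] * N [:inverse P:] = 1" using mult[of "[:P:]" "[:inverse P:]"] P0 N1 by (simp add: one_pCons)
  then have Ni: "N [:inverse P:] = exp 1" using Np by (simp add: P_def exp_minus field_simps)
  have Nsi: "N (smult (inverse P ^ n) f) = exp (real n) * N f" for n f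
  proof (induction n)
    case (Suc n)
    have "N (smult (inverse P ^ Suc n) f) = N ([:inverse P:] * smult (inverse P ^ n) f)" by (simp add: mult.commute)
also have "\<dots> = exp 1 * (exp (real n) * N f)" unfolding mult Ni Suc by simp
    finally show ?case by (simp add: exp_add)
  qed simp
  have pd: "f \<in> pdiv p R \<longleftrightarrow> N f < 1" for f
  proof (cases "f = 0")
    case True
    have "N 0 = N [:P:] * N 0" using mult[of "[:P:]" 0] by simp
    then have "N 0 = 0" using Np by (simp add: P_def)
    then show ?thesis using True zero_in by (simp add: pdiv_iff)
  next
    case False
    then obtain k :: int where k: "N f = exp (of_int k)" using int by blast
    have "f \<in> pdiv p R \<longleftrightarrow> exp 1 * N f \<le> 1" using Nsi[of 1 f] unfolding pdiv_iff by (simp add: R)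
    also have "\<dots> \<longleftrightarrow> 1 + real_of_int k \<le> 0" unfolding k by (simp add: exp_add[symmetric])
    also have "\<dots> \<longleftrightarrow> k < 0" by linarith
    finally show ?thesis unfolding k by simp
  qed
  show ?thesis unfolding p_prime_separated_def
  proof (intro conjI ballI impI allI)
    show "1 \<notin> pdiv p R" using pd N1 by simp
    fix f g assume "f \<in> R" "g \<in> R" "f * g \<in> pdiv p R"
    then have "N f \<le> 1" "N g \<le> 1" "N f * N g < 1" unfolding pd by (auto simp: R mult)
    then have "N f < 1 \<or> N g < 1" by (cases "N f = 1") auto
    then show "f \<in> pdiv p R \<or> g \<in> pdiv p R" by (simp add: pd)
  next
    fix f :: "rat poly" assume "f \<noteq> 0"
    then have p: "N f > 0" using pos(1)[of f] pos(2)[of f] by linarith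
    obtain n :: nat where "real n > - ln (N f)" using reals_Archimedean2 by blast
    then have "exp (real n) * exp (ln (N f)) > 1" unfolding exp_add[symmetric] by simp
    then have "smult (inverse P ^ n) f \<notin> R" using p Nsi by (simp add: R)
    then show "\<exists>n. smult (inverse (of_nat p) ^ n) f \<notin> R" by (auto simp: P_def)
  qed
qed

text \<open>The norm is the Gauss norm on the ball for finite d, and |f(a)| for infinite d.
  Unramifiedness makes its values integral powers of e; for infinite d, transcendence of a makes it
  nonzero on nonzero polynomials.\<close>

lemma ball_imp_separated:
  assumes "p_overring R p" "admissible v a d" "unramified_in v a" "R = Int_Q v (closed_ball_p v a d)"
  shows "p_prime_separated p R"
proof (cases d)
  case (enat n)
  define N where "N f = gn (pcompose (emb f) (ballmap a n))" for f
  have p0: "of_nat p ^ n \<noteq> (0::'k)" using p_nz by simp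
  show ?thesis
  proof (rule integral_norm_imp_separated[where N = N])
    show "R = {f. N f \<le> 1}" using assms(4) enat Int_Q_ball by (simp add: N_def)
    show "N (f * g) = N f * N g" for f g by (simp add: N_def emb_mult pcompose_mult gn_mult)
    show "N [:of_nat p:] = exp (-1)" by (simp add: N_def emb_pCons gn_pCons av_p)
    show nz: "N f \<noteq> 0" if "f \<noteq> 0" for f
      using that p0 by (simp add: N_def pcompose_eq_0_iff ballmap_def)
    show "\<exists>k::int. N f = exp (of_int k)" if f: "f \<noteq> 0" for f
    proof -
      obtain i where i: "N f = av (coeff (pcompose (emb f) (ballmap a n)) i)" unfolding N_def using gn_attained by blast
      obtain h where "coeff (pcompose (emb f) (ballmap a n)) i = poly (emb h) a"
        using poly_pcompose_emb_coeff[of f a "of_nat p ^ n" i] by (auto simp: ballmap_def of_rat_power)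
      then have "intval (coeff (pcompose (emb f) (ballmap a n)) i)" using unramifiedD assms by metis
      then show ?thesis using i nz[OF f] unfolding intval_def by auto
    qed
  qed (use assms in \<open>auto simp: N_def\<close>)
next
  case infinity
  then have tr: "transcendental_over_Q a" using assms by (auto simp: admissible_def)
  show ?thesis
  proof (rule integral_norm_imp_separated[where N = "\<lambda>f. av (poly (emb f) a)"])
    show "R = {f. av (poly (emb f) a) \<le> 1}" using assms(4) infinity Int_Q_point by simp
    show "av (poly (emb (f * g)) a) = av (poly (emb f) a) * av (poly (emb g) a)" for f g by (simp add: emb_mult av_mult)
    show "av (poly (emb [:of_nat p:]) a) = exp (-1)" by (simp add: emb_pCons av_p)
    show nz: "av (poly (emb f) a) \<noteq> 0" if "f \<noteq> 0" for f
      using tr that by (auto simp: transcendental_over_Q_def emb_def)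
    show "\<exists>k::int. av (poly (emb f) a) = exp (of_int k)" if "f \<noteq> 0" for f
      using unramifiedD[OF assms(3), of f] nz[OF that] by (auto simp: intval_def)
  qed (use assms in auto)
qed

end

section \<open>Extension of the valuation to polynomials over the algebraically closed field\<close>

locale cp_ring = cp_model p v + p_valued_ring R p
  for p :: nat and v :: "'k::field_char_0 \<Rightarrow> ereal" and R :: "rat poly set"

text \<open>V plays the part of a local ring with maximal ideal M, cut down to C_p[X]. Elements
  outside M need have no inverse there, and \<open>V_sat\<close> states instead that they can be
  cancelled.\<close>

locale valuation_extension = cp_ring p v R
  for p :: nat and v :: "'k::field_char_0 \<Rightarrow> ereal" and R :: "rat poly set" +
  fixes V M :: "'k poly set"
  assumes V_subring: "is_subring V"
    and M_sub: "M \<subseteq> V" and M_add: "x \<in> M \<Longrightarrow> y \<in> M \<Longrightarrow> x + y \<in> M"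
    and M_mult: "x \<in> V \<Longrightarrow> y \<in> M \<Longrightarrow> x * y \<in> M"
    and M_prime: "x \<in> V \<Longrightarrow> y \<in> V \<Longrightarrow> x * y \<in> M \<Longrightarrow> x \<in> M \<or> y \<in> M"
    and V_sat: "u \<in> V \<Longrightarrow> u \<notin> M \<Longrightarrow> u * x \<in> V \<Longrightarrow> x \<in> V"
    and V_const: "[:c:] \<in> V \<longleftrightarrow> av c \<le> 1" and M_const: "[:c:] \<in> M \<longleftrightarrow> av c < 1"
    and V_emb: "emb f \<in> V \<longleftrightarrow> f \<in> R" and M_emb: "f \<in> R \<Longrightarrow> emb f \<in> M \<longleftrightarrow> f \<in> pdiv p R"

context cp_ring begin

lemma pdiv_add: "f \<in> pdiv p R \<Longrightarrow> g \<in> pdiv p R \<Longrightarrow> f + g \<in> pdiv p R"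
  by (simp add: pdiv_iff smult_add_right add_in)

lemma pdiv_0: "0 \<in> pdiv p R" by (simp add: pdiv_iff zero_in)

lemma av_P: "av (of_rat P) = exp (-1)" by (simp add: P_def av_p)

lemma smult_small_pdiv:
  assumes "av (of_rat c) < 1" "f \<in> R" shows "smult c f \<in> pdiv p R"
proof -
  have "av (of_rat (inverse P * c)) = exp 1 * av (of_rat c)"
    by (simp add: of_rat_mult of_rat_inverse av_mult av_inverse av_P exp_minus)
  also have "\<dots> \<le> exp 1 * exp (-1)" using av_rat_less_1[OF assms(1)] by (intro mult_left_mono) auto
  finally have "av (of_rat (inverse P * c)) \<le> 1" by (simp add: exp_add[symmetric])
  then have "inverse P * c \<in> Zloc p" using av_rat_le_1_iff by blast
  then show ?thesis using smult_in[OF _ assms(2)] by (simp add: pdiv_iff)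
qed

text \<open>Flatness: a combination of elements of R with small coefficients that happens to be rational
  lies in pR. A coefficient relation with a pivot of maximal size eliminates one term.\<close>
lemma rational_small_combination:
  assumes "finite J" "\<And>j. j \<in> J \<Longrightarrow> av (a j) < 1" "\<And>j. j \<in> J \<Longrightarrow> f j \<in> R"
    and "(\<Sum>j\<in>J. smult (a j) (emb (f j))) = emb g"
  shows "g \<in> pdiv p R"
  using assms
proof (induction "card J" arbitrary: J f g rule: less_induct)
  case less
  show ?case
  proof (cases "\<forall>j\<in>J. f j = 0")
    case True
    then have "emb g = 0" using less.prems(4) by simp
    then show ?thesis using pdiv_0 by simp
  next
    case False
    then obtain j1 k where j1: "j1 \<in> J" "coeff (f j1) k \<noteq> 0" by (metis leading_coeff_neq_0)
    define A where "A j = av (of_rat (coeff (f j) k))" for j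
    have "Max (A ` J) \<in> A ` J" using less.prems(1) j1 by (intro Max_in) auto
    then obtain j0 where j0: "j0 \<in> J" "A j0 = Max (A ` J)" by (metis imageE)
    have Ale: "A j \<le> A j0" if "j \<in> J" for j using that less.prems(1) j0 by simp
    have "A j1 > 0" using j1 unfolding A_def by (intro av_pos) simp
    then have Apos: "A j0 > 0" using Ale[OF j1(1)] by linarith
    then have c0: "coeff (f j0) k \<noteq> 0" unfolding A_def by auto
    define r where "r j = coeff (f j) k / coeff (f j0) k" for j
    define m where "m = coeff g k / coeff (f j0) k"
    have r1: "av (of_rat (r j)) \<le> 1" if "j \<in> J" for j
      using Ale[OF that] Apos unfolding r_def A_def by (simp add: of_rat_divide av_divide)
    have rZ: "r j \<in> Zloc p" if "j \<in> J" for j using r1[OF that] av_rat_le_1_iff by blast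
    have "(\<Sum>j\<in>J. a j * of_rat (coeff (f j) k)) = of_rat (coeff g k)"
      using arg_cong[OF less.prems(4), of "\<lambda>p. coeff p k"] by (simp add: coeff_sum)
    then have "(\<Sum>j\<in>J. a j * of_rat (coeff (f j) k)) / of_rat (coeff (f j0) k) = of_rat m"
      by (simp add: m_def of_rat_divide)
    then have rel: "(\<Sum>j\<in>J. a j * of_rat (r j)) = of_rat m"
      by (simp add: r_def of_rat_divide sum_divide_distrib)
    have "av (\<Sum>j\<in>J. a j * of_rat (r j)) < 1"
      using less.prems(1,2) r1 by (intro av_sum_less av_mult_less_1) auto
    then have m1: "av (of_rat m) < 1" using rel by simp
    have r0: "r j0 = 1" using c0 by (simp add: r_def)
    have a0: "a j0 = of_rat m - (\<Sum>j\<in>J - {j0}. a j * of_rat (r j))"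
      using rel sum.remove[OF less.prems(1) j0(1), of "\<lambda>j. a j * of_rat (r j)"] r0 by (simp add: eq_diff_eq)
    \<comment> \<open>Since r j0 = 1, the relation expresses a j0 through m and the other
      coefficients. Substituting it replaces each f j by f j - r j * f j0 and leaves over m * f j0,
      which is in pR because m is small and rational.\<close>
    have "g - smult m (f j0) \<in> pdiv p R"
    proof (rule less.hyps[where J = "J - {j0}" and f = "\<lambda>j. f j - smult (r j) (f j0)"])
      show "card (J - {j0}) < card J" using less.prems(1) j0 by (intro psubset_card_mono) auto
      show "f j - smult (r j) (f j0) \<in> R" if "j \<in> J - {j0}" for j
        using that less.prems(3) rZ j0(1) by (intro diff_in smult_in) auto
      have "emb g = smult (a j0) (emb (f j0)) + (\<Sum>j\<in>J - {j0}. smult (a j) (emb (f j)))"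
        using less.prems(4) sum.remove[OF less.prems(1) j0(1), of "\<lambda>j. smult (a j) (emb (f j))"] by simp
      also have "smult (a j0) (emb (f j0)) = smult (of_rat m) (emb (f j0)) - (\<Sum>j\<in>J - {j0}. smult (a j * of_rat (r j)) (emb (f j0)))"
        unfolding a0 by (simp add: smult_diff_left smult_sum)
      finally show "(\<Sum>j\<in>J - {j0}. smult (a j) (emb (f j - smult (r j) (f j0)))) = emb (g - smult m (f j0))"
        by (simp add: emb_diff emb_smult smult_diff_right sum_subtractf)
    qed (use less.prems in auto)
    moreover have "smult m (f j0) \<in> pdiv p R" using smult_small_pdiv[OF m1] less.prems(3) j0 by blast
    ultimately have "(g - smult m (f j0)) + smult m (f j0) \<in> pdiv p R" by (rule pdiv_add)
    then show ?thesis by simp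
  qed
qed

end

section \<open>The ring generated by R and the integers of C_p\<close>

inductive_set (in cp_ring) lspan :: "'k set \<Rightarrow> 'k poly set" for A where
  zero: "0 \<in> lspan A"
| step: "x \<in> lspan A \<Longrightarrow> c \<in> A \<Longrightarrow> f \<in> R \<Longrightarrow> x + smult c (emb f) \<in> lspan A"

context cp_ring begin

lemma lspan_add: "x \<in> lspan A \<Longrightarrow> y \<in> lspan A \<Longrightarrow> x + y \<in> lspan A"
proof -
  assume x: "x \<in> lspan A" assume "y \<in> lspan A"
  then show "x + y \<in> lspan A"
    by (induction rule: lspan.induct) (use x in \<open>auto simp: add.assoc[symmetric] intro: lspan.step\<close>)
qed

lemma lspan_single: "c \<in> A \<Longrightarrow> f \<in> R \<Longrightarrow> smult c (emb f) \<in> lspan A"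
  using lspan.step[OF lspan.zero] by fastforce

lemma lspan_mult:
  assumes "x \<in> lspan A" "y \<in> lspan B" "\<And>a b. a \<in> A \<Longrightarrow> b \<in> B \<Longrightarrow> a * b \<in> D"
  shows "x * y \<in> lspan D"
  using assms(1)
proof (induction rule: lspan.induct)
  case (step x c f)
  have "smult c (emb f) * y \<in> lspan D" using assms(2)
  proof (induction rule: lspan.induct)
    case (step y d g)
    have "smult c (emb f) * (y + smult d (emb g)) = smult c (emb f) * y + smult (c * d) (emb (f * g))"
      by (simp add: distrib_left emb_mult mult.commute)
    then show ?case using step \<open>c \<in> A\<close> \<open>f \<in> R\<close> assms(3) mult_in by (metis lspan.step)
  qed (simp add: lspan.zero)
  then show ?case using step lspan_add by (simp add: distrib_right)
qed (simp add: lspan.zero)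

lemma lspan_mono: assumes "A \<subseteq> B" "x \<in> lspan A" shows "x \<in> lspan B"
  using assms(2) by (induction rule: lspan.induct) (use assms(1) in \<open>auto intro: lspan.intros\<close>)

lemma lspan_explicit:
  assumes "x \<in> lspan A"
  shows "\<exists>n::nat. \<exists>a f. x = (\<Sum>j<n. smult (a j) (emb (f j))) \<and> (\<forall>j<n. a j \<in> A \<and> f j \<in> R)"
  using assms
proof (induction rule: lspan.induct)
  case zero
  show ?case by (intro exI[of _ 0]) auto
next
  case (step x c g)
  then obtain n :: nat and a f where n: "x = (\<Sum>j<n. smult (a j) (emb (f j)))" "\<forall>j<n. a j \<in> A \<and> f j \<in> R" by blast
  have "x + smult c (emb g) = (\<Sum>j<Suc n. smult ((a(n := c)) j) (emb ((f(n := g)) j)))"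
    unfolding n(1) by simp
  moreover have "\<forall>j<Suc n. (a(n := c)) j \<in> A \<and> (f(n := g)) j \<in> R" using n(2) step by (auto simp: less_Suc_eq)
  ultimately show ?case by blast
qed

definition C :: "'k poly set" where "C = lspan {c. av c \<le> 1}"
definition mC :: "'k poly set" where "mC = lspan {c. av c < 1}"

lemma mC_rational: assumes "emb g \<in> mC" shows "g \<in> pdiv p R"
proof -
  obtain n :: nat and a f where "emb g = (\<Sum>j<n. smult (a j) (emb (f j)))" "\<forall>j<n. av (a j) < 1 \<and> f j \<in> R"
    using lspan_explicit[OF assms[unfolded mC_def]] by auto
  then show ?thesis by (intro rational_small_combination[of "{..<n}" a f g]) auto
qed

lemma C_const: "av c \<le> 1 \<Longrightarrow> [:c:] \<in> C"
  using lspan_single[of c "{c. av c \<le> 1}" 1] one_in by (simp add: C_def emb_1)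

lemma mC_const: "av c < 1 \<Longrightarrow> [:c:] \<in> mC"
  using lspan_single[of c "{c. av c < 1}" 1] one_in by (simp add: mC_def emb_1)

lemma C_emb: "f \<in> R \<Longrightarrow> emb f \<in> C"
  using lspan_single[of 1 "{c. av c \<le> 1}" f] by (simp add: C_def)

lemma C_add: "x \<in> C \<Longrightarrow> y \<in> C \<Longrightarrow> x + y \<in> C" unfolding C_def by (rule lspan_add)
lemma C_mult: "x \<in> C \<Longrightarrow> y \<in> C \<Longrightarrow> x * y \<in> C"
  unfolding C_def by (erule lspan_mult, assumption) (auto intro: av_mult_le_1)
lemma C_mC_mult: "x \<in> C \<Longrightarrow> y \<in> mC \<Longrightarrow> x * y \<in> mC"
  unfolding C_def mC_def by (erule lspan_mult, assumption) (metis av_mult_less_1 mem_Collect_eq mult.commute)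
lemma mC_sub: "mC \<subseteq> C" unfolding C_def mC_def using lspan_mono[of "{c. av c < 1}" "{c. av c \<le> 1}"] by force

text \<open>The last clause says that I avoids the multiplicative set R - pR. It also keeps I
  proper, because 1 is not in pR.\<close>

definition C_ideal :: "'k poly set \<Rightarrow> bool" where
  "C_ideal I \<longleftrightarrow> mC \<subseteq> I \<and> I \<subseteq> C \<and> (\<forall>x\<in>I. \<forall>y\<in>I. x + y \<in> I) \<and> (\<forall>x\<in>C. \<forall>y\<in>I. x * y \<in> I) \<and>
     (\<forall>f\<in>R. emb f \<in> I \<longrightarrow> f \<in> pdiv p R)"

lemma C_ideal_mC: "C_ideal mC"
  unfolding C_ideal_def using mC_sub C_mC_mult mC_rational lspan_add by (auto simp: mC_def)

lemma C_ideal_maximal: "\<exists>I. C_ideal I \<and> (\<forall>J. C_ideal J \<longrightarrow> I \<subseteq> J \<longrightarrow> J = I)"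
proof -
  have "\<exists>I\<in>Collect C_ideal. \<forall>J\<in>Collect C_ideal. I \<subseteq> J \<longrightarrow> J = I"
  proof (rule subset_Zorn_nonempty)
    show "Collect C_ideal \<noteq> {}" using C_ideal_mC by auto
    fix F assume F: "F \<noteq> {}" "subset.chain (Collect C_ideal) F"
    have id: "C_ideal I" if "I \<in> F" for I using F(2) that by (auto simp: subset.chain_def)
    have tot: "I \<subseteq> J \<or> J \<subseteq> I" if "I \<in> F" "J \<in> F" for I J using F(2) that by (auto simp: subset.chain_def)
    have "C_ideal (\<Union>F)" unfolding C_ideal_def
    proof (intro conjI ballI impI)
      show "mC \<subseteq> \<Union>F" using F(1) id unfolding C_ideal_def by blast
      show "\<Union>F \<subseteq> C" using id unfolding C_ideal_def by blast
      show "f \<in> pdiv p R" if "f \<in> R" "emb f \<in> \<Union>F" for f using that id unfolding C_ideal_def by blast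
      show "x * y \<in> \<Union>F" if "x \<in> C" "y \<in> \<Union>F" for x y using that id unfolding C_ideal_def by blast
      fix x y assume "x \<in> \<Union>F" "y \<in> \<Union>F"
      then obtain I J where IJ: "I \<in> F" "J \<in> F" "x \<in> I" "y \<in> J" by blast
      then obtain K where "K \<in> F" "x \<in> K" "y \<in> K" using tot by blast
      then show "x + y \<in> \<Union>F" using id unfolding C_ideal_def by blast
    qed
    then show "\<Union>F \<in> Collect C_ideal" by simp
  qed
  then show ?thesis by auto
qed

text \<open>The classical argument that an ideal maximal among those avoiding a multiplicative set
  is prime.\<close>

lemma C_ideal_maximal_prime:
  assumes I: "C_ideal I" and mx: "\<And>J. C_ideal J \<Longrightarrow> I \<subseteq> J \<Longrightarrow> J = I"
    and x: "x \<in> C" "y \<in> C" "x * y \<in> I"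
  shows "x \<in> I \<or> y \<in> I"
proof (rule ccontr)
  assume nin: "\<not> ?thesis"
  have Ia: "a + b \<in> I" if "a \<in> I" "b \<in> I" for a b using I that unfolding C_ideal_def by blast
  have Im: "a * b \<in> I" if "a \<in> C" "b \<in> I" for a b using I that unfolding C_ideal_def by blast
  have IC: "a \<in> C" if "a \<in> I" for a using I that unfolding C_ideal_def by blast
  have IR: "f \<in> pdiv p R" if "f \<in> R" "emb f \<in> I" for f using I that unfolding C_ideal_def by blast
  have one: "1 \<in> C" using C_emb[OF one_in] by simp
  have zI: "0 \<in> I" using I lspan.zero[of "{c. av c < 1}"] unfolding C_ideal_def mC_def by blast
  have zC: "0 \<in> C" using IC zI by blast
  \<comment> \<open>For z outside I, the larger ideal I + C z must meet R - pR.\<close>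
  have key: "\<exists>f a c. f \<in> R \<and> f \<notin> pdiv p R \<and> a \<in> I \<and> c \<in> C \<and> emb f = a + c * z" if "z \<in> C" "z \<notin> I" for z
  proof (rule ccontr)
    assume no: "\<not> ?thesis"
    define J where "J = {a + c * z | a c. a \<in> I \<and> c \<in> C}"
    have IJ: "I \<subseteq> J" unfolding J_def using zC by force
    have "C_ideal J" unfolding C_ideal_def
    proof (intro conjI ballI impI)
      show "mC \<subseteq> J" using IJ I unfolding C_ideal_def by blast
      show "J \<subseteq> C" unfolding J_def using IC C_add C_mult that by blast
      fix s t assume "s \<in> J" "t \<in> J"
      then obtain a b c d where "s = a + c * z" "t = b + d * z" "a \<in> I" "b \<in> I" "c \<in> C" "d \<in> C"
        unfolding J_def by blast
      moreover have "(a + c * z) + (b + d * z) = (a + b) + (c + d) * z" by (simp add: algebra_simps)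
      ultimately show "s + t \<in> J" unfolding J_def using Ia C_add by blast
    next
      fix s t assume "s \<in> C" "t \<in> J"
      then obtain a c where "t = a + c * z" "a \<in> I" "c \<in> C" unfolding J_def by blast
      moreover have "s * (a + c * z) = s * a + (s * c) * z" by (simp add: algebra_simps)
      ultimately show "s * t \<in> J" unfolding J_def using \<open>s \<in> C\<close> Im C_mult by blast
    next
      fix f assume "f \<in> R" "emb f \<in> J"
      then show "f \<in> pdiv p R" unfolding J_def using no by blast
    qed
    then have "J = I" using mx IJ by blast
    moreover have "0 + 1 * z \<in> J" unfolding J_def using zI one by blast
    ultimately show False using that by simp
  qed
  obtain f a c where f: "f \<in> R" "f \<notin> pdiv p R" "a \<in> I" "c \<in> C" "emb f = a + c * x" using key[of x] nin x by blast
  obtain g b d where g: "g \<in> R" "g \<notin> pdiv p R" "b \<in> I" "d \<in> C" "emb g = b + d * y" using key[of y] nin x by blast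
  \<comment> \<open>Every term contains a, b or x * y, so the product of two elements of R - pR
    would fall into I.\<close>
  have "emb (f * g) = (b + d * y) * a + ((c * x) * b + (c * d) * (x * y))"
    unfolding emb_mult f(5) g(5) by (simp add: algebra_simps)
  also have "\<dots> \<in> I"
    by (intro Ia Im[OF C_add[OF IC[OF g(3)] C_mult[OF g(4) x(2)]] f(3)]
        Im[OF C_mult[OF f(4) x(1)] g(3)] Im[OF C_mult[OF f(4) g(4)] x(3)])
  finally have "f * g \<in> pdiv p R" using IR mult_in f g by blast
  then show False using pdiv_prime f g by blast
qed

lemma valuation_extension_exists: "\<exists>V M. valuation_extension p v R V M"
proof -
  obtain I where I: "C_ideal I" and mx: "\<And>J. C_ideal J \<Longrightarrow> I \<subseteq> J \<Longrightarrow> J = I"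
    using C_ideal_maximal by blast
  have Ia: "a + b \<in> I" if "a \<in> I" "b \<in> I" for a b using I that unfolding C_ideal_def by blast
  have Im: "a * b \<in> I" if "a \<in> C" "b \<in> I" for a b using I that unfolding C_ideal_def by blast
  have IC: "a \<in> C" if "a \<in> I" for a using I that unfolding C_ideal_def by blast
  have IR: "f \<in> pdiv p R" if "f \<in> R" "emb f \<in> I" for f using I that unfolding C_ideal_def by blast
  have prim: "x \<in> I \<or> y \<in> I" if "x \<in> C" "y \<in> C" "x * y \<in> I" for x y
    by (rule C_ideal_maximal_prime[OF I _ that]) (rule mx)
  have mI: "a \<in> I" if "a \<in> mC" for a using I that unfolding C_ideal_def by blast
  define S where "S = C - I"
  have one: "1 \<in> S" using C_emb[OF one_in] IR[OF one_in] one_nin unfolding S_def by auto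
  have Sm: "s * t \<in> S" if "s \<in> S" "t \<in> S" for s t
    using that C_mult prim[of s t] unfolding S_def by blast
  have SC: "s \<in> C" if "s \<in> S" for s using that unfolding S_def by blast
  \<comment> \<open>The localizations of C and of I at S, intersected with C_p[X]; fractions are
    replaced by the existence of a denominator in S.\<close>
  define V where "V = {x. \<exists>u\<in>S. u * x \<in> C}"
  define M where "M = {x. \<exists>u\<in>S. u * x \<in> I}"
  have neg: "[:- 1:] \<in> C" using C_const[of "-1"] by simp
  have VI: "x \<in> V" if "u \<in> S" "u * x \<in> C" for x u using that unfolding V_def by blast
  have CV: "x \<in> V" if "x \<in> C" for x using VI[OF one] that by simp
  have IM: "x \<in> M" if "x \<in> I" for x using one that unfolding M_def by force
  have Vadd: "x + y \<in> V" if xy: "x \<in> V" "y \<in> V" for x y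
  proof -
    obtain s t where st: "s \<in> S" "t \<in> S" "s * x \<in> C" "t * y \<in> C" using xy unfolding V_def by blast
    have "(s * t) * (x + y) = t * (s * x) + s * (t * y)" by (simp add: algebra_simps)
    also have "\<dots> \<in> C" by (rule C_add[OF C_mult[OF SC[OF st(2)] st(3)] C_mult[OF SC[OF st(1)] st(4)]])
    finally show ?thesis using VI[OF Sm[OF st(1,2)]] by blast
  qed
  have Vmult: "x * y \<in> V" if xy: "x \<in> V" "y \<in> V" for x y
  proof -
    obtain s t where st: "s \<in> S" "t \<in> S" "s * x \<in> C" "t * y \<in> C" using xy unfolding V_def by blast
    have "(s * t) * (x * y) = (s * x) * (t * y)" by (simp add: algebra_simps)
    also have "\<dots> \<in> C" by (rule C_mult[OF st(3,4)])
    finally show ?thesis using VI[OF Sm[OF st(1,2)]] by blast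
  qed
  have "x - y \<in> V" if "x \<in> V" "y \<in> V" for x y
    using Vadd[OF that(1) Vmult[OF CV[OF neg] that(2)]] by simp
  then have V: "is_subring V"
    unfolding is_subring_def using CV C_emb[OF one_in] C_const[of 0] Vadd Vmult by auto
  \<comment> \<open>A constant of absolute value at least 1 has an integral inverse, which would
    carry u * c in I back to u in I.\<close>
  have big: False if c: "av c \<ge> 1" "u \<in> S" "u * [:c:] \<in> I" for c u
  proof -
    have "c \<noteq> 0" using c by auto
    have "u = [:inverse c:] * (u * [:c:])" using \<open>c \<noteq> 0\<close> by simp
    also have "\<dots> \<in> I" using c by (intro Im[OF C_const c(3)]) (auto simp: av_inverse inverse_le_1_iff)
    finally show False using c unfolding S_def by blast
  qed
  have big': False if c: "av c > 1" "u \<in> S" "u * [:c:] \<in> C" for c u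
  proof -
    have "c \<noteq> 0" using c by auto
    have "u = (u * [:c:]) * [:inverse c:]" using \<open>c \<noteq> 0\<close> by simp
    also have "\<dots> \<in> I" using c by (intro Im[OF c(3) mI[OF mC_const]]) (auto simp: av_inverse inverse_less_1_iff)
    finally show False using c unfolding S_def by blast
  qed
  have "valuation_extension p v R V M"
  proof (unfold_locales)
    show "is_subring V" by (rule V)
    show "M \<subseteq> V" unfolding M_def V_def using IC by blast
  next
    fix x y assume "x \<in> M" "y \<in> M"
    then obtain s t where st: "s \<in> S" "t \<in> S" "s * x \<in> I" "t * y \<in> I" unfolding M_def by blast
    have "(s * t) * (x + y) = t * (s * x) + s * (t * y)" by (simp add: algebra_simps)
    also have "\<dots> \<in> I" by (rule Ia[OF Im[OF SC[OF st(2)] st(3)] Im[OF SC[OF st(1)] st(4)]])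
    finally show "x + y \<in> M" using Sm[OF st(1,2)] unfolding M_def by blast
  next
    fix x y assume "x \<in> V" "y \<in> M"
    then obtain s t where st: "s \<in> S" "t \<in> S" "s * x \<in> C" "t * y \<in> I" unfolding M_def V_def by blast
    have "(s * t) * (x * y) = (s * x) * (t * y)" by (simp add: algebra_simps)
    also have "\<dots> \<in> I" by (rule Im[OF st(3,4)])
    finally show "x * y \<in> M" using Sm[OF st(1,2)] unfolding M_def by blast
  next
    fix x y assume "x \<in> V" "y \<in> V" "x * y \<in> M"
    then obtain s t u where st: "s \<in> S" "t \<in> S" "s * x \<in> C" "t * y \<in> C" "u \<in> S" "u * (x * y) \<in> I"
      unfolding M_def V_def by blast
    have "(u * (s * x)) * (t * y) = (s * t) * (u * (x * y))" by (simp add: algebra_simps)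
    also have "\<dots> \<in> I" by (rule Im[OF C_mult[OF SC[OF st(1)] SC[OF st(2)]] st(6)])
    finally have "u * (s * x) \<in> I \<or> t * y \<in> I"
      by (rule prim[OF C_mult[OF SC[OF st(5)] st(3)] st(4)])
    then have "(u * s) * x \<in> I \<or> t * y \<in> I" by (simp add: mult.assoc)
    moreover have "u * s \<in> S" using Sm[OF st(5,1)] .
    ultimately show "x \<in> M \<or> y \<in> M" using st(2) unfolding M_def by auto
  next
    fix u x assume u: "u \<in> V" "u \<notin> M" "u * x \<in> V"
    then obtain s t where st: "s \<in> S" "t \<in> S" "s * u \<in> C" "t * (u * x) \<in> C" unfolding V_def by blast
    have "s * u \<in> S" using st u unfolding S_def M_def by blast
    then have ts: "t * (s * u) \<in> S" using st Sm by blast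
    have "(t * (s * u)) * x = s * (t * (u * x))" by (simp add: algebra_simps)
    also have "\<dots> \<in> C" using st SC C_mult by blast
    finally show "x \<in> V" using VI ts by blast
  next
    fix c :: 'k
    show "[:c:] \<in> V \<longleftrightarrow> av c \<le> 1"
    proof
      assume "[:c:] \<in> V"
      then obtain u where "u \<in> S" "u * [:c:] \<in> C" unfolding V_def by blast
      then show "av c \<le> 1" using big'[of c u] linorder_not_le by blast
    qed (rule CV[OF C_const])
    show "[:c:] \<in> M \<longleftrightarrow> av c < 1"
    proof
      assume "[:c:] \<in> M"
      then obtain u where "u \<in> S" "u * [:c:] \<in> I" unfolding M_def by blast
      then show "av c < 1" using big[of c u] linorder_not_le by blast
    qed (rule IM[OF mI[OF mC_const]])
  next
    fix f :: "rat poly"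
    show "emb f \<in> M \<longleftrightarrow> f \<in> pdiv p R" if fR: "f \<in> R"
    proof
      assume "emb f \<in> M"
      then obtain u where "u \<in> S" "u * emb f \<in> I" unfolding M_def by blast
      then have "emb f \<in> I" using prim[of u "emb f"] C_emb fR unfolding S_def by blast
      then show "f \<in> pdiv p R" using IR fR by blast
    next
      assume "f \<in> pdiv p R"
      then obtain g where g: "g \<in> R" "f = smult P g" by (auto simp: pdiv_def P_def)
      have "emb f = smult (of_rat P) (emb g)" using g by (simp add: emb_smult)
      also have "\<dots> \<in> mC" unfolding mC_def using g av_P by (intro lspan_single) auto
      finally show "emb f \<in> M" using IM mI by blast
    qed
    show "emb f \<in> V \<longleftrightarrow> f \<in> R"
    proof
      assume fV: "emb f \<in> V"
      show "f \<in> R"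
      proof (cases "f = 0")
        case False
        show ?thesis
        proof (rule ccontr)
          assume "f \<notin> R"
          \<comment> \<open>The normalized g is a positive power of p times f, so a denominator u of
            f puts u * g into I, although g lies in R - pR and u lies outside I.\<close>
          then have w: "w0 f < 0" using w0_nonneg_iff False by auto
          define g where "g = smult (P powi (- w0 f)) f"
          have g: "g \<in> R" "g \<notin> pdiv p R" using w0_normalized[OF False] unfolding g_def by auto
          obtain u where u: "u \<in> S" "u * emb f \<in> C" using fV unfolding V_def by blast
          have "av (of_rat (P powi (- w0 f))) = exp (-1) ^ nat (- w0 f)"
            using w by (simp add: power_int_def of_rat_power av_power av_P)
          also have "\<dots> < 1" using w by (intro power_less_one_iff[THEN iffD2]) auto
          finally have small: "av (of_rat (P powi (- w0 f))) < 1" .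
          have "u * emb g = (u * emb f) * [:of_rat (P powi (- w0 f)):]"
            unfolding g_def emb_smult by simp
          also have "\<dots> \<in> I" by (rule Im[OF u(2) mI[OF mC_const[OF small]]])
          finally have "emb g \<in> I" using prim[of u "emb g"] u(1) C_emb g(1) unfolding S_def by blast
          then show False using IR g by blast
        qed
      qed (simp add: zero_in)
    qed (rule CV[OF C_emb])
  qed
  then show ?thesis by blast
qed

end

section \<open>Successive approximation of the centre of the ball\<close>

text \<open>The sum is (g^q - t^q)/(g - t). Modulo I it becomes q t^(q-1), which vanishes. It is
  applied both to M in V and to Gauss norm below 1.\<close>

lemma power_quotient_sum_in_ideal:
  fixes g t :: "'a::idom"
  assumes "is_subring V" and add: "\<And>x y. x \<in> I \<Longrightarrow> y \<in> I \<Longrightarrow> x + y \<in> I"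
    and mult: "\<And>x y. x \<in> V \<Longrightarrow> y \<in> I \<Longrightarrow> x * y \<in> I"
    and g: "g \<in> V" "t \<in> V" "g - t \<in> I" "of_nat q \<in> I"
  shows "(\<Sum>i<q. t ^ (q - Suc i) * g ^ i) \<in> I"
proof -
  interpret subring_of V by unfold_locales fact
  have zero: "0 \<in> I" using mult[OF zero_in g(4)] by simp
  have sum: "sum f A \<in> I" if "\<And>i. i \<in> A \<Longrightarrow> f i \<in> I" for f and A :: "nat set"
    using that by (induction A rule: infinite_finite_induct) (auto intro: add zero)
  have d: "g ^ i - t ^ i \<in> I" for i
  proof -
    have "g ^ i - t ^ i = (\<Sum>j<i. t ^ (i - Suc j) * g ^ j) * (g - t)"
      unfolding power_diff_sumr2[of g i t] by (simp add: mult.commute)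
    moreover have "(\<Sum>j<i. t ^ (i - Suc j) * g ^ j) \<in> V" using g by (intro sum_in mult_in power_in)
    ultimately show ?thesis using mult g(3) by simp
  qed
  have "(\<Sum>i<q. t ^ (q - Suc i) * t ^ i) = (\<Sum>i<q. t ^ (q - 1))"
    by (intro sum.cong) (auto simp: power_add[symmetric])
  also have "\<dots> = t ^ (q - 1) * of_nat q" by simp
  finally have "(\<Sum>i<q. t ^ (q - Suc i) * g ^ i) = (\<Sum>i<q. t ^ (q - Suc i) * (g ^ i - t ^ i)) + t ^ (q - 1) * of_nat q"
    by (simp add: right_diff_distrib sum_subtractf)
  also have "\<dots> \<in> I" using g d by (intro add sum mult power_in) auto
  finally show ?thesis .
qed

section \<open>Iterated Frobenius quotients of X\<close>

inductive frobenius_chain :: "nat \<Rightarrow> rat poly \<Rightarrow> bool" for p where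
  base: "frobenius_chain p [:0, 1:]"
| step: "frobenius_chain p G \<Longrightarrow> m \<ge> 1 \<Longrightarrow> G ^ (p ^ m) - G = smult (of_nat p) H \<Longrightarrow> frobenius_chain p H"

context cp_model begin

text \<open>The chain is descended from G to X. At each step the value of the previous member at x
  solves z^q - z = p * y with y in S0, so adjoining z keeps the set stable; S0 is arbitrary because
  it grows. At X the adjoined value is x itself.\<close>

lemma frobenius_chain_stable:
  assumes "frobenius_chain p G" "S0 \<subseteq> {x. av x \<le> 1}" "frobenius_stable p S0" "poly (emb G) x \<in> S0"
  shows "\<exists>S. S \<subseteq> {x. av x \<le> 1} \<and> frobenius_stable p S \<and> x \<in> S"
  using assms
proof (induction arbitrary: S0 rule: frobenius_chain.induct)
  case base
  then show ?case by auto
next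
  case (step G m H)
  define z where "z = poly (emb G) x"
  have "emb G ^ (p ^ m) - emb G = smult (of_nat p) (emb H)"
    using arg_cong[OF step.hyps(3), of emb] by (simp add: emb_diff emb_power emb_smult)
  then have e: "z ^ (p ^ m) - z = of_nat p * poly (emb H) x"
    unfolding z_def by (metis poly_diff poly_power poly_smult)
  have "p ^ m > 1" using step.hyps(2) p_prime prime_gt_1_nat by (intro one_less_power) auto
  \<comment> \<open>If |z| > 1, then z^q would dominate z^q - z, which however is a multiple of
    p.\<close>
  have z1: "av z \<le> 1"
  proof (rule ccontr)
    assume z: "\<not> ?thesis"
    then have "av z ^ 1 < av z ^ (p ^ m)" using \<open>p ^ m > 1\<close> by (intro power_strict_increasing) auto
    then have "av ((z ^ (p ^ m) - z) - z ^ (p ^ m)) < av (z ^ (p ^ m))" by (simp add: av_power)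
    then have "av (z ^ (p ^ m) - z) = av (z ^ (p ^ m))" by (rule av_eqI)
    moreover have "av (z ^ (p ^ m)) > 1" using z prime_gt_0_nat[OF p_prime] unfolding av_power by (intro one_less_power) auto
    moreover have "av (of_nat p * poly (emb H) x) < 1"
      using step.prems av_mult_less_1[OF av_p_less_1] by blast
    ultimately show False using e by simp
  qed
  have "frobenius_stable p (insert z S0)" unfolding frobenius_stable_def
  proof
    fix y assume "y \<in> insert z S0"
    then show "\<exists>m\<ge>1. \<exists>y'\<in>insert z S0. y ^ (p ^ m) - y = of_nat p * y'"
    proof
      assume "y = z"
      then show ?thesis using e step.hyps(2) step.prems(3) by blast
    next
      assume "y \<in> S0"
      then show ?thesis using step.prems(2) unfolding frobenius_stable_def by blast
    qed
  qed
  then show ?case using step.IH[of "insert z S0"] step.prems(1) z1 unfolding z_def by auto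
qed

lemma frobenius_chain_unramified:
  assumes "frobenius_chain p G" "poly (emb G) x = 0" shows "unramified_in v x" "av x \<le> 1"
proof -
  have "frobenius_stable p {0::'k}" unfolding frobenius_stable_def
    using p_prime prime_gt_0_nat by (auto intro!: exI[of _ 1])
  then obtain S where "S \<subseteq> {x. av x \<le> 1}" "frobenius_stable p S" "x \<in> S"
    using frobenius_chain_stable[OF assms(1), of "{0}" x] assms(2) by auto
  then show "unramified_in v x" "av x \<le> 1" using frobenius_stable_imp_unramified by auto
qed

lemma gn_subring: "is_subring {P. gn P \<le> 1}"
  unfolding is_subring_def by (auto intro: gn_add_le gn_diff_le simp: gn_mult mult_le_one)

end

lemma pcompose_power: "pcompose (f ^ n) g = pcompose f g ^ n" for f :: "'a::comm_ring_1 poly"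
  by (induction n) (auto simp: pcompose_mult pcompose_1)

context valuation_extension begin

sublocale VR: subring_of V by unfold_locales (rule V_subring)

text \<open>The coordinate on the ball, compositional inverse of \<open>ballmap\<close>.\<close>

definition Yp :: "'k \<Rightarrow> nat \<Rightarrow> 'k poly" where
  "Yp a n = smult (inverse (of_nat p ^ n)) [:- a, 1:]"

lemma pcompose_ballmap_Yp: "pcompose (pcompose f (ballmap a n)) (Yp a n) = f"
proof -
  have "pcompose (ballmap a n) (Yp a n) = [:0, 1:]"
    using p_nz by (simp add: ballmap_def Yp_def pcompose_pCons)
  then show ?thesis by (simp add: pcompose_assoc[symmetric])
qed

lemma X_in_V: "[:0, 1:] \<in> V" using V_emb[of "[:0, 1:]"] X_in by simp

lemma pcompose_in_V: "gn A \<le> 1 \<Longrightarrow> Y \<in> V \<Longrightarrow> pcompose A Y \<in> V"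
proof (induction A)
  case (pCons a A)
  then show ?case using V_const[of a] by (auto simp: pcompose_pCons gn_pCons intro!: VR.add_in VR.mult_in)
qed (simp add: VR.zero_in)

lemma zero_in_M: "0 \<in> M" using M_const[of 0] by simp

lemma pcompose_in_M: "gn A < 1 \<Longrightarrow> Y \<in> V \<Longrightarrow> pcompose A Y \<in> M"
proof (induction A)
  case (pCons a A)
  then show ?case using M_const[of a] by (auto simp: pcompose_pCons gn_pCons intro!: M_add M_mult)
qed (simp add: zero_in_M)

lemma M_diff: "x \<in> M \<Longrightarrow> y \<in> M \<Longrightarrow> x - y \<in> M"
  using M_add[of x "[:- 1:] * y"] M_mult[of "[:- 1:]" y] V_const[of "- 1"] by simp

lemma one_notin_M: "1 \<notin> M" using M_const[of 1] by (simp add: one_pCons)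

text \<open>A splits into linear factors and M is prime, so some factor evaluated at Y lies in M;
  this replaces the fact that the residue field of C_p is algebraically closed.\<close>

lemma residue_of_algebraic:
  assumes "Y \<in> V" "gn A = 1" "pcompose A Y \<in> M"
  shows "\<exists>c. av c \<le> 1 \<and> Y - [:c:] \<in> M"
  using assms(2,3)
proof (induction "degree A" arbitrary: A rule: less_induct)
  case less
  show ?case
  proof (cases "degree A = 0")
    case True
    then obtain a where "A = [:a:]" by (metis degree_eq_zeroE)
    then show ?thesis using less.prems M_const[of a] by (simp add: gn_pCons)
  next
    case False
    then obtain r where r: "poly A r = 0" using alg_closed by blast
    define Q where "Q = synthetic_div A r"
    have PQ: "A = [:- r, 1:] * Q" using split_root[of A r] r unfolding Q_def by simp
    have dQ: "degree Q < degree A" using False unfolding Q_def by (simp add: degree_synthetic_div)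
    show ?thesis
    proof (cases "av r \<le> 1")
      case True
      then have g: "gn [:- r, 1:] = 1" by (simp add: gn_pCons)
      have gQ: "gn Q = 1" using less.prems(1) unfolding PQ gn_mult g by simp
      have "pcompose A Y = (Y - [:r:]) * pcompose Q Y" unfolding PQ pcompose_mult by (simp add: pcompose_pCons)
      moreover have "Y - [:r:] \<in> V" using assms(1) V_const[of r] True by (intro VR.diff_in) auto
      ultimately have "Y - [:r:] \<in> M \<or> pcompose Q Y \<in> M"
        using M_prime pcompose_in_V[of Q Y] gQ assms(1) less.prems(2) by simp
      then show ?thesis using True less.hyps[OF dQ gQ] by blast
    next
      \<comment> \<open>A root outside the unit ball gives the factor 1 - X/r, whose value at Y is 1
        modulo M and can be cancelled.\<close>
      case r1: False
      then have r0: "r \<noteq> 0" by auto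
      have rr: "av (inverse r) < 1" using r1 by (simp add: av_inverse inverse_less_1_iff)
      then have g: "gn [:1, - inverse r:] = 1" by (simp add: gn_pCons)
      define Q' where "Q' = smult (- r) Q"
      have PQ': "A = [:1, - inverse r:] * Q'" unfolding PQ Q'_def using r0 by (simp add: smult_add_right)
      have gQ: "gn Q' = 1" using less.prems(1) unfolding PQ' gn_mult g by simp
      have s: "[:- inverse r:] * Y \<in> M" using M_mult[OF assms(1), of "[:- inverse r:]"] M_const[of "- inverse r"] rr
        by (simp add: mult.commute)
      have e: "pcompose [:1, - inverse r:] Y = 1 + [:- inverse r:] * Y" by (simp add: pcompose_pCons one_pCons)
      have nM: "1 + [:- inverse r:] * Y \<notin> M" using M_diff[OF _ s] one_notin_M by fastforce
      have inV: "1 + [:- inverse r:] * Y \<in> V" using s M_sub VR.one_in by (intro VR.add_in) auto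
      have "(1 + [:- inverse r:] * Y) * pcompose Q' Y \<in> M" using less.prems(2) unfolding PQ' pcompose_mult e .
      then have "pcompose Q' Y \<in> M" using M_prime[OF inV] pcompose_in_V[of Q' Y] gQ assms(1) nM by simp
      then show ?thesis using less.hyps[of Q'] gQ dQ r0 unfolding Q'_def by simp
    qed
  qed
qed

text \<open>On the ball, G is congruent to e times the coordinate, with e a unit. Thus G is a
  rational replacement for the coordinate, vanishing at the centre, to which the Frobenius
  congruence in R can be applied.\<close>

definition approximant :: "'k \<Rightarrow> nat \<Rightarrow> rat poly \<Rightarrow> bool" where
  "approximant a n G \<longleftrightarrow> frobenius_chain p G \<and> G \<in> R \<and> Yp a n \<in> V \<and> poly (emb G) a = 0 \<and>
     (\<exists>e. av e = 1 \<and> gn (pcompose (emb G) (ballmap a n) - [:0, e:]) < 1)"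

lemma approximant_0: "approximant 0 0 [:0, 1:]"
proof -
  have "pcompose (emb [:0, 1:]) (ballmap 0 0) - [:0, 1:] = 0" by (simp add: ballmap_def)
  then show ?thesis unfolding approximant_def
    using X_in X_in_V by (auto simp: Yp_def intro!: frobenius_chain.base exI[of _ 1])
qed

text \<open>A polynomial integral on the ball is an integral polynomial in \<open>Yp a n\<close>,
  hence in V.\<close>

lemma Int_Q_ball_subset:
  assumes "Yp a n \<in> V" shows "Int_Q v (closed_ball_p v a (enat n)) \<subseteq> R"
proof
  fix f assume "f \<in> Int_Q v (closed_ball_p v a (enat n))"
  then have "pcompose (pcompose (emb f) (ballmap a n)) (Yp a n) \<in> V"
    using assms by (intro pcompose_in_V) (auto simp: Int_Q_ball)
  then show "f \<in> R" using V_emb by (simp add: pcompose_ballmap_Yp)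
qed

lemma approximant_step:
  assumes st: "approximant a n G" and ne: "R \<noteq> Int_Q v (closed_ball_p v a (enat n))"
  shows "\<exists>a' H. approximant a' (Suc n) H \<and> av (a' - a) \<le> exp (- real n)"
proof -
  define Y where "Y = Yp a n"
  define F where "F = pcompose (emb G) (ballmap a n)"
  obtain e where ch: "frobenius_chain p G" and GR: "G \<in> R" and YV: "Y \<in> V" and Ga: "poly (emb G) a = 0"
    and e: "av e = 1" "gn (F - [:0, e:]) < 1"
    using st unfolding approximant_def Y_def F_def by blast
  define D where "D = F - [:0, e:]"
  have F: "F = [:0, e:] + D" by (simp add: D_def)
  have D1: "gn D < 1" using e(2) by (simp add: D_def)
  have F1: "gn F \<le> 1" unfolding F using D1 e(1) by (intro gn_add_le) (auto simp: gn_pCons)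
  have pn: "(of_nat p ^ n :: 'k) \<noteq> 0" using p_nz by simp
  \<comment> \<open>Some f in R fails to be integral on the ball. Written in the coordinate Y and
    scaled to Gauss norm 1, it becomes b * f with |b| < 1, hence a nontrivial equation for Y modulo
    M.\<close>
  obtain c where c: "av c \<le> 1" "Y - [:c:] \<in> M"
  proof -
    obtain f where f: "f \<in> R" "gn (pcompose (emb f) (ballmap a n)) > 1"
      using ne Int_Q_ball_subset YV unfolding Y_def Int_Q_ball by fastforce
    define L where "L = pcompose (emb f) (ballmap a n)"
    obtain i where i: "gn L = av (coeff L i)" using gn_attained by blast
    define b where "b = inverse (coeff L i)"
    have b: "av b = inverse (gn L)" by (simp add: b_def av_inverse i)
    have "gn L \<noteq> 0" using f(2) unfolding L_def by linarith
    then have "gn (smult b L) = 1" unfolding gn_smult b by (rule left_inverse)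
    moreover have "pcompose (smult b L) Y \<in> M"
    proof -
      have "pcompose (smult b L) Y = emb f * [:b:]"
        unfolding L_def Y_def by (simp add: pcompose_smult pcompose_ballmap_Yp)
      moreover have "av b < 1" using f(2) unfolding b L_def by (simp add: inverse_less_1_iff)
      ultimately show ?thesis using M_mult[of "emb f" "[:b:]"] V_emb[of f] M_const[of b] f(1) by simp
    qed
    ultimately show ?thesis using residue_of_algebraic[OF YV] that by blast
  qed
  have pFc: "av (poly F c) \<le> 1" using poly_le_gn[OF c(1), of F] F1 by linarith
  \<comment> \<open>As Y is c modulo M, F(c) represents the residue of G at M, and t is its
    Frobenius-fixed lift.\<close>
  obtain m t where m: "m \<ge> 1" "t ^ (p ^ m) = t" "av (poly F c - t) < 1" using teichmueller[OF pFc] by blast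
  define q where "q = p ^ m"
  have tq: "t ^ q = t" using m by (simp add: q_def)
  have q1: "q > 1" unfolding q_def using m(1) p_prime prime_gt_1_nat by (intro one_less_power) auto
  \<comment> \<open>The digit c is corrected so that G takes the value t exactly at the new centre.
    The linear coefficient of F is a unit, so F - t has Gauss norm at least 1 and a root near
    c.\<close>
  obtain c' where c': "poly F c' = t" "av (c - c') < 1"
  proof -
    have "av ((e + coeff D 1) - e) < 1" using coeff_le_gn[of D 1] D1 by simp
    then have "av (e + coeff D 1) = 1" using av_eqI[of "e + coeff D 1" e] e(1) by simp
    then have "av (coeff (F - [:t:]) 1) = 1" unfolding F by simp
    then have "gn (F - [:t:]) \<ge> 1" using coeff_le_gn by metis
    then have "av (poly (F - [:t:]) c) < gn (F - [:t:])" using m(3) by simp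
    then show ?thesis using approximate_root[OF c(1)] that by fastforce
  qed
  have c'1: "av c' \<le> 1" using av_diff_le[of c 1 "c - c'"] c(1) c'(2) by simp
  have t1: "av t \<le> 1" using poly_le_gn[OF c'1, of F] c'(1) F1 by simp
  define a' where "a' = a + of_nat p ^ n * c'"
  have Ga': "poly (emb G) a' = t" using c'(1) unfolding F_def a'_def by (simp add: poly_pcompose ballmap_def mult.commute)
  define F' where "F' = pcompose F [:c', 1:]"
  obtain s E where sE: "F' = pCons s E" by (cases F') auto
  have "s = coeff F' 0" by (simp add: sE)
  then have s: "s = t" unfolding F'_def using c'(1) by (simp add: pcompose_coeff_0)
  \<comment> \<open>Here F(c' + X) = t + X * E. Removing the linear part e X leaves the shifted D,
    still of Gauss norm below 1, so E is e up to small terms.\<close>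
  have E: "gn (E - [:e:]) < 1"
  proof -
    have "pCons (t - e * c') (E - [:e:]) = F' - pcompose [:0, e:] [:c', 1:]" unfolding sE s by (simp add: pcompose_pCons mult.commute)
    also have "\<dots> = pcompose D [:c', 1:]" unfolding F'_def F by (simp add: pcompose_add)
    finally have eq: "pCons (t - e * c') (E - [:e:]) = pcompose D [:c', 1:]" .
    have "gn (pcompose D [:c', 1:]) \<le> gn D" using c'1 by (intro gn_pcompose_le) (simp add: gn_pCons)
    then have "gn (pCons (t - e * c') (E - [:e:])) < 1" using D1 unfolding eq by linarith
    then show ?thesis by (simp add: gn_pCons)
  qed
  have E1: "gn E \<le> 1"
    using gn_add_le[of "E - [:e:]" 1 "[:e:]"] E e(1) by (simp add: gn_pCons)
  define Z where "Z = Y - [:c':]"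
  have ZV: "Z \<in> V" unfolding Z_def using YV V_const[of c'] c'1 by (intro VR.diff_in) auto
  have "Z = (Y - [:c:]) + [:c - c':]" by (simp add: Z_def)
  then have ZM: "Z \<in> M" using M_add c(2) M_const[of "c - c'"] c'(2) by metis
  define g where "g = emb G"
  have gV: "g \<in> V" unfolding g_def using V_emb GR by blast
  define EZ where "EZ = pcompose E Z"
  have gZ: "g = [:t:] + Z * EZ"
  proof -
    have "g = pcompose F Y" unfolding g_def F_def Y_def by (simp add: pcompose_ballmap_Yp)
    also have "Y = pcompose [:c', 1:] Z" unfolding Z_def by (simp add: pcompose_pCons)
    also have "pcompose F (pcompose [:c', 1:] Z) = pcompose F' Z" unfolding F'_def by (simp add: pcompose_assoc)
    finally show ?thesis unfolding sE s EZ_def by (simp add: pcompose_pCons)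
  qed
  have EZV: "EZ \<in> V" unfolding EZ_def using pcompose_in_V E1 ZV by blast
  have "pcompose (E - [:e:]) Z \<in> M" using pcompose_in_M E ZV by blast
  then have EZe: "EZ - [:e:] \<in> M" unfolding EZ_def by (simp add: pcompose_diff)
  have EZM: "EZ \<notin> M"
  proof
    assume "EZ \<in> M"
    then have "EZ - (EZ - [:e:]) \<in> M" using EZe M_diff by blast
    then show False using M_const[of e] e(1) by simp
  qed
  have tV: "[:t:] \<in> V" using V_const t1 by blast
  have gt: "g - [:t:] \<in> M" using M_mult[OF EZV ZM] gZ by (simp add: mult.commute)
  define K where "K = (\<Sum>i<q. [:t:] ^ (q - Suc i) * g ^ i)"
  have qsmall: "av (of_nat q) < 1"
  proof -
    obtain m' where "m = Suc m'" using m(1) by (cases m) auto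
    then have "(of_nat q :: 'k) = of_nat p * of_nat (p ^ m')" by (simp add: q_def)
    then show ?thesis using av_mult_less_1[OF av_p_less_1 av_of_nat_le_1] by metis
  qed
  have qM: "of_nat q \<in> M" using M_const[of "of_nat q"] qsmall by (simp add: of_nat_poly)
  have KM: "K \<in> M" unfolding K_def
    by (rule power_quotient_sum_in_ideal[OF V_subring M_add M_mult gV tV gt qM])
  have tqc: "[:t:] ^ q = [:t:]" using tq by (simp add: poly_const_pow)
  \<comment> \<open>Uses t^q = t; K is small, so K - 1 acts as a unit.\<close>
  have gq: "g ^ q - g = (g - [:t:]) * (K - 1)"
  proof -
    have "g ^ q - [:t:] ^ q = (g - [:t:]) * K" unfolding K_def by (rule power_diff_sumr2)
    then have "g ^ q - g = (g - [:t:]) * K - (g - [:t:])" unfolding tqc by (metis diff_diff_eq2 diff_add_cancel)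
    then show ?thesis by (simp only: right_diff_distrib mult_1_right)
  qed
  have K1M: "K - 1 \<notin> M"
  proof
    assume "K - 1 \<in> M"
    then have "K - (K - 1) \<in> M" using KM M_diff by blast
    then show False using one_notin_M by simp
  qed
  have K1V: "K - 1 \<in> V" using KM M_sub VR.one_in by (intro VR.diff_in) auto
  have embq: "emb (G ^ q - G) = g ^ q - g" by (simp add: g_def emb_diff emb_power)
  \<comment> \<open>M meets R exactly in pR, so divisibility by p follows from G being t modulo
    M.\<close>
  have "G ^ q - G \<in> R" using GR by (intro diff_in power_in)
  moreover have "emb (G ^ q - G) \<in> M" unfolding embq gq using M_mult[OF K1V gt] by (simp add: mult.commute)
  ultimately have "G ^ q - G \<in> pdiv p R" using M_emb by blast
  then obtain H where H: "H \<in> R" "G ^ q - G = smult (of_nat p) H" unfolding pdiv_def by blast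
  have gH: "g ^ q - g = smult (of_nat p) (emb H)" using embq H(2) by (simp add: emb_smult)
  have chH: "frobenius_chain p H" using frobenius_chain.step[OF ch m(1)] H(2) unfolding q_def by blast
  \<comment> \<open>Now p * H = u * Z with u outside M. Cancelling u puts Z/p into V, and Z/p is the
    coordinate of the next ball.\<close>
  define u where "u = EZ * (K - 1)"
  have uV: "u \<in> V" unfolding u_def using EZV K1V by (rule VR.mult_in)
  have uM: "u \<notin> M" unfolding u_def using M_prime[OF EZV K1V] EZM K1M by blast
  have "smult (of_nat p) (emb H) = u * Z" using gH gq gZ unfolding u_def by (simp add: mult_ac)
  then have "smult (inverse (of_nat p)) (smult (of_nat p) (emb H)) = smult (inverse (of_nat p)) (u * Z)" by simp
  then have "emb H = u * smult (inverse (of_nat p)) Z" using p_nz by simp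
  then have "u * smult (inverse (of_nat p)) Z \<in> V" using V_emb[of H] H(1) by simp
  then have "smult (inverse (of_nat p)) Z \<in> V" using V_sat uV uM by blast
  moreover have "smult (inverse (of_nat p)) Z = Yp a' (Suc n)"
    unfolding Z_def Y_def Yp_def a'_def using p_nz by (simp add: smult_diff_right field_simps)
  ultimately have YV': "Yp a' (Suc n) \<in> V" by simp
  have Ha': "poly (emb H) a' = 0"
  proof -
    have "poly (g ^ q - g) a' = 0" using Ga' tq by (simp add: g_def)
    then show ?thesis unfolding gH using p_nz by simp
  qed
  \<comment> \<open>The same factorization is repeated with Gauss norms on the smaller ball: there G
    is t + p S with S close to e X, so H becomes S (K' - 1), close to -e X.\<close>
  have "gn (pcompose (emb H) (ballmap a' (Suc n)) - [:0, - e:]) < 1"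
  proof -
    define \<pi> where "\<pi> = [:0, of_nat p :: 'k:]"
    have gpi: "gn \<pi> \<le> 1" unfolding \<pi>_def using av_p_less_1 by (simp add: gn_pCons)
    define T where "T = pcompose g (ballmap a' (Suc n))"
    have "ballmap a' (Suc n) = pcompose (ballmap a n) (pcompose [:c', 1:] \<pi>)"
      by (simp add: ballmap_def a'_def \<pi>_def pcompose_pCons mult.commute)
    then have "T = pcompose F' \<pi>" unfolding T_def F'_def F_def g_def by (simp add: pcompose_assoc)
    define E' where "E' = pcompose E \<pi>"
    define S where "S = [:0, 1:] * E'"
    have T: "T = [:t:] + smult (of_nat p) S"
      unfolding \<open>T = pcompose F' \<pi>\<close> sE s S_def E'_def by (simp add: pcompose_pCons \<pi>_def)
    have "gn (pcompose (E - [:e:]) \<pi>) < 1" using gn_pcompose_le[OF gpi, of "E - [:e:]"] E by linarith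
    then have E'e: "gn (E' - [:e:]) < 1" unfolding E'_def by (simp add: pcompose_diff)
    have "S - [:0, e:] = pCons 0 (E' - [:e:])" by (simp add: S_def)
    then have Se: "gn (S - [:0, e:]) < 1" using E'e by (simp add: gn_pCons)
    have "gn E' \<le> 1" unfolding E'_def using gn_pcompose_le[OF gpi, of E] E1 by linarith
    then have S1: "gn S \<le> 1" unfolding S_def by (simp add: gn_pCons)
    have Tt: "gn (T - [:t:]) < 1"
    proof -
      have "gn (T - [:t:]) = av (of_nat p) * gn S" unfolding T by (simp add: gn_smult)
      also have "\<dots> \<le> av (of_nat p)" using S1 by (intro mult_left_le) auto
      finally show ?thesis using av_p_less_1 by linarith
    qed
    have tt: "gn [:t:] \<le> 1" using t1 by (simp add: gn_pCons)
    have T1: "gn T \<le> 1" using gn_add_le[of "T - [:t:]" 1 "[:t:]"] Tt tt by simp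
    define K' where "K' = (\<Sum>i<q. [:t:] ^ (q - Suc i) * T ^ i)"
    have K': "K' \<in> {P. gn P < 1}" unfolding K'_def
    proof (rule power_quotient_sum_in_ideal[OF gn_subring])
      show "x * y \<in> {P. gn P < 1}" if "x \<in> {P. gn P \<le> 1}" "y \<in> {P. gn P < 1}" for x y
        using that mult_left_le_one_le[of "gn y" "gn x"] by (auto simp: gn_mult)
      show "of_nat q \<in> {P :: 'k poly. gn P < 1}" using qsmall by (simp add: of_nat_poly gn_pCons)
    qed (use Tt T1 tt gn_add_less in auto)
    have "T ^ q - [:t:] ^ q = (T - [:t:]) * K'" unfolding K'_def by (rule power_diff_sumr2)
    then have "T ^ q - T = smult (of_nat p) S * K' - smult (of_nat p) S" unfolding tqc T by (simp add: algebra_simps)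
    moreover have "T ^ q - T = smult (of_nat p) (pcompose (emb H) (ballmap a' (Suc n)))"
      using arg_cong[OF gH, of "\<lambda>x. pcompose x (ballmap a' (Suc n))"]
      by (simp add: T_def pcompose_diff pcompose_smult pcompose_power)
    ultimately have "smult (of_nat p) (pcompose (emb H) (ballmap a' (Suc n))) = smult (of_nat p) (S * K' - S)"
      by (simp add: smult_diff_right)
    then have eq: "pcompose (emb H) (ballmap a' (Suc n)) = S * K' - S" using p_nz by (metis smult_cancel)
    have "S * K' - S - [:0, - e:] = S * K' - (S - [:0, e:])" by simp
    moreover have "gn (S * K') < 1" using S1 K' mult_left_le_one_le[of "gn K'" "gn S"] by (auto simp: gn_mult)
    ultimately show ?thesis unfolding eq using Se gn_diff_less by metis
  qed
  then have "approximant a' (Suc n) H" unfolding approximant_def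
    using chH H(1) YV' Ha' e(1) by (auto intro!: exI[of _ "- e"])
  moreover have "av (a' - a) \<le> exp (- real n)"
    unfolding a'_def using c'1 by (simp add: av_mult av_p_power)
  ultimately show ?thesis by blast
qed

text \<open>G is nonzero because its expansion has a unit slope; as a rational polynomial vanishing
  at a it makes a algebraic, and its chain makes a unramified.\<close>

lemma approximant_imp_ball:
  assumes "approximant a n G"
  shows "admissible v a (enat n)" "a \<in> Op_br v" "unramified_in v a"
proof -
  obtain e where *: "frobenius_chain p G" "poly (emb G) a = 0" "av e = 1"
     "gn (pcompose (emb G) (ballmap a n) - [:0, e:]) < 1" using assms unfolding approximant_def by blast
  show un: "unramified_in v a" using frobenius_chain_unramified * by blast
  have "av a \<le> 1" using frobenius_chain_unramified * by blast
  then show "a \<in> Op_br v" unfolding Op_br_def Op_in_def using unramified_imp_Cp_br[OF un] v_nonneg_iff by auto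
  have "emb G \<noteq> 0"
  proof
    assume "emb G = 0"
    then show False using *(3,4) by (simp add: gn_pCons)
  qed
  then have "a \<in> Qpbar_in v" unfolding Qpbar_in_def using *(2) of_rat_in_Qp by (auto intro!: exI[of _ "emb G"])
  then show "admissible v a (enat n)" by (simp add: admissible_def)
qed

section \<open>The limit of the centres\<close>

text \<open>Let g be f normalized to order 0, so g is in V - M, and write g = g(a) + (X - a) Q.
  Since X - a is p^n times an element of V for every n, the second summand lies in M, and the
  constant g(a) must have absolute value 1.\<close>

lemma limit_point_value:
  assumes "\<And>n. Yp a n \<in> V" "f \<noteq> 0" shows "av (poly (emb f) a) = exp (of_int (- w0 f))"
proof -
  define g where "g = smult (P powi (- w0 f)) f"
  have g: "g \<in> R" "g \<notin> pdiv p R" using w0_normalized[OF assms(2)] unfolding g_def by auto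
  define c where "c = poly (emb g) a"
  define Q where "Q = synthetic_div (emb g) a"
  have s: "emb g = [:c:] + [:- a, 1:] * Q" unfolding c_def Q_def by (rule split_root)
  \<comment> \<open>The power p^n is chosen to make p^n Q smaller than 1 in Gauss norm.\<close>
  obtain n :: nat where n: "exp (- real n) * gn Q < 1"
  proof -
    obtain n :: nat where "real n > gn Q" using reals_Archimedean2 by blast
    then have "exp (real n) > gn Q" using exp_ge_add_one_self[of "real n"] by linarith
    then show ?thesis using that[of n] by (simp add: exp_minus field_simps)
  qed
  have "gn (smult (of_nat p ^ n) Q) < 1" using n by (simp add: gn_smult av_p_power)
  then have "pcompose (smult (of_nat p ^ n) Q) [:0, 1:] \<in> M" using X_in_V by (rule pcompose_in_M)
  then have "Yp a n * smult (of_nat p ^ n) Q \<in> M" unfolding pcompose_idR by (rule M_mult[OF assms(1)])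
  moreover have "Yp a n * smult (of_nat p ^ n) Q = [:- a, 1:] * Q"
    unfolding Yp_def mult_smult_left mult_smult_right using p_nz by simp
  ultimately have d: "[:- a, 1:] * Q \<in> M" by simp
  have gM: "emb g \<notin> M" using M_emb g by blast
  have "emb g \<in> V" using V_emb g by blast
  then have "emb g - [:- a, 1:] * Q \<in> V" using d M_sub by (intro VR.diff_in) auto
  then have "[:c:] \<in> V" using s by (metis add_diff_cancel_right')
  moreover have "[:c:] \<notin> M" using gM s d M_add by metis
  ultimately have c1: "av c = 1" using V_const[of c] M_const[of c] by linarith
  have "f = smult (P powi (w0 f)) g" unfolding g_def using P0 by (simp add: power_int_minus)
  then have "poly (emb f) a = of_rat (P powi (w0 f)) * c" unfolding c_def by (metis emb_smult poly_smult)
  then have "av (poly (emb f) a) = av (of_rat (P powi (w0 f)))" using c1 by (simp add: av_mult)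
  also have "\<dots> = exp (of_int (- w0 f))"
  proof (cases "w0 f \<ge> 0")
    case True
    then show ?thesis by (simp add: power_int_def of_rat_power av_power av_P exp_of_nat_mult[symmetric])
  next
    case False
    then show ?thesis
      by (simp add: power_int_def of_rat_power of_rat_inverse av_inverse av_power av_P exp_of_nat_mult[symmetric] exp_minus)
  qed
  finally show ?thesis .
qed

text \<open>The formula |f(a)| = exp(-w0 f) carries everything: f(a) is never 0 for nonzero f,
  valuations are integers, and |f(a)| is at most 1 exactly on R.\<close>

lemma limit_point:
  assumes "\<And>n. Yp a n \<in> V"
  shows "admissible v a \<infinity>" "a \<in> Op_br v" "unramified_in v a" "R = Int_Q v (closed_ball_p v a \<infinity>)"
proof -
  have val: "av (poly (emb f) a) = exp (of_int (- w0 f))" if "f \<noteq> 0" for f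
    using limit_point_value assms that by blast
  have Y0: "[:- a, 1:] \<in> V" using assms[of 0] by (simp add: Yp_def)
  have "[:a:] = [:0, 1:] - [:- a, 1:]" by simp
  also have "\<dots> \<in> V" using Y0 X_in_V by (rule VR.diff_in[rotated])
  finally have a1: "av a \<le> 1" using V_const by blast
  show un: "unramified_in v a"
  proof (rule unramifiedI[OF a1])
    fix f show "intval (poly (emb f) a)" using val[of f] unfolding intval_def by (cases "f = 0") (simp, blast)
  qed
  show "a \<in> Op_br v" unfolding Op_br_def Op_in_def using unramified_imp_Cp_br[OF un] v_nonneg_iff a1 by auto
  have "poly (emb f) a \<noteq> 0" if "f \<noteq> 0" for f using val[OF that] by auto
  then show "admissible v a \<infinity>" by (auto simp: admissible_def transcendental_over_Q_def emb_def)
  have "f \<in> R \<longleftrightarrow> av (poly (emb f) a) \<le> 1" for f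
    using val[of f] w0_nonneg_iff[of f] zero_in by (cases "f = 0") auto
  then show "R = Int_Q v (closed_ball_p v a \<infinity>)" unfolding Int_Q_point by blast
qed

lemma ball_exists:
  "\<exists>a d. admissible v a d \<and> a \<in> Op_br v \<and> unramified_in v a \<and> R = Int_Q v (closed_ball_p v a d)"
proof (cases "\<exists>a n G. approximant a n G \<and> R = Int_Q v (closed_ball_p v a (enat n))")
  case True
  then show ?thesis using approximant_imp_ball by blast
next
  case False
  have "\<exists>s. \<forall>n. approximant (fst (s n)) n (snd (s n)) \<and> av (fst (s (Suc n)) - fst (s n)) \<le> exp (- real n)"
  proof (rule dependent_nat_choice)
    show "\<exists>x. approximant (fst x) 0 (snd x)" using approximant_0 by auto
    show "\<exists>y. approximant (fst y) (Suc n) (snd y) \<and> av (fst y - fst x) \<le> exp (- real n)"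
      if "approximant (fst x) n (snd x)" for x n
      using approximant_step[OF that] False that by fastforce
  qed
  then obtain s where s: "\<And>n. approximant (fst (s n)) n (snd (s n))"
    "\<And>n. av (fst (s (Suc n)) - fst (s n)) \<le> exp (- real n)" by blast
  define a where "a n = fst (s n)" for n
  have near: "av (a (n + k) - a n) \<le> exp (- real n)" for n k
  proof (induction k)
    case (Suc k)
    have "av (a (n + Suc k) - a (n + k)) \<le> exp (- real (n + k))" using s(2)[of "n + k"] by (simp add: a_def)
    also have "\<dots> \<le> exp (- real n)" by simp
    finally have "av ((a (n + Suc k) - a (n + k)) + (a (n + k) - a n)) \<le> exp (- real n)" using Suc by (rule av_add_le)
    then show ?case by simp
  qed simp
  have near': "av (a m - a n) \<le> exp (- real n)" if "n \<le> m" for m n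
    using near[of n "m - n"] that by simp
  have "\<exists>L. \<forall>M::real. \<exists>N. \<forall>n\<ge>N. v (a n - L) \<ge> ereal M"
  proof (rule complete, rule allI)
    fix B :: real
    obtain N :: nat where N: "real N > B" using reals_Archimedean2 by blast
    have "v (a m - a n) \<ge> ereal B" if "m \<ge> N" "n \<ge> N" for m n
    proof -
      have "av ((a m - a N) - (a n - a N)) \<le> exp (- real N)" by (rule av_diff_le[OF near'[OF that(1)] near'[OF that(2)]])
      also have "\<dots> \<le> exp (- B)" using N by simp
      finally show ?thesis unfolding v_ge_iff by simp
    qed
    then show "\<exists>N. \<forall>m\<ge>N. \<forall>n\<ge>N. v (a m - a n) \<ge> ereal B" by blast
  qed
  then obtain L where L: "\<And>B. \<exists>N. \<forall>n\<ge>N. v (a n - L) \<ge> ereal B" by blast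
  have aL: "av (a n - L) \<le> exp (- real n)" for n
  proof -
    obtain N where N: "\<forall>k\<ge>N. v (a k - L) \<ge> ereal (real n)" using L by blast
    define k where "k = max N n"
    have "av (a k - L) \<le> exp (- real n)" using N unfolding k_def v_ge_iff by simp
    moreover have "av (a k - a n) \<le> exp (- real n)" unfolding k_def by (rule near') simp
    ultimately have "av ((a k - L) - (a k - a n)) \<le> exp (- real n)" by (rule av_diff_le)
    then show ?thesis by simp
  qed
  \<comment> \<open>The limit stays in every ball, so moving the centre from a n to L changes the
    coordinate by an integral constant.\<close>
  have "Yp L n \<in> V" for n
  proof -
    have "Yp (a n) n \<in> V" using s(1)[of n] unfolding approximant_def a_def by blast
    moreover have "[:(a n - L) / of_nat p ^ n:] \<in> V" using aL[of n] V_const by (simp add: av_divide av_p_power)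
    moreover have "Yp L n = Yp (a n) n + [:(a n - L) / of_nat p ^ n:]"
      unfolding Yp_def using p_nz by (simp add: field_simps)
    ultimately show ?thesis using VR.add_in by simp
  qed
  then show ?thesis using limit_point by blast
qed

end

lemma (in cp_ring) separated_imp_ball:
  "\<exists>a d. admissible v a d \<and> a \<in> Op_br v \<and> unramified_in v a \<and> R = Int_Q v (closed_ball_p v a d)"
  using valuation_extension_exists valuation_extension.ball_exists by blast

theorem mainTheorem13:
  fixes p :: nat and R :: "rat poly set" and v :: "'k::field_char_0 \<Rightarrow> ereal"
  assumes "prime p"
    and "is_Cp_model p v"
    and "is_subring R"
    and "Zloc_poly p \<subseteq> R"
  shows "(is_UFD R \<longleftrightarrow>
            R = UNIV \<or>
            (\<exists>W. is_DVR_of_QX W \<and> DVR_contract_Q W = Zloc p \<and> DVR_unramified W \<and>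
                 R = DVR_contract_QX W))
       \<and> ((\<exists>W. is_DVR_of_QX W \<and> DVR_contract_Q W = Zloc p \<and> DVR_unramified W \<and>
                 R = DVR_contract_QX W) \<longleftrightarrow>
          (\<exists>a d. admissible v a d \<and> a \<in> Op_br v \<and> unramified_in v a \<and>
                 R = Int_Q v (closed_ball_p v a d)))"
proof -
  interpret p_overring R p using assms by unfold_locales
  interpret cp_model p v using assms by unfold_locales
  have valued: "p_valued_ring R p" if "p_prime_separated p R" using that by unfold_locales
  have DVR: "(\<exists>W. is_DVR_of_QX W \<and> DVR_contract_Q W = Zloc p \<and> DVR_unramified W \<and> R = DVR_contract_QX W)
      \<longleftrightarrow> p_prime_separated p R"
    using p_valued_ring.DVR_exists[OF valued] DVR_imp_separated by blast
  have UFD: "is_UFD R \<longleftrightarrow> R = UNIV \<or> p_prime_separated p R"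
    using p_valued_ring.is_UFD[OF valued] UFD_imp_separated is_UFD_rat_poly by blast
  have "p_prime_separated p R \<longleftrightarrow>
      (\<exists>a d. admissible v a d \<and> a \<in> Op_br v \<and> unramified_in v a \<and> R = Int_Q v (closed_ball_p v a d))"
  proof
    assume "p_prime_separated p R"
    then interpret cp_ring p v R by unfold_locales
    show "\<exists>a d. admissible v a d \<and> a \<in> Op_br v \<and> unramified_in v a \<and> R = Int_Q v (closed_ball_p v a d)"
      by (rule separated_imp_ball)
  next
    assume "\<exists>a d. admissible v a d \<and> a \<in> Op_br v \<and> unramified_in v a \<and> R = Int_Q v (closed_ball_p v a d)"
    then show "p_prime_separated p R" using ball_imp_separated p_overring_axioms by blast
  qed
  then show ?thesis unfolding DVR UFD by blast
qed

end
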